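(* Let $(X,\mathfrak A,P)$ be a probability space, $(Y,\mathfrak B,Q)$ a complete probability space, and $R$ a probability measure on $\mathfrak A\otimes\mathfrak B$ with marginals $P$ and $Q$. If $R\ll P\otimes Q$, then there exist a product regular conditional probability $\{T_y:y\in Y\}$ on $\mathfrak A$ for $R$ with respect to $Q$ and a lifting $\rho'\in\Lambda(Q)$ such that, for all $A\in\mathfrak A$, $B\in\mathfrak B$, $$R(A\times B)=0\ \Longrightarrow\ Q(B)=0\ \text{ or }\ T_y(A)=0\text{ for all }y\in\rho'(B),$$ and there exist liftings $\sigma_y\in\Lambda(\widehat T_y)$ for all $y\in Y$ as well as a lifting $\varpi\in\Lambda(\widehat R)$ such that: (i) $[\varpi(E)]^y=\sigma_y([\varpi(E)]^y)$ for all $y\in Y$ and all $E\in\mathfrak A\widehat\otimes_R\mathfrak B$; (ii) $\varpi(A\times B)=\bigcup_{y\in\rho'(B)}(\sigma_y(A)\times\{y\})$ for all $A\in\mathfrak A$ and all $B\in\mathfrak B$.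
   Context: For a probability space $(Z,\mathfrak Z,S)$, $(Z,\widehat{\mathfrak Z},\widehat S)$ denotes its completion. A lower density on $(Z,\mathfrak Z,S)$ is a map $\delta:\mathfrak Z\to\mathfrak Z$ such that $\delta(A)=A$ a.e. $(S)$; $A=B$ a.e. implies $\delta(A)=\delta(B)$; $\delta(\varnothing)=\varnothing$, $\delta(Z)=Z$; $\delta(A\cap B)=\delta(A)\cap\delta(B)$. A lifting is a lower density with in addition $\delta(A^c)=\delta(A)^c$. $\Lambda(S)$ is the set of all liftings on $(Z,\mathfrak Z,S)$. $\mathfrak A\otimes\mathfrak B$ is the product $\sigma$-algebra, $P\otimes Q$ the product measure; $(X\times Y,\mathfrak A\widehat\otimes_R\mathfrak B,\widehat R)$ is the completion of $(X\times Y,\mathfrak A\otimes\mathfrak B,R)$. A product regular conditional probability on $\mathfrak A$ for $R$ with respect to $Q$ is a family $\{T_y:y\in Y\}$ of probability measures on $\mathfrak A$ such that $y\mapsto T_y(A)$ is $\mathfrak B$-measurable for each $A\in\mathfrak A$, and $R(A\times B)=\int_B T_y(A)\,dQ(y)$ for all $A\in\mathfrak A$, $B\in\mathfrak B$. $\widehat T_y$ is the completion of $T_y$; liftings in $\Lambda(\widehat T_y)$ are defined on the completion of $\mathfrak A$ with respect to $T_y$. For $E\subseteq X\times Y$ and $y\in Y$, $E^y=\{x\in X:(x,y)\in E\}$. The equality in (i) includes the assertion that the section is $\widehat T_y$-measurable. *)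

theory Defs
  imports "HOL-Probability.Probability"
begin

text \<open>Densities and liftings are total functions on sets of which only the values on
  \<^term>\<open>sets S\<close> matter. Neither notion presupposes that \<^term>\<open>S\<close> is complete.\<close>

definition lower_density :: "'a measure \<Rightarrow> ('a set \<Rightarrow> 'a set) \<Rightarrow> bool" where
  "lower_density S \<delta> \<longleftrightarrow>
     (\<forall>A\<in>sets S. \<delta> A \<in> sets S) \<and>
     (\<forall>A\<in>sets S. AE z in S. z \<in> \<delta> A \<longleftrightarrow> z \<in> A) \<and>
     (\<forall>A\<in>sets S. \<forall>B\<in>sets S. (AE z in S. z \<in> A \<longleftrightarrow> z \<in> B) \<longrightarrow> \<delta> A = \<delta> B) \<and>
     \<delta> {} = {} \<and> \<delta> (space S) = space S \<and>
     (\<forall>A\<in>sets S. \<forall>B\<in>sets S. \<delta> (A \<inter> B) = \<delta> A \<inter> \<delta> B)"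

definition liftings :: "'a measure \<Rightarrow> ('a set \<Rightarrow> 'a set) set" where
  "liftings S = {\<delta>. lower_density S \<delta> \<and> (\<forall>A\<in>sets S. \<delta> (space S - A) = space S - \<delta> A)}"

text \<open>The argument \<^term>\<open>P\<close> contributes only its \<open>\<sigma>\<close>-algebra.
  The members \<open>T y\<close> of the family are unconstrained for \<open>y\<close> outside \<^term>\<open>space Q\<close>.\<close>

definition product_rcp ::
  "'a measure \<Rightarrow> 'b measure \<Rightarrow> ('a \<times> 'b) measure \<Rightarrow> ('b \<Rightarrow> 'a measure) \<Rightarrow> bool" where
  "product_rcp P Q R T \<longleftrightarrow>
     (\<forall>y\<in>space Q. prob_space (T y) \<and> sets (T y) = sets P) \<and>
     (\<forall>A\<in>sets P. (\<lambda>y. emeasure (T y) A) \<in> borel_measurable Q) \<and>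
     (\<forall>A\<in>sets P. \<forall>B\<in>sets Q. emeasure R (A \<times> B) = (\<integral>\<^sup>+y\<in>B. emeasure (T y) A \<partial>Q))"

definition hsection :: "('a \<times> 'b) set \<Rightarrow> 'b \<Rightarrow> 'a set" where
  "hsection E y = {x. (x, y) \<in> E}"

end

theory Submission
  imports Defs
begin

text \<open>Call a lifting \<open>s\<close> of \<open>M\<close> section-compatible with \<open>Q\<close> if, for every \<open>E\<close> in the product \<open>\<sigma>\<close>-algebra,
  \<open>{(x, y). x \<in> s (E\<^sup>y)}\<close> equals \<open>E\<close> almost everywhere. Such liftings exist for arbitrary probability spaces \<open>M\<close> and
  \<open>Q\<close>: in the Zorn argument behind von Neumann and Maharam's theorem the compatibility survives adjoining one set,
  and it survives countable limits because the conditional probabilities of all sections \<open>E\<^sup>y\<close> given a sub-\<open>\<sigma>\<close>-algebra can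
  be read off one jointly measurable function, to which Levy's zero-one law and Fubini apply.

  Let \<open>s\<close> and \<open>\<rho>\<close> be such liftings for \<open>P\<close> (compatible with \<open>Q\<close>) and for \<open>Q\<close> (compatible with \<open>P\<close>). For fixed \<open>y\<close> the
  map \<open>E \<mapsto> s {x. y \<in> \<rho> (E\<^sub>x)}\<close> is a homomorphism on those \<open>E\<close> for which the set is measurable; Sikorski's theorem
  extends it to a homomorphism \<open>H y\<close> into the \<open>s\<close>-fixed sets, and for each \<open>E\<close> we have \<open>H y E = s (E\<^sup>y)\<close> for almost every
  \<open>y\<close>. Gluing the \<open>H y E\<close> gives the lifting of the product measure. If \<open>f\<close> is the density of \<open>R\<close> and \<open>N = {f > 0}\<close>,
  one passes to \<open>R\<close> by pulling back along a retraction of each fibre onto \<open>H y N\<close>, the support of \<open>f(\<cdot>, y) P\<close>. The null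
  set of exceptional \<open>y\<close> is removed by copying everything from one regular \<open>y\<close>.\<close>

section \<open>Homomorphisms of set algebras\<close>

text \<open>The set {(x, y). x \<in> s (E^y)} has the right sections, but it is not determined by
  the class of E: a null set E may have large sections over a null set of y, whereas (i) speaks
  about every y. This is why \<rho> enters through {x. y \<in> \<rho> (E_x)}: for null E almost
  every E_x is null and is sent to the empty set, so the result is null for every y. The price is
  that this set may fail to be measurable for some y, so for each y only an algebra of sets E is
  admissible. Sikorski's theorem fits: its domain may be any algebra, and its target, the fixed sets
  of a lifting, is complete, so the extended values are fixed, as (i) demands. Compatibility of
  \<rho> makes E admissible with the right value for almost all y; compatibility of s makes the
  glued set equal to E almost everywhere. The null set of bad y depends on E. Changing y on one null
  set therefore has to secure only two conditions for every y: the fibre of f has integral 1, and H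
  y N = s (N^y).\<close>

lemma partial_map_Zorn:
  fixes V :: "'b set \<Rightarrow> ('b \<Rightarrow> 'c) \<Rightarrow> bool"
  assumes start: "V D0 f0"
    and chain: "\<And>C. C \<noteq> {} \<Longrightarrow> (\<And>D f. (D, f) \<in> C \<Longrightarrow> V D f) \<Longrightarrow>
      (\<And>D f D' f'. (D, f) \<in> C \<Longrightarrow> (D', f') \<in> C \<Longrightarrow>
        D \<subseteq> D' \<and> (\<forall>x\<in>D. f' x = f x) \<or> D' \<subseteq> D \<and> (\<forall>x\<in>D'. f x = f' x)) \<Longrightarrow>
      \<exists>D f. V D f \<and> (\<forall>(D', f')\<in>C. D' \<subseteq> D \<and> (\<forall>x\<in>D'. f x = f' x))"
  shows "\<exists>D f. V D f \<and> (\<forall>D' f'. V D' f' \<and> D \<subseteq> D' \<and> (\<forall>x\<in>D. f' x = f x) \<longrightarrow> D' = D)"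
proof -
  \<comment> \<open>Inclusion of graphs is extension of partial maps. Values outside
    \<open>D\<close> do not enter the graph, so maximality is expressed by
    \<open>D' = D\<close>.\<close>
  define gr :: "'b set \<times> ('b \<Rightarrow> 'c) \<Rightarrow> ('b \<times> 'c) set"
    where "gr = (\<lambda>(D, f). (\<lambda>x. (x, f x)) ` D)"
  have gr_le: "gr (D, f) \<subseteq> gr (D', f') \<longleftrightarrow> D \<subseteq> D' \<and> (\<forall>x\<in>D. f' x = f x)" for D f D' f'
    by (auto simp: gr_def image_iff subset_eq)
  define \<A> where "\<A> = gr ` {(D, f). V D f}"
  have max_ex: "\<exists>M\<in>\<A>. \<forall>X\<in>\<A>. M \<subseteq> X \<longrightarrow> X = M"
  proof (rule subset_Zorn)
    fix K assume K: "subset.chain \<A> K"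
    show "\<exists>U\<in>\<A>. \<forall>X\<in>K. X \<subseteq> U"
    proof (cases "K = {}")
      case True
      then show ?thesis using start by (auto simp: \<A>_def)
    next
      case False
      define C where "C = {(D, f). V D f \<and> gr (D, f) \<in> K}"
      have KC: "\<exists>D f. (D, f) \<in> C \<and> X = gr (D, f)" if "X \<in> K" for X
        using K that by (force simp: C_def \<A>_def subset.chain_def)
      have "C \<noteq> {}" using False KC by fast
      moreover have "V D f" if "(D, f) \<in> C" for D f using that by (simp add: C_def)
      moreover have "D \<subseteq> D' \<and> (\<forall>x\<in>D. f' x = f x) \<or> D' \<subseteq> D \<and> (\<forall>x\<in>D'. f x = f' x)"
        if "(D, f) \<in> C" "(D', f') \<in> C" for D f D' f'
      proof -
        have "gr (D, f) \<in> K" "gr (D', f') \<in> K" using that by (auto simp: C_def)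
        then have "gr (D, f) \<subseteq> gr (D', f') \<or> gr (D', f') \<subseteq> gr (D, f)"
          using K unfolding subset.chain_def by blast
        then show ?thesis by (simp only: gr_le)
      qed
      ultimately have "\<exists>D f. V D f \<and> (\<forall>(D', f')\<in>C. D' \<subseteq> D \<and> (\<forall>x\<in>D'. f x = f' x))"
        by (rule chain)
      then obtain D f where Df: "V D f" "\<forall>(D', f')\<in>C. D' \<subseteq> D \<and> (\<forall>x\<in>D'. f x = f' x)"
        by blast
      have "X \<subseteq> gr (D, f)" if X: "X \<in> K" for X
      proof -
        obtain D' f' where D': "(D', f') \<in> C" "X = gr (D', f')" using KC[OF X] by blast
        then have "D' \<subseteq> D \<and> (\<forall>x\<in>D'. f x = f' x)" using Df(2) by blast
        then show ?thesis unfolding D'(2) gr_le .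
      qed
      then show ?thesis using Df(1) by (auto simp: \<A>_def)
    qed
  qed
  obtain D f where "V D f" and max: "\<And>X. X \<in> \<A> \<Longrightarrow> gr (D, f) \<subseteq> X \<Longrightarrow> X = gr (D, f)"
  proof -
    obtain M where M: "M \<in> \<A>" "\<And>X. X \<in> \<A> \<Longrightarrow> M \<subseteq> X \<Longrightarrow> X = M"
      using max_ex by blast
    then obtain D f where "V D f" "M = gr (D, f)" by (auto simp: \<A>_def)
    with M show thesis using that by blast
  qed
  have "D' = D" if "V D' f'" "D \<subseteq> D'" "\<forall>x\<in>D. f' x = f x" for D' f'
  proof -
    have "gr (D', f') = gr (D, f)"
      using that by (intro max) (auto simp: \<A>_def gr_le)
    then have "fst ` gr (D', f') = fst ` gr (D, f)" by simp
    then show ?thesis by (simp add: gr_def image_image)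
  qed
  with \<open>V D f\<close> show ?thesis by blast
qed

text \<open>In a maximal \<open>U\<close>, a set outside \<open>U\<close> must be disjoint from some
  member of \<open>U\<close>, as otherwise \<open>U\<close> could be enlarged by it. If this
  happened to a set and to its complement, two members of \<open>U\<close> would be
  disjoint.\<close>

lemma extend_to_ultrafilter:
  assumes "algebra \<Omega> \<G>" and F: "F \<subseteq> \<G>" "\<Omega> \<in> F" "{} \<notin> F" "\<And>A B. A \<in> F \<Longrightarrow> B \<in> F \<Longrightarrow> A \<inter> B \<in> F"
  shows "\<exists>U. F \<subseteq> U \<and> U \<subseteq> \<G> \<and> {} \<notin> U \<and> (\<forall>A\<in>U. \<forall>B\<in>U. A \<inter> B \<in> U) \<and>
    (\<forall>A\<in>\<G>. A \<in> U \<or> \<Omega> - A \<in> U)"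
proof -
  interpret algebra \<Omega> \<G> by fact
  define Z where "Z = {U. F \<subseteq> U \<and> U \<subseteq> \<G> \<and> {} \<notin> U \<and> (\<forall>A\<in>U. \<forall>B\<in>U. A \<inter> B \<in> U)}"
  have "\<exists>U\<in>Z. \<forall>X\<in>Z. U \<subseteq> X \<longrightarrow> X = U"
  proof (rule subset_Zorn_nonempty)
    have "F \<in> Z" using F by (auto simp: Z_def)
    then show "Z \<noteq> {}" by auto
    fix C assume C: "C \<noteq> {}" "subset.chain Z C"
    have CZ: "F \<subseteq> X" "X \<subseteq> \<G>" "{} \<notin> X" "\<And>A B. A \<in> X \<Longrightarrow> B \<in> X \<Longrightarrow> A \<inter> B \<in> X" if "X \<in> C" for X
      using C that by (auto simp: subset.chain_def Z_def)
    have "A \<inter> B \<in> \<Union>C" if AB: "A \<in> X" "X \<in> C" "B \<in> Y" "Y \<in> C" for A B X Y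
    proof -
      have XY: "X \<subseteq> Y \<or> Y \<subseteq> X" using C AB by (auto simp: subset.chain_def)
      then have "A \<inter> B \<in> X \<or> A \<inter> B \<in> Y" using CZ(4) AB by (metis subsetD)
      then show ?thesis using AB by blast
    qed
    then have "\<forall>A\<in>\<Union>C. \<forall>B\<in>\<Union>C. A \<inter> B \<in> \<Union>C" by (intro ballI) (elim UnionE)
    moreover have "F \<subseteq> \<Union>C" using C(1) CZ(1) by fast
    moreover have "\<Union>C \<subseteq> \<G>" using CZ(2) by fast
    moreover have "{} \<notin> \<Union>C" using CZ(3) by fast
    ultimately show "\<Union>C \<in> Z" by (simp add: Z_def)
  qed
  then obtain U where U: "U \<in> Z" and max: "\<And>X. X \<in> Z \<Longrightarrow> U \<subseteq> X \<Longrightarrow> X = U" by blast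
  have disj: "\<exists>B\<in>U. B \<inter> A = {}" if A: "A \<in> \<G>" "A \<notin> U" for A
  proof (rule ccontr)
    assume neg: "\<not> ?thesis"
    \<comment> \<open>The filter in \<open>\<G>\<close> generated by \<open>U\<close> and
      \<open>A\<close>. The negated claim says that \<open>A\<close> meets every member of
      \<open>U\<close>, so this filter omits the empty set.\<close>
    define U' where "U' = {C \<in> \<G>. \<exists>B\<in>U. B \<inter> A \<subseteq> C}"
    have "U \<subseteq> U'" using U by (auto simp: U'_def Z_def)
    moreover have "U' \<in> Z"
    proof -
      have UZ: "F \<subseteq> U" "\<And>A B. A \<in> U \<Longrightarrow> B \<in> U \<Longrightarrow> A \<inter> B \<in> U" using U by (auto simp: Z_def)
      have "X \<inter> Y \<in> U'" if XY: "X \<in> U'" "Y \<in> U'" for X Y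
      proof -
        obtain B1 B2 where B: "B1 \<in> U" "B2 \<in> U" "B1 \<inter> A \<subseteq> X" "B2 \<inter> A \<subseteq> Y"
          using XY by (auto simp: U'_def)
        then have "B1 \<inter> B2 \<in> U" "(B1 \<inter> B2) \<inter> A \<subseteq> X \<inter> Y" using UZ(2) by auto
        moreover have "X \<inter> Y \<in> \<G>" using XY by (auto simp: U'_def)
        ultimately show ?thesis unfolding U'_def by blast
      qed
      moreover have "{} \<notin> U'" using neg by (auto simp: U'_def)
      moreover have "F \<subseteq> U'" using \<open>U \<subseteq> U'\<close> UZ(1) by (rule order_trans[rotated])
      moreover have "U' \<subseteq> \<G>" by (auto simp: U'_def)
      ultimately show ?thesis unfolding Z_def by simp
    qed
    ultimately have "U' = U" by (rule max[rotated])
    moreover have "A \<in> U'" using A(1) U F(2) by (force simp: U'_def Z_def)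
    ultimately show False using A by simp
  qed
  have "A \<in> U \<or> \<Omega> - A \<in> U" if A: "A \<in> \<G>" for A
  proof (rule ccontr)
    assume neg: "\<not> ?thesis"
    then obtain B where B: "B \<in> U" "B \<inter> A = {}" using disj A by blast
    obtain B' where B': "B' \<in> U" "B' \<inter> (\<Omega> - A) = {}" using disj[of "\<Omega> - A"] A neg by blast
    have "B \<subseteq> \<Omega>" using B U sets_into_space by (auto simp: Z_def)
    then have "B \<inter> B' = {}" using B B' by blast
    then show False using U B B' unfolding Z_def by (metis (mono_tags, lifting) mem_Collect_eq)
  qed
  then show ?thesis using U by (auto simp: Z_def)
qed

text \<open>A Boolean homomorphism from the quotient of \<open>\<G>\<close> by the ideal
  \<open>\<N>\<close> into the power set of \<Omega>', written on representatives. Nothing ties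
  \<open>h A\<close> to \<open>A\<close>, so the notion covers liftings as well as maps between
  different spaces, and values may be nonmeasurable.\<close>

definition set_hom :: "'a set \<Rightarrow> 'a set set \<Rightarrow> 'a set set \<Rightarrow> 'b set \<Rightarrow> ('a set \<Rightarrow> 'b set) \<Rightarrow> bool" where
  "set_hom \<Omega> \<N> \<G> \<Omega>' h \<longleftrightarrow>
     (\<forall>A\<in>\<G>. h A \<subseteq> \<Omega>') \<and> (\<forall>A\<in>\<G>. h (\<Omega> - A) = \<Omega>' - h A) \<and>
     (\<forall>A\<in>\<G>. \<forall>B\<in>\<G>. h (A \<inter> B) = h A \<inter> h B) \<and> (\<forall>A\<in>\<G> \<inter> \<N>. h A = {})"

lemma set_homI:
  assumes "\<And>A. A \<in> \<G> \<Longrightarrow> h A \<subseteq> \<Omega>'" "\<And>A. A \<in> \<G> \<Longrightarrow> h (\<Omega> - A) = \<Omega>' - h A"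
    "\<And>A B. A \<in> \<G> \<Longrightarrow> B \<in> \<G> \<Longrightarrow> h (A \<inter> B) = h A \<inter> h B" "\<And>A. A \<in> \<G> \<Longrightarrow> A \<in> \<N> \<Longrightarrow> h A = {}"
  shows "set_hom \<Omega> \<N> \<G> \<Omega>' h"
  using assms by (simp add: set_hom_def)

lemma set_homD:
  assumes "set_hom \<Omega> \<N> \<G> \<Omega>' h"
  shows "A \<in> \<G> \<Longrightarrow> h A \<subseteq> \<Omega>'" "A \<in> \<G> \<Longrightarrow> h (\<Omega> - A) = \<Omega>' - h A"
    "A \<in> \<G> \<Longrightarrow> B \<in> \<G> \<Longrightarrow> h (A \<inter> B) = h A \<inter> h B" "A \<in> \<G> \<Longrightarrow> A \<in> \<N> \<Longrightarrow> h A = {}"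
  using assms by (auto simp: set_hom_def)

lemma set_hom_diff:
  assumes h: "set_hom \<Omega> \<N> \<G> \<Omega>' h" and "algebra \<Omega> \<G>" and AB: "A \<in> \<G>" "B \<in> \<G>"
  shows "h (A - B) = h A - h B"
proof -
  interpret algebra \<Omega> \<G> by fact
  have "A - B = A \<inter> (\<Omega> - B)" using AB sets_into_space by blast
  then have "h (A - B) = h A \<inter> (\<Omega>' - h B)"
    using set_homD[OF h] AB by (metis compl_sets)
  then show ?thesis using set_homD(1)[OF h AB(1)] by blast
qed

lemma set_hom_mono:
  assumes h: "set_hom \<Omega> \<N> \<G> \<Omega>' h" and "algebra \<Omega> \<G>" and AB: "A \<in> \<G>" "B \<in> \<G>" "A - B \<in> \<N>"
  shows "h A \<subseteq> h B"
proof -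
  interpret algebra \<Omega> \<G> by fact
  have "h (A - B) = {}" using set_homD(4)[OF h] AB by auto
  then show ?thesis using set_hom_diff[OF assms(1-4)] by blast
qed

lemma set_hom_cong_null:
  assumes h: "set_hom \<Omega> \<N> \<G> \<Omega>' h" and "algebra \<Omega> \<G>" and AB: "A \<in> \<G>" "B \<in> \<G>" "A - B \<in> \<N>" "B - A \<in> \<N>"
  shows "h A = h B"
  using set_hom_mono[OF assms(1,2)] AB by (intro equalityI) auto

lemma set_hom_disjoint:
  assumes h: "set_hom \<Omega> \<N> \<G> \<Omega>' h" and "algebra \<Omega> \<G>" and AB: "A \<in> \<G>" "B \<in> \<G>" "A \<inter> B \<in> \<N>"
  shows "h A \<inter> h B = {}"
proof -
  interpret algebra \<Omega> \<G> by fact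
  show ?thesis using set_homD(3,4)[OF h] AB by (metis Int)
qed

lemma set_hom_whole:
  assumes h: "set_hom \<Omega> \<N> \<G> \<Omega>' h" and "algebra \<Omega> \<G>" and "{} \<in> \<N>"
  shows "h \<Omega> = \<Omega>'" "h {} = {}"
proof -
  interpret algebra \<Omega> \<G> by fact
  show "h {} = {}" using set_homD(4)[OF h] assms by auto
  then show "h \<Omega> = \<Omega>'" using set_homD(2)[OF h, of "{}"] by auto
qed

text \<open>At each point the sets whose density contains it form a filter base that includes all
  complements of null sets. An ultrafilter above this base decides whether the point belongs to
  \<open>h A\<close>. This is the classical passage from a lower density to a lifting.\<close>

lemma set_hom_above_density:
  assumes "algebra \<Omega> \<G>" and "{} \<in> \<N>"
    and \<delta>: "\<And>A B. A \<in> \<G> \<Longrightarrow> B \<in> \<G> \<Longrightarrow> \<delta> (A \<inter> B) = \<delta> A \<inter> \<delta> B"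
      "\<delta> {} = {}" "\<And>A. A \<in> \<G> \<Longrightarrow> A \<in> \<N> \<Longrightarrow> \<delta> (\<Omega> - A) = \<Omega>'"
  shows "\<exists>h. set_hom \<Omega> \<N> \<G> \<Omega>' h \<and> (\<forall>A\<in>\<G>. \<delta> A \<inter> \<Omega>' \<subseteq> h A)"
proof -
  interpret algebra \<Omega> \<G> by fact
  have "\<exists>U. {A \<in> \<G>. x \<in> \<delta> A} \<subseteq> U \<and> U \<subseteq> \<G> \<and> {} \<notin> U \<and> (\<forall>A\<in>U. \<forall>B\<in>U. A \<inter> B \<in> U) \<and>
      (\<forall>A\<in>\<G>. A \<in> U \<or> \<Omega> - A \<in> U)" if x: "x \<in> \<Omega>'" for x
  proof -
    have F: "{A \<in> \<G>. x \<in> \<delta> A} \<subseteq> \<G>" "\<Omega> \<in> {A \<in> \<G>. x \<in> \<delta> A}" "{} \<notin> {A \<in> \<G>. x \<in> \<delta> A}"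
      using \<delta> x assms(2) \<delta>(3)[of "{}"] by auto
    have F_Int: "A \<inter> B \<in> {A \<in> \<G>. x \<in> \<delta> A}"
      if "A \<in> {A \<in> \<G>. x \<in> \<delta> A}" "B \<in> {A \<in> \<G>. x \<in> \<delta> A}" for A B
      using \<delta>(1) that by auto
    show ?thesis by (rule extend_to_ultrafilter[OF assms(1) F F_Int])
  qed
  then have "\<forall>x\<in>\<Omega>'. \<exists>U. {A \<in> \<G>. x \<in> \<delta> A} \<subseteq> U \<and> U \<subseteq> \<G> \<and> {} \<notin> U \<and> (\<forall>A\<in>U. \<forall>B\<in>U. A \<inter> B \<in> U) \<and>
      (\<forall>A\<in>\<G>. A \<in> U \<or> \<Omega> - A \<in> U)" by blast
  from bchoice[OF this] obtain U where "\<forall>x\<in>\<Omega>'. {A \<in> \<G>. x \<in> \<delta> A} \<subseteq> U x \<and> U x \<subseteq> \<G> \<and> {} \<notin> U x \<and>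
      (\<forall>A\<in>U x. \<forall>B\<in>U x. A \<inter> B \<in> U x) \<and> (\<forall>A\<in>\<G>. A \<in> U x \<or> \<Omega> - A \<in> U x)" ..
  then have U: "{A \<in> \<G>. x \<in> \<delta> A} \<subseteq> U x" "U x \<subseteq> \<G>" "{} \<notin> U x"
      "\<And>A B. A \<in> U x \<Longrightarrow> B \<in> U x \<Longrightarrow> A \<inter> B \<in> U x" "\<And>A. A \<in> \<G> \<Longrightarrow> A \<in> U x \<or> \<Omega> - A \<in> U x"
    if "x \<in> \<Omega>'" for x using that by blast+
  define h where "h = (\<lambda>A. {x \<in> \<Omega>'. A \<in> U x})"
  have disj: "A \<inter> B \<noteq> {}" if "x \<in> \<Omega>'" "A \<in> U x" "B \<in> U x" for x A B
    using U(3,4)[OF that(1)] that(2,3) by metis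
  have compl: "\<Omega> - A \<in> U x \<longleftrightarrow> A \<notin> U x" if "x \<in> \<Omega>'" "A \<in> \<G>" for x A
    using disj[OF that(1), of A "\<Omega> - A"] U(5)[OF that(1) that(2)] by blast
  have inter: "A \<inter> B \<in> U x \<longleftrightarrow> A \<in> U x \<and> B \<in> U x" if x: "x \<in> \<Omega>'" "A \<in> \<G>" "B \<in> \<G>" for x A B
  proof
    assume AB: "A \<inter> B \<in> U x"
    show "A \<in> U x \<and> B \<in> U x"
      using disj[OF x(1) AB, of "\<Omega> - A"] disj[OF x(1) AB, of "\<Omega> - B"] compl x by blast
  next
    assume "A \<in> U x \<and> B \<in> U x"
    then show "A \<inter> B \<in> U x" using U(4)[OF x(1)] by blast
  qed
  show ?thesis
  proof (intro exI[of _ h] conjI ballI, rule set_homI)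
    fix A assume A: "A \<in> \<G>" "A \<in> \<N>"
    then have "\<Omega> - A \<in> U x" if "x \<in> \<Omega>'" for x using \<delta>(3)[OF A] U(1)[OF that] that A by blast
    then show "h A = {}" using A(1) compl by (fastforce simp: h_def)
  next
    show "\<delta> A \<inter> \<Omega>' \<subseteq> h A" if "A \<in> \<G>" for A using U(1) that by (auto simp: h_def)
  qed (auto simp: h_def compl inter)
qed

section \<open>Extending a homomorphism by one set\<close>

lemma adjoin_set_algebra:
  assumes "algebra \<Omega> \<G>" and "E \<subseteq> \<Omega>"
  shows "algebra \<Omega> {(F \<inter> E) \<union> (G - E) |F G. F \<in> \<G> \<and> G \<in> \<G>}" (is "algebra \<Omega> ?\<G>'")
proof -
  interpret algebra \<Omega> \<G> by fact
  show ?thesis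
    unfolding algebra_iff_Int
  proof (intro conjI ballI)
    show "?\<G>' \<subseteq> Pow \<Omega>" using sets_into_space assms(2) by blast
    show "{} \<in> ?\<G>'" by (rule CollectI, rule exI[of _ "{}"], rule exI[of _ "{}"]) auto
    fix A assume "A \<in> ?\<G>'"
    then obtain F G where A: "A = (F \<inter> E) \<union> (G - E)" "F \<in> \<G>" "G \<in> \<G>" by blast
    have "\<Omega> - A = ((\<Omega> - F) \<inter> E) \<union> ((\<Omega> - G) - E)" using A assms(2) by blast
    then show "\<Omega> - A \<in> ?\<G>'" using A by blast
    fix B assume "B \<in> ?\<G>'"
    then obtain F' G' where B: "B = (F' \<inter> E) \<union> (G' - E)" "F' \<in> \<G>" "G' \<in> \<G>" by blast
    have "A \<inter> B = ((F \<inter> F') \<inter> E) \<union> ((G \<inter> G') - E)" using A B by blast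
    then show "A \<inter> B \<in> ?\<G>'" using A B by blast
  qed
qed

text \<open>\<open>K\<close> is the intended image of \<open>E\<close>. The assumptions
  \<open>meet\<close> and \<open>below\<close> are Sikorski's criterion: relations between
  \<open>F\<close> and \<open>E\<close> modulo \<open>\<N>\<close> must be respected by
  \<open>h F\<close> and \<open>K\<close>. They make the value on (F \<inter> E) \<union> (G - E)
  independent of \<open>F\<close> and \<open>G\<close>. The ideal is hereditary only within
  \<open>\<S>\<close>, because the null sets of an incomplete measure do not contain all their
  subsets.\<close>

lemma set_hom_adjoin_set:
  assumes h: "set_hom \<Omega> \<N> \<G> \<Omega>' h" and alg: "algebra \<Omega> \<G>"
    and ideal: "{} \<in> \<N>" "\<And>A B. A \<in> \<N> \<Longrightarrow> B \<in> \<S> \<Longrightarrow> B \<subseteq> A \<Longrightarrow> B \<in> \<N>"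
    and \<S>: "algebra \<Omega> \<S>" "\<G> \<subseteq> \<S>" and E: "E \<in> \<S>" and "K \<subseteq> \<Omega>'"
    and meet: "\<And>F. F \<in> \<G> \<Longrightarrow> F \<inter> E \<in> \<N> \<Longrightarrow> h F \<inter> K = {}"
    and below: "\<And>F. F \<in> \<G> \<Longrightarrow> F - E \<in> \<N> \<Longrightarrow> h F \<subseteq> K"
  shows "\<exists>h'. set_hom \<Omega> \<N> {(F \<inter> E) \<union> (G - E) |F G. F \<in> \<G> \<and> G \<in> \<G>} \<Omega>' h' \<and>
    (\<forall>F\<in>\<G>. \<forall>G\<in>\<G>. h' ((F \<inter> E) \<union> (G - E)) = (h F \<inter> K) \<union> (h G - K))"
proof -
  interpret algebra \<Omega> \<G> by fact
  interpret S: algebra \<Omega> \<S> by fact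
  note sd = set_hom_diff[OF h alg]
  have mono1: "h F \<inter> K \<subseteq> h F' \<inter> K" if "F \<in> \<G>" "F' \<in> \<G>" "F \<inter> E \<subseteq> F'" for F F'
  proof -
    have "(F - F') \<inter> E = {}" using that by blast
    then have "(F - F') \<inter> E \<in> \<N>" using ideal(1) by (simp only:)
    with that have "h (F - F') \<inter> K = {}" by (intro meet Diff)
    then show ?thesis using sd[OF that(1,2)] by blast
  qed
  have mono2: "h F - K \<subseteq> h F' - K" if "F \<in> \<G>" "F' \<in> \<G>" "F - E \<subseteq> F'" for F F'
  proof -
    have "(F - F') - E = {}" using that by blast
    then have "(F - F') - E \<in> \<N>" using ideal(1) by (simp only:)
    with that have "h (F - F') \<subseteq> K" by (intro below Diff)
    then show ?thesis using sd[OF that(1,2)] by blast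
  qed
  \<comment> \<open>A representation is chosen for each set; \<open>mono1\<close> and
    \<open>mono2\<close>, used in both directions, show that the choice does not affect
    \<open>h'\<close>.\<close>
  define \<phi> where "\<phi> = (\<lambda>A. SOME p. fst p \<in> \<G> \<and> snd p \<in> \<G> \<and> A = (fst p \<inter> E) \<union> (snd p - E))"
  define h' where "h' = (\<lambda>A. (h (fst (\<phi> A)) \<inter> K) \<union> (h (snd (\<phi> A)) - K))"
  have h': "h' ((F \<inter> E) \<union> (G - E)) = (h F \<inter> K) \<union> (h G - K)" if FG: "F \<in> \<G>" "G \<in> \<G>" for F G
  proof -
    define p where "p = \<phi> ((F \<inter> E) \<union> (G - E))"
    have p: "fst p \<in> \<G> \<and> snd p \<in> \<G> \<and> (F \<inter> E) \<union> (G - E) = (fst p \<inter> E) \<union> (snd p - E)"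
      unfolding p_def \<phi>_def by (rule someI[of _ "(F, G)"]) (use FG in auto)
    have "h (fst p) \<inter> K = h F \<inter> K" 
      using p FG by (intro equalityI mono1) blast+
    moreover have "h (snd p) - K = h G - K" 
      using p FG by (intro equalityI mono2) blast+
    ultimately show ?thesis by (simp add: h'_def p_def)
  qed
  have "set_hom \<Omega> \<N> {(F \<inter> E) \<union> (G - E) |F G. F \<in> \<G> \<and> G \<in> \<G>} \<Omega>' h'"
  proof (rule set_homI)
    fix A assume "A \<in> {(F \<inter> E) \<union> (G - E) |F G. F \<in> \<G> \<and> G \<in> \<G>}"
    then obtain F G where A: "A = (F \<inter> E) \<union> (G - E)" "F \<in> \<G>" "G \<in> \<G>" by blast
    note hA = h'[OF A(2,3), folded A(1)]
    show "h' A \<subseteq> \<Omega>'" using hA set_homD(1)[OF h] A(2,3) by blast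
    have "\<Omega> - A = ((\<Omega> - F) \<inter> E) \<union> ((\<Omega> - G) - E)" using A S.sets_into_space[OF E] by blast
    then have "h' (\<Omega> - A) = (h (\<Omega> - F) \<inter> K) \<union> (h (\<Omega> - G) - K)"
      using h'[OF compl_sets[OF A(2)] compl_sets[OF A(3)]] by (simp only:)
    also have "\<dots> = \<Omega>' - h' A"
      unfolding hA set_homD(2)[OF h A(2)] set_homD(2)[OF h A(3)]
      using \<open>K \<subseteq> \<Omega>'\<close> by blast
    finally show "h' (\<Omega> - A) = \<Omega>' - h' A" .
    show "h' A = {}" if "A \<in> \<N>"
    proof -
      have "F \<inter> E \<in> \<N>" "G - E \<in> \<N>"
        by (rule ideal(2)[OF that]; use A E \<S> in blast)+
      then have "h F \<inter> K = {}" "h G \<subseteq> K" using meet[OF A(2)] below[OF A(3)] by blast+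
      then show ?thesis using hA by blast
    qed
    fix B assume "B \<in> {(F \<inter> E) \<union> (G - E) |F G. F \<in> \<G> \<and> G \<in> \<G>}"
    then obtain F' G' where B: "B = (F' \<inter> E) \<union> (G' - E)" "F' \<in> \<G>" "G' \<in> \<G>" by blast
    have "A \<inter> B = ((F \<inter> F') \<inter> E) \<union> ((G \<inter> G') - E)" using A B by blast
    then have "h' (A \<inter> B) = (h (F \<inter> F') \<inter> K) \<union> (h (G \<inter> G') - K)"
      using h'[OF Int[OF A(2) B(2)] Int[OF A(3) B(3)]] by (simp only:)
    also have "\<dots> = h' A \<inter> h' B"
      unfolding hA h'[OF B(2,3), folded B(1)] set_homD(3)[OF h A(2) B(2)] set_homD(3)[OF h A(3) B(3)]
      by blast
    finally show "h' (A \<inter> B) = h' A \<inter> h' B" .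
  qed
  then show ?thesis using h' by blast
qed

section \<open>Conditional probabilities and the zero-one law\<close>

definition cond_prob :: "'a measure \<Rightarrow> 'a measure \<Rightarrow> 'a set \<Rightarrow> 'a \<Rightarrow> ennreal" where
  "cond_prob M F C = nn_cond_exp M F (indicator C)"

lemma borel_measurable_cond_prob [measurable]:
  "cond_prob M F C \<in> borel_measurable F" "cond_prob M F C \<in> borel_measurable M"
  by (simp_all add: cond_prob_def)

section \<open>Conditional probabilities given one sub-\<sigma>-algebra\<close>

context finite_measure_subalgebra
begin

lemma sets_F_subset: "A \<in> sets F \<Longrightarrow> A \<in> sets M"
  using subalg by (auto simp: subalgebra_def)

lemma cond_prob_unique:
  assumes "C \<in> sets M" "g \<in> borel_measurable F"
    and "\<And>A. A \<in> sets F \<Longrightarrow> (\<integral>\<^sup>+x\<in>A. g x \<partial>M) = emeasure M (C \<inter> A)"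
  shows "AE x in M. g x = cond_prob M F C x"
unfolding cond_prob_def
proof (rule nn_cond_exp_charact)
  fix A assume A: "A \<in> sets F"
  have "(\<integral>\<^sup>+x\<in>A. indicator C x \<partial>M) = (\<integral>\<^sup>+x. indicator (C \<inter> A) x \<partial>M)"
    by (simp add: indicator_inter_arith)
  then show "(\<integral>\<^sup>+x\<in>A. indicator C x \<partial>M) = (\<integral>\<^sup>+x\<in>A. g x \<partial>M)"
    using assms A sets_F_subset by simp
qed (use assms in auto)

lemma cond_prob_integral:
  assumes "C \<in> sets M" "A \<in> sets F"
  shows "(\<integral>\<^sup>+x\<in>A. cond_prob M F C x \<partial>M) = emeasure M (C \<inter> A)"
proof -
  have "(\<integral>\<^sup>+x. indicator A x * cond_prob M F C x \<partial>M) = (\<integral>\<^sup>+x. indicator A x * indicator C x \<partial>M)"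
    using assms unfolding cond_prob_def by (intro nn_cond_exp_intg) auto
  also have "\<dots> = (\<integral>\<^sup>+x. indicator (C \<inter> A) x \<partial>M)"
    by (simp add: indicator_inter_arith mult.commute)
  finally show ?thesis using assms sets_F_subset by (simp add: mult.commute)
qed

lemma cond_prob_mono:
  assumes "C \<in> sets M" "D \<in> sets M" "C - D \<in> null_sets M"
  shows "AE x in M. cond_prob M F C x \<le> cond_prob M F D x"
unfolding cond_prob_def
proof (rule nn_cond_exp_mono)
  show "AE x in M. indicator C x \<le> (indicator D x :: ennreal)"
    using AE_not_in[OF assms(3)] by eventually_elim (auto simp: indicator_def)
qed (use assms in auto)

lemma cond_prob_measurable_set:
  assumes "C \<in> sets F"
  shows "AE x in M. cond_prob M F C x = indicator C x"
  using nn_cond_exp_F_meas[of "indicator C"] assms by (auto simp: cond_prob_def)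

lemma cond_prob_compl:
  assumes "C \<in> sets M"
  shows "AE x in M. cond_prob M F C x + cond_prob M F (space M - C) x = 1"
proof -
  have "AE x in M. cond_prob M F C x + cond_prob M F (space M - C) x =
      nn_cond_exp M F (\<lambda>x. indicator C x + indicator (space M - C) x) x"
    using assms unfolding cond_prob_def by (intro nn_cond_exp_sum) auto
  moreover have "AE x in M. nn_cond_exp M F (\<lambda>x. indicator C x + indicator (space M - C) x) x = cond_prob M F (space M) x"
    using assms unfolding cond_prob_def by (intro nn_cond_exp_cong) (auto simp: indicator_def)
  moreover have "AE x in M. cond_prob M F (space M) x = indicator (space M) x"
    using subalg sets.top[of F] by (intro cond_prob_measurable_set) (simp add: subalgebra_def)
  ultimately show ?thesis using AE_space by eventually_elim simp
qed

lemma cond_prob_Un: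
  assumes "C \<in> sets M" "D \<in> sets M"
  shows "AE x in M. cond_prob M F (C \<union> D) x \<le> cond_prob M F C x + cond_prob M F D x"
proof -
  have "AE x in M. cond_prob M F C x + cond_prob M F D x = nn_cond_exp M F (\<lambda>x. indicator C x + indicator D x) x"
    using assms unfolding cond_prob_def by (intro nn_cond_exp_sum) auto
  moreover have "AE x in M. cond_prob M F (C \<union> D) x \<le> nn_cond_exp M F (\<lambda>x. indicator C x + indicator D x) x"
    using assms unfolding cond_prob_def by (intro nn_cond_exp_mono) (auto simp: indicator_def)
  ultimately show ?thesis by eventually_elim simp
qed

lemma cond_prob_finite_UN:
  fixes k :: nat
  assumes "\<And>i. C i \<in> sets M"
  shows "AE x in M. cond_prob M F (\<Union>i<k. C i) x \<le> (\<Sum>i<k. cond_prob M F (C i) x)"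
proof (induction k)
  case 0
  have "AE x in M. cond_prob M F {} x = indicator {} x" by (rule cond_prob_measurable_set) simp
  then show ?case by eventually_elim simp
next
  case (Suc k)
  have "AE x in M. cond_prob M F ((\<Union>i<k. C i) \<union> C k) x \<le> cond_prob M F (\<Union>i<k. C i) x + cond_prob M F (C k) x"
    using assms by (intro cond_prob_Un) auto
  with Suc show ?case
  proof eventually_elim
    case (elim x)
    have "(\<Union>i<Suc k. C i) = (\<Union>i<k. C i) \<union> C k" by (auto simp: lessThan_Suc)
    then show ?case using elim by (auto simp: add_mono intro: order_trans[OF _ add_right_mono])
  qed
qed

lemma cond_prob_UN_disjoint:
  fixes C :: "nat \<Rightarrow> 'a set"
  assumes "\<And>i. C i \<in> sets M" "disjoint_family C"
  shows "AE x in M. (\<Sum>i. cond_prob M F (C i) x) = cond_prob M F (\<Union>i. C i) x"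
proof (rule cond_prob_unique)
  fix A assume A: "A \<in> sets F"
  note [measurable] = sets_F_subset[OF A]
  have "(\<integral>\<^sup>+x\<in>A. (\<Sum>i. cond_prob M F (C i) x) \<partial>M) = (\<Sum>i. \<integral>\<^sup>+x\<in>A. cond_prob M F (C i) x \<partial>M)"
    by (subst nn_integral_suminf[symmetric]) (auto simp: ennreal_suminf_multc)
  also have "\<dots> = (\<Sum>i. emeasure M (C i \<inter> A))"
    using cond_prob_integral assms A by simp
  also have "\<dots> = emeasure M (\<Union>i. C i \<inter> A)"
    using assms by (intro suminf_emeasure) (auto simp: disjoint_family_on_def)
  finally show "(\<integral>\<^sup>+x\<in>A. (\<Sum>i. cond_prob M F (C i) x) \<partial>M) = emeasure M ((\<Union>i. C i) \<inter> A)"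
    by (simp add: Int_UN_distrib2)
qed (use assms in auto)

text \<open>Versions chosen separately for each y would carry no measurability in y. Rectangles have
  a joint version, and complements and disjoint unions inherit one because conditional probabilities
  add. The equation holds for every y, with a null set of x depending on y; this strength matters
  because a homomorphism applied to the section over a fixed y sees only its class.\<close>

lemma cond_prob_sections_version:
  assumes E: "E \<in> sets (M \<Otimes>\<^sub>M Q)"
  shows "\<exists>g\<in>borel_measurable (F \<Otimes>\<^sub>M Q). \<forall>y\<in>space Q. AE x in M. g (x, y) = cond_prob M F (hsection E y) x"
proof -
  have sp: "space F = space M" using subalg by (simp add: subalgebra_def)
  have sec: "hsection E y \<in> sets M" if "E \<in> sets (M \<Otimes>\<^sub>M Q)" for E y
    using sets_Pair2[OF that, of y] by (simp add: hsection_def vimage_def)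
  have sig: "sets (M \<Otimes>\<^sub>M Q) = sigma_sets (space M \<times> space Q) {a \<times> b |a b. a \<in> sets M \<and> b \<in> sets Q}"
    by (rule sets_pair_measure)
  show ?thesis
    using Int_stable_pair_measure_generator pair_measure_closed E[unfolded sig]
  proof (induction rule: sigma_sets_induct_disjoint)
    case (basic E)
    then obtain A B where E: "E = A \<times> B" and [measurable]: "A \<in> sets M" "B \<in> sets Q" by auto
    have "(\<lambda>z. cond_prob M F A (fst z) * indicator B (snd z)) \<in> borel_measurable (F \<Otimes>\<^sub>M Q)"
      by measurable
    moreover have "AE x in M. cond_prob M F A x * indicator B y = cond_prob M F (hsection E y) x" for y
    proof (cases "y \<in> B")
      case True
      then have "hsection E y = A" using E by (auto simp: hsection_def)
      then show ?thesis using True by simp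
    next
      case False
      then have "hsection E y = {}" using E by (auto simp: hsection_def)
      moreover have "AE x in M. cond_prob M F {} x = indicator {} x" by (rule cond_prob_measurable_set) simp
      ultimately show ?thesis using False by simp
    qed
    ultimately show ?case
      by (intro bexI[of _ "\<lambda>z. cond_prob M F A (fst z) * indicator B (snd z)"]) auto
  next
    case empty
    have "AE x in M. cond_prob M F {} x = indicator {} x" by (rule cond_prob_measurable_set) simp
    then show ?case by (intro bexI[of _ "\<lambda>_. 0"]) (auto simp: hsection_def)
  next
    case (compl E)
    then obtain g where g: "g \<in> borel_measurable (F \<Otimes>\<^sub>M Q)"
        "\<And>y. y \<in> space Q \<Longrightarrow> AE x in M. g (x, y) = cond_prob M F (hsection E y) x" by blast
    have "AE x in M. 1 - g (x, y) = cond_prob M F (hsection (space M \<times> space Q - E) y) x" if y: "y \<in> space Q" for y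
    proof -
      have hs: "hsection (space M \<times> space Q - E) y = space M - hsection E y" using y by (auto simp: hsection_def)
      have "AE x in M. cond_prob M F (hsection E y) x + cond_prob M F (space M - hsection E y) x = 1"
        using compl sec by (intro cond_prob_compl) (simp add: sig)
      then show ?thesis unfolding hs using g(2)[OF y]
      proof eventually_elim
        case (elim x)
        \<comment> \<open>Finiteness, read off from the sum 1, permits the cancellation in
          \<open>ennreal\<close>.\<close>
        have "cond_prob M F (hsection E y) x \<noteq> \<top>" using elim(1) by (metis ennreal_add_eq_top ennreal_one_neq_top)
        then have "1 - cond_prob M F (hsection E y) x = cond_prob M F (space M - hsection E y) x"
          unfolding elim(1)[symmetric] by (rule ennreal_add_diff_cancel_left)
        then show ?case using elim(2) by simp
      qed
    qed
    then show ?case using g(1) by (intro bexI[of _ "\<lambda>z. 1 - g z"]) auto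
  next
    case (union E)
    then have "\<forall>i. \<exists>g. g \<in> borel_measurable (F \<Otimes>\<^sub>M Q) \<and>
        (\<forall>y\<in>space Q. AE x in M. g (x, y) = cond_prob M F (hsection (E i) y) x)" by blast
    then obtain g where g: "\<And>i. g i \<in> borel_measurable (F \<Otimes>\<^sub>M Q)"
        "\<And>i y. y \<in> space Q \<Longrightarrow> AE x in M. g i (x, y) = cond_prob M F (hsection (E i) y) x" by metis
    have "AE x in M. (\<Sum>i. g i (x, y)) = cond_prob M F (hsection (\<Union>i. E i) y) x" if y: "y \<in> space Q" for y
    proof -
      have hs: "hsection (\<Union>i. E i) y = (\<Union>i. hsection (E i) y)" by (auto simp: hsection_def)
      have "AE x in M. (\<Sum>i. cond_prob M F (hsection (E i) y) x) = cond_prob M F (\<Union>i. hsection (E i) y) x"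
      proof (rule cond_prob_UN_disjoint)
        show "hsection (E i) y \<in> sets M" for i using union(2) sig by (intro sec) auto
        show "disjoint_family (\<lambda>i. hsection (E i) y)"
          using union(1) by (auto simp: disjoint_family_on_def hsection_def)
      qed
      moreover have "AE x in M. \<forall>i. g i (x, y) = cond_prob M F (hsection (E i) y) x"
        using g(2)[OF y] by (simp add: AE_all_countable)
      ultimately show ?thesis unfolding hs by eventually_elim simp
    qed
    then show ?case using g(1) by (intro bexI[of _ "\<lambda>z. \<Sum>i. g i z"]) auto
  qed
qed

end

section \<open>Maximal inequality and Levy's zero-one law\<close>

locale increasing_subalgebras = prob_space M for M :: "'a measure" +
  fixes F :: "nat \<Rightarrow> 'a measure"
  assumes subalgebra_F: "\<And>n. subalgebra M (F n)"
    and F_mono: "\<And>m n. m \<le> n \<Longrightarrow> sets (F m) \<subseteq> sets (F n)"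
begin

sublocale sub: finite_measure_subalgebra M "F n" for n
  by unfold_locales (rule subalgebra_F)

lemma space_F: "space (F n) = space M"
  using subalgebra_F by (simp add: subalgebra_def)

text \<open>Doob's argument: \<open>D n\<close> holds the points at which the level \<open>l\<close>
  is exceeded for the first time at \<open>n\<close>. It belongs to \<open>F n\<close>, so the
  conditional probability integrates over it to the measure of the part of \<open>C\<close> in it,
  and these parts are disjoint.\<close>

lemma maximal_inequality:
  assumes C: "C \<in> sets M"
  shows "l * emeasure M {x \<in> space M. \<exists>n. l < cond_prob M (F n) C x} \<le> emeasure M C"
proof -
  define A where "A n = {x \<in> space M. l < cond_prob M (F n) C x}" for n
  define D where "D = disjointed A"
  have A: "A n \<in> sets (F n)" for n
    unfolding A_def space_F[of n, symmetric] by measurable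
  have D: "D n \<in> sets (F n)" for n
    unfolding D_def disjointed_def using A F_mono by (intro sets.Diff sets.finite_UN) (auto dest: less_imp_le)
  have disj: "disjoint_family D" unfolding D_def by (rule disjoint_family_disjointed)
  have DM[measurable]: "D n \<in> sets M" for n using D sub.sets_F_subset by blast
  have "l * emeasure M (D n) \<le> emeasure M (C \<inter> D n)" for n
  proof -
    have "l * emeasure M (D n) = (\<integral>\<^sup>+x\<in>D n. l \<partial>M)" by (simp add: nn_integral_cmult_indicator)
    also have "\<dots> \<le> (\<integral>\<^sup>+x\<in>D n. cond_prob M (F n) C x \<partial>M)"
      by (intro nn_integral_mono) (auto simp: indicator_def D_def disjointed_def A_def)
    also have "\<dots> = emeasure M (C \<inter> D n)" by (rule sub.cond_prob_integral[OF C D])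
    finally show ?thesis .
  qed
  then have "(\<Sum>n. l * emeasure M (D n)) \<le> (\<Sum>n. emeasure M (C \<inter> D n))"
    by (intro suminf_le) auto
  also have "\<dots> = emeasure M (\<Union>n. C \<inter> D n)"
    using C disj DM by (intro suminf_emeasure) (auto simp: disjoint_family_on_def)
  also have "\<dots> \<le> emeasure M C" using C by (intro emeasure_mono) auto
  also have "(\<Sum>n. l * emeasure M (D n)) = l * emeasure M (\<Union>n. D n)"
    using disj DM by (subst ennreal_suminf_cmult, subst suminf_emeasure) auto
  also have "(\<Union>n. D n) = {x \<in> space M. \<exists>n. l < cond_prob M (F n) C x}"
    by (auto simp: D_def UN_disjointed_eq A_def)
  finally show ?thesis .
qed

text \<open>A point violating the claim lies in the exceptional set of the maximal inequality for
  every \<open>T k\<close>, and the measures of these sets tend to 0. The bound is uniform in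
  \<open>m\<close>, which is what the treatment of infinite unions requires.\<close>

lemma uniformly_small_tails:
  assumes T: "\<And>k. T k \<in> sets M" "(\<lambda>k. emeasure M (T k)) \<longlonglongrightarrow> 0" and l: "0 < l"
  shows "AE x in M. \<exists>k. \<forall>m. cond_prob M (F m) (T k) x \<le> l"
proof -
  define B where "B k = {x \<in> space M. \<exists>m. l < cond_prob M (F m) (T k) x}" for k
  have [measurable]: "B k \<in> sets M" for k unfolding B_def by measurable
  have "l * emeasure M (\<Inter>k. B k) \<le> emeasure M (T k)" for k
  proof -
    have "l * emeasure M (\<Inter>k. B k) \<le> l * emeasure M (B k)"
      by (intro mult_left_mono emeasure_mono) auto
    also have "\<dots> \<le> emeasure M (T k)" unfolding B_def by (rule maximal_inequality[OF T(1)])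
    finally show ?thesis .
  qed
  then have "l * emeasure M (\<Inter>k. B k) \<le> 0"
    by (intro LIMSEQ_le_const[OF T(2)]) auto
  then have "(\<Inter>k. B k) \<in> null_sets M" using l by (auto simp: null_sets_def)
  from AE_not_in[OF this] AE_space show ?thesis
    by eventually_elim (auto simp: B_def not_less)
qed

end

lemma ennreal_one_over_Suc_pos: "0 < ennreal (1 / Suc k)"
  by simp

lemma ennreal_tendsto_0I:
  fixes f :: "nat \<Rightarrow> ennreal"
  assumes "\<And>j::nat. \<forall>\<^sub>F m in sequentially. f m \<le> ennreal (1 / Suc j)"
  shows "f \<longlonglongrightarrow> 0"
proof (rule order_tendstoI)
  fix a :: ennreal assume "0 < a"
  have "(\<lambda>j. ennreal (1 / Suc j)) \<longlonglongrightarrow> ennreal 0"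
    using LIMSEQ_inverse_real_of_nat by (intro tendsto_ennrealI) (simp add: inverse_eq_divide)
  then have "\<forall>\<^sub>F j in sequentially. ennreal (1 / Suc j) < a"
    using \<open>0 < a\<close> by (intro order_tendstoD) auto
  then obtain j where "ennreal (1 / Suc j) < a" by (auto simp: eventually_sequentially)
  with assms[of j] show "\<forall>\<^sub>F m in sequentially. f m < a"
    by (auto elim: eventually_mono)
qed auto

text \<open>Level \<open>2 * j + 1\<close> is half of level \<open>j\<close>, since
  \<open>Suc (2 * j + 1)\<close> is \<open>2 * Suc j\<close>. It serves whenever two bounds are
  added.\<close>

lemma two_halves_ennreal: "ennreal (1 / Suc (2 * j + 1)) + ennreal (1 / Suc (2 * j + 1)) = ennreal (1 / Suc j)"
  by (subst ennreal_plus[symmetric]) (auto simp: field_simps)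

context increasing_subalgebras
begin

text \<open>The property is carried for \<open>C\<close> and its complement together, so the
  complement step of the Dynkin induction is a swap. For a disjoint union, the complement is
  controlled by monotonicity. The union itself is split into finitely many sets, whose conditional
  probabilities vanish in the limit, and a tail that is small uniformly in \<open>m\<close>.\<close>

lemma Levy_zero:
  assumes C: "C \<in> sigma_sets (space M) (\<Union>n. sets (F n))"
  shows "AE x in M. (x \<notin> C \<longrightarrow> (\<lambda>m. cond_prob M (F m) C x) \<longlonglongrightarrow> 0)"
proof -
  define L where "L C \<longleftrightarrow> (AE x in M. (x \<notin> C \<longrightarrow> (\<lambda>m. cond_prob M (F m) C x) \<longlonglongrightarrow> 0))" for C
  have L_F: "L C" if C: "C \<in> sets (F n)" for C n
  proof -
    have "AE x in M. \<forall>m. n \<le> m \<longrightarrow> cond_prob M (F m) C x = indicator C x"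
      unfolding AE_all_countable
    proof
      fix m
      show "AE x in M. n \<le> m \<longrightarrow> cond_prob M (F m) C x = indicator C x"
      proof (cases "n \<le> m")
        case True
        then have "C \<in> sets (F m)" using F_mono C by blast
        from sub.cond_prob_measurable_set[OF this] show ?thesis by eventually_elim simp
      qed simp
    qed
    then show ?thesis unfolding L_def
    proof eventually_elim
      case (elim x)
      show ?case
      proof
        assume "x \<notin> C"
        then have "\<forall>\<^sub>F m in sequentially. cond_prob M (F m) C x = 0"
          using elim by (auto simp: eventually_sequentially)
        then show "(\<lambda>m. cond_prob M (F m) C x) \<longlonglongrightarrow> 0" by (rule tendsto_eventually)
      qed
    qed
  qed
  have stable: "Int_stable (\<Union>n. sets (F n))"
  proof (rule Int_stableI)
    fix A B assume "A \<in> (\<Union>n. sets (F n))" "B \<in> (\<Union>n. sets (F n))"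
    then obtain m n where "A \<in> sets (F m)" "B \<in> sets (F n)" by blast
    then have "A \<in> sets (F (max m n))" "B \<in> sets (F (max m n))" using F_mono[of m "max m n"] F_mono[of n "max m n"] by auto
    then show "A \<inter> B \<in> (\<Union>n. sets (F n))" by blast
  qed
  have into: "(\<Union>n. sets (F n)) \<subseteq> Pow (space M)" using sets.space_closed space_F by blast
  have "C \<in> sets M \<and> L C \<and> L (space M - C)"
    using stable into C
  proof (induction rule: sigma_sets_induct_disjoint)
    case (basic A)
    then obtain n where n: "A \<in> sets (F n)" by blast
    then have "space M - A \<in> sets (F n)" by (metis sets.compl_sets space_F)
    then show ?case using n L_F sub.sets_F_subset by blast
  next
    case empty
    have "{} \<in> sets (F 0)" "space M \<in> sets (F 0)" using space_F by (metis sets.empty_sets, metis sets.top)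
    then show ?case using L_F by auto
  next
    case (compl A)
    then have "space M - (space M - A) = A" by (meson sets.sets_into_space double_diff order_refl)
    then show ?case using compl by auto
  next
    case (union A)
    then have A: "\<And>i. A i \<in> sets M" "\<And>i. L (A i)" "\<And>i. L (space M - A i)" "disjoint_family A" by auto
    have "L (space M - (\<Union>i. A i))"
    proof -
      have "AE x in M. \<forall>m i. cond_prob M (F m) (space M - (\<Union>i. A i)) x \<le> cond_prob M (F m) (space M - A i) x"
        unfolding AE_all_countable
      proof (intro allI sub.cond_prob_mono)
        show "space M - (\<Union>i. A i) - (space M - A i) \<in> null_sets M" for i
        proof -
          have "space M - (\<Union>i. A i) - (space M - A i) = {}" by auto
          then show ?thesis by (metis null_sets.empty_sets)
        qed
      qed (use A in auto)
      moreover have "AE x in M. \<forall>i. (x \<notin> space M - A i \<longrightarrow> (\<lambda>m. cond_prob M (F m) (space M - A i) x) \<longlonglongrightarrow> 0)"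
        using A(3) by (simp add: AE_all_countable L_def)
      ultimately show ?thesis unfolding L_def using AE_space
      proof eventually_elim
        case (elim x)
        show ?case
        proof
          assume "x \<notin> space M - (\<Union>i. A i)"
          then obtain i where "x \<in> A i" using elim by auto
          then have "(\<lambda>m. cond_prob M (F m) (space M - A i) x) \<longlonglongrightarrow> 0" using elim by auto
          then show "(\<lambda>m. cond_prob M (F m) (space M - (\<Union>i. A i)) x) \<longlonglongrightarrow> 0"
            by (rule tendsto_sandwich[OF _ _ tendsto_const, rotated 2]) (use elim in auto)
        qed
      qed
    qed
    moreover have "L (\<Union>i. A i)"
    proof -
      \<comment> \<open>By disjointness a point of \<open>A i\<close> is absent from
        \<open>T (Suc i)\<close>, so the tails decrease to the empty set and their measures tend to
        0.\<close>
      define T where "T k = (\<Union>i. A (i + k))" for k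
      have T: "T k \<in> sets M" for k using A by (auto simp: T_def)
      have "(\<lambda>k. emeasure M (T k)) \<longlonglongrightarrow> emeasure M (\<Inter>k. T k)"
      proof (rule Lim_emeasure_decseq)
        show "decseq T"
          unfolding decseq_def T_def
        proof (intro allI impI subsetI)
          fix m n :: nat and x assume "m \<le> n" "x \<in> (\<Union>i. A (i + n))"
          then obtain i where "x \<in> A (i + (n - m) + m)" by auto
          then show "x \<in> (\<Union>i. A (i + m))" by blast
        qed
      qed (use T in auto)
      moreover have "(\<Inter>k. T k) = {}"
      proof (rule ccontr)
        assume "(\<Inter>k. T k) \<noteq> {}"
        then obtain x where x: "\<And>k. x \<in> T k" by blast
        then obtain i where i: "x \<in> A i" unfolding T_def by blast
        obtain j where "x \<in> A (j + Suc i)" using x[of "Suc i"] unfolding T_def by blast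
        moreover have "A (j + Suc i) \<inter> A i = {}" by (rule disjoint_family_onD[OF A(4)]) auto
        ultimately show False using i by blast
      qed
      ultimately have "(\<lambda>k. emeasure M (T k)) \<longlonglongrightarrow> 0" by simp
      then have "AE x in M. \<forall>j. \<exists>k. \<forall>m. cond_prob M (F m) (T k) x \<le> ennreal (1 / Suc (2 * j + 1))"
        unfolding AE_all_countable by (intro allI uniformly_small_tails T ennreal_one_over_Suc_pos)
      moreover have "AE x in M. \<forall>m k. cond_prob M (F m) (\<Union>i. A i) x \<le>
          (\<Sum>i<k. cond_prob M (F m) (A i) x) + cond_prob M (F m) (T k) x"
        unfolding AE_all_countable
      proof (intro allI)
        fix m k
        have "(\<Union>i. A i) = (\<Union>i<k. A i) \<union> T k"
        proof -
          have "x \<in> (\<Union>i<k. A i) \<union> T k" if "x \<in> A i" for x i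
          proof (cases "i < k")
            case False
            then have "x \<in> A ((i - k) + k)" using that by simp
            then show ?thesis unfolding T_def by blast
          qed (use that in auto)
          then have "(\<Union>i. A i) \<subseteq> (\<Union>i<k. A i) \<union> T k" by blast
          moreover have "T k \<subseteq> (\<Union>i. A i)" by (auto simp: T_def)
          ultimately show ?thesis by blast
        qed
        moreover have "AE x in M. cond_prob M (F m) ((\<Union>i<k. A i) \<union> T k) x \<le>
            cond_prob M (F m) (\<Union>i<k. A i) x + cond_prob M (F m) (T k) x"
          using A T by (intro sub.cond_prob_Un) auto
        moreover have "AE x in M. cond_prob M (F m) (\<Union>i<k. A i) x \<le> (\<Sum>i<k. cond_prob M (F m) (A i) x)"
          by (rule sub.cond_prob_finite_UN[OF A(1)])
        ultimately show "AE x in M. cond_prob M (F m) (\<Union>i. A i) x \<le>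
            (\<Sum>i<k. cond_prob M (F m) (A i) x) + cond_prob M (F m) (T k) x"
          by (auto elim!: eventually_elim2 intro: order_trans[OF _ add_right_mono])
      qed
      moreover have "AE x in M. \<forall>i. (x \<notin> A i \<longrightarrow> (\<lambda>m. cond_prob M (F m) (A i) x) \<longlonglongrightarrow> 0)"
        using A(2) by (simp add: AE_all_countable L_def)
      ultimately show ?thesis unfolding L_def
      proof eventually_elim
        case (elim x)
        show ?case
        proof (intro impI ennreal_tendsto_0I)
          fix j assume x: "x \<notin> (\<Union>i. A i)"
          obtain k where k: "\<And>m. cond_prob M (F m) (T k) x \<le> ennreal (1 / Suc (2 * j + 1))"
            using elim(1) by blast
          have "(\<lambda>m. \<Sum>i<k. cond_prob M (F m) (A i) x) \<longlonglongrightarrow> (\<Sum>i<k. 0)"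
            using elim(3) x by (intro tendsto_sum) auto
          then have "\<forall>\<^sub>F m in sequentially. (\<Sum>i<k. cond_prob M (F m) (A i) x) < ennreal (1 / Suc (2 * j + 1))"
            by (intro order_tendstoD(2)[of _ 0]) (simp, rule ennreal_one_over_Suc_pos)
          then show "\<forall>\<^sub>F m in sequentially. cond_prob M (F m) (\<Union>i. A i) x \<le> ennreal (1 / Suc j)"
          proof eventually_elim
            case (elim m)
            have "cond_prob M (F m) (\<Union>i. A i) x \<le> (\<Sum>i<k. cond_prob M (F m) (A i) x) + cond_prob M (F m) (T k) x"
              using \<open>\<forall>m k. _ m k\<close> by blast
            also have "\<dots> \<le> ennreal (1 / Suc (2 * j + 1)) + ennreal (1 / Suc (2 * j + 1))"
              using elim k by (intro add_mono) auto
            finally show ?case by (simp only: two_halves_ennreal)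
          qed
        qed
      qed
    qed
    ultimately show ?case using A(1) by auto
  qed
  then show ?thesis by (simp add: L_def)
qed

text \<open>The right-hand side uses countably many level sets, to each of which a homomorphism can
  be applied. Off \<open>C\<close> the conditional probability of \<open>C\<close> is eventually
  below 1/2, that of the complement is then not, and \<open>k = 1\<close> refutes the right-hand
  side.\<close>

lemma Levy_zero_one:
  assumes C: "C \<in> sigma_sets (space M) (\<Union>n. sets (F n))" and CM: "C \<in> sets M"
  shows "AE x in M. x \<in> C \<longleftrightarrow> (\<forall>k. \<exists>n. \<forall>m\<ge>n. cond_prob M (F m) (space M - C) x < ennreal (1 / Suc k))"
proof -
  have "AE x in M. (x \<notin> space M - C \<longrightarrow> (\<lambda>m. cond_prob M (F m) (space M - C) x) \<longlonglongrightarrow> 0)"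
    by (intro Levy_zero sigma_sets.Compl C)
  moreover have "AE x in M. \<forall>m. cond_prob M (F m) C x + cond_prob M (F m) (space M - C) x = 1"
    unfolding AE_all_countable using CM by (intro allI sub.cond_prob_compl)
  ultimately show ?thesis using Levy_zero[OF C] AE_space
  proof eventually_elim
    case (elim x)
    show ?case
    proof (cases "x \<in> C")
      case True
      then have "(\<lambda>m. cond_prob M (F m) (space M - C) x) \<longlonglongrightarrow> 0" using elim by auto
      then have "\<forall>\<^sub>F m in sequentially. cond_prob M (F m) (space M - C) x < ennreal (1 / Suc k)" for k
        by (rule order_tendstoD) (rule ennreal_one_over_Suc_pos)
      then show ?thesis using True by (auto simp: eventually_sequentially)
    next
      case False
      then have "(\<lambda>m. cond_prob M (F m) C x) \<longlonglongrightarrow> 0" using elim by auto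
      then have "\<forall>\<^sub>F m in sequentially. cond_prob M (F m) C x < ennreal (1 / Suc 1)"
        by (rule order_tendstoD) (rule ennreal_one_over_Suc_pos)
      then obtain n where n: "\<And>m. m \<ge> n \<Longrightarrow> cond_prob M (F m) C x < ennreal (1 / Suc 1)"
        by (auto simp: eventually_sequentially)
      have "\<not> cond_prob M (F m) (space M - C) x < ennreal (1 / Suc 1)" if "m \<ge> n" for m
      proof
        assume "cond_prob M (F m) (space M - C) x < ennreal (1 / Suc 1)"
        then have "cond_prob M (F m) C x + cond_prob M (F m) (space M - C) x < ennreal (1 / Suc 1) + ennreal (1 / Suc 1)"
          by (intro add_strict_mono n that)
        also have "\<dots> = 1" using two_halves_ennreal[of 0] by simp
        finally show False using elim(2) by simp
      qed
      then have "\<not> (\<exists>n. \<forall>m\<ge>n. cond_prob M (F m) (space M - C) x < ennreal (1 / Suc 1))"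
        by (meson max.cobounded1 max.cobounded2)
      then show ?thesis using False by blast
    qed
  qed
qed

end

section \<open>Section-compatible liftings\<close>

text \<open>Exhaustion: the measures of the \<open>C n\<close> approach the supremum over
  \<open>\<K>\<close>. A member of \<open>\<K>\<close> exceeding their union by a set of positive
  measure would, joined with a suitable \<open>C n\<close>, surpass that supremum.\<close>

lemma finite_measure_ess_sup_family:
  assumes "finite_measure M" and \<K>: "\<K> \<subseteq> sets M" "{} \<in> \<K>"
    and Un: "\<And>A B. A \<in> \<K> \<Longrightarrow> B \<in> \<K> \<Longrightarrow> A \<union> B \<in> \<K>"
  shows "\<exists>C :: nat \<Rightarrow> 'a set. range C \<subseteq> \<K> \<and> (\<forall>K\<in>\<K>. K - (\<Union>n. C n) \<in> null_sets M)"
proof -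
  interpret finite_measure M by fact
  define m where "m = (SUP K\<in>\<K>. measure M K)"
  have bdd: "bdd_above (measure M ` \<K>)"
    using bounded_measure by (intro bdd_aboveI[of _ "measure M (space M)"]) auto
  have "\<exists>K\<in>\<K>. m - 1 / Suc n < measure M K" for n
    unfolding m_def by (rule less_cSUP_iff[THEN iffD1, OF _ bdd]) (use \<K>(2) in auto)
  then obtain C where C: "\<And>n. C n \<in> \<K>" "\<And>n. m - 1 / Suc n < measure M (C n)" by metis
  show ?thesis
  proof (intro exI[of _ C] conjI ballI)
    show "range C \<subseteq> \<K>" using C by auto
    fix K assume K: "K \<in> \<K>"
    have "measure M (K - (\<Union>n. C n)) \<le> 1 / Suc n" for n
    proof -
      have "measure M (K \<union> C n) \<le> m"
        unfolding m_def using bdd Un[OF K C(1)] by (intro cSUP_upper)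
      moreover have "measure M (K \<union> C n) = measure M (C n) + measure M (K - C n)"
        using K C \<K> by (subst finite_measure_Union[symmetric]) (auto simp: Un_commute)
      moreover have "measure M (K - (\<Union>n. C n)) \<le> measure M (K - C n)"
        using K C \<K> by (intro finite_measure_mono) auto
      ultimately show ?thesis using C(2)[of n] by linarith
    qed
    moreover have "(\<lambda>n. 1 / Suc n) \<longlonglongrightarrow> 0"
      using LIMSEQ_inverse_real_of_nat by (simp add: inverse_eq_divide)
    ultimately have "measure M (K - (\<Union>n. C n)) \<le> 0"
      by (intro LIMSEQ_le_const) auto
    moreover have "K - (\<Union>n. C n) \<in> sets M" using K C(1) \<K> by blast
    ultimately show "K - (\<Union>n. C n) \<in> null_sets M"
      by (auto simp: null_sets_def emeasure_eq_measure measure_le_0_iff)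
  qed
qed

lemma adjoin_set_sigma_algebra:
  assumes "sigma_algebra \<Omega> \<G>" and "E \<subseteq> \<Omega>"
  shows "sigma_algebra \<Omega> {(F \<inter> E) \<union> (G - E) |F G. F \<in> \<G> \<and> G \<in> \<G>}" (is "sigma_algebra \<Omega> ?\<G>'")
proof -
  interpret sigma_algebra \<Omega> \<G> by fact
  show ?thesis
    unfolding sigma_algebra_iff
  proof (intro conjI allI impI)
    show "algebra \<Omega> ?\<G>'" by (rule adjoin_set_algebra) (use assms(2) in \<open>auto intro: algebra_axioms\<close>)
    fix A :: "nat \<Rightarrow> _" assume "range A \<subseteq> ?\<G>'"
    then have "\<forall>i. \<exists>F G. A i = (F \<inter> E) \<union> (G - E) \<and> F \<in> \<G> \<and> G \<in> \<G>" by blast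
    then obtain F G where A: "\<And>i. A i = (F i \<inter> E) \<union> (G i - E)" "\<And>i. F i \<in> \<G>" "\<And>i. G i \<in> \<G>" by metis
    have "(\<Union>i. A i) = ((\<Union>i. F i) \<inter> E) \<union> ((\<Union>i. G i) - E)" using A(1) by auto
    moreover have "(\<Union>i. F i) \<in> \<G>" "(\<Union>i. G i) \<in> \<G>" using A(2,3) by auto
    ultimately show "(\<Union>i. A i) \<in> ?\<G>'" by blast
  qed
qed

section \<open>Null sets and sections in products\<close>

lemma AE_imp_Diff_null_sets:
  assumes "A \<in> sets M" "B \<in> sets M" "AE x in M. x \<in> A \<longrightarrow> x \<in> B"
  shows "A - B \<in> null_sets M"
proof -
  have "AE x in M. x \<notin> A - B" using assms(3) by eventually_elim auto
  then show ?thesis using assms(1,2) by (subst AE_iff_null_sets) auto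
qed

lemma AE_pair_fst:
  assumes "sigma_finite_measure Q" "AE x in M. \<phi> x"
  shows "AE z in M \<Otimes>\<^sub>M Q. \<phi> (fst z)"
proof -
  interpret sigma_finite_measure Q by fact
  obtain N where N: "N \<in> null_sets M" "{x \<in> space M. \<not> \<phi> x} \<subseteq> N" using assms(2) by (auto simp: eventually_ae_filter)
  then have "N \<times> space Q \<in> null_sets (M \<Otimes>\<^sub>M Q)" by (intro times_in_null_sets1) auto
  then show ?thesis using N(2) by (intro AE_I') (auto simp: space_pair_measure)
qed

lemma AE_pair_snd:
  assumes "sigma_finite_measure Q" "AE y in Q. \<phi> y"
  shows "AE z in M \<Otimes>\<^sub>M Q. \<phi> (snd z)"
proof -
  interpret sigma_finite_measure Q by fact
  obtain N where N: "N \<in> null_sets Q" "{y \<in> space Q. \<not> \<phi> y} \<subseteq> N" using assms(2) by (auto simp: eventually_ae_filter)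
  then have "space M \<times> N \<in> null_sets (M \<Otimes>\<^sub>M Q)" by (intro times_in_null_sets2) auto
  then show ?thesis using N(2) by (intro AE_I') (auto simp: space_pair_measure)
qed

text \<open>Joint measurability of the set is what allows Fubini to combine the null sets of the
  separate fibres into one null set of the product.\<close>

lemma AE_pair_sections:
  assumes "prob_space M" "prob_space Q"
    and "{z \<in> space (M \<Otimes>\<^sub>M Q). \<phi> z} \<in> sets (M \<Otimes>\<^sub>M Q)"
    and "\<And>y. y \<in> space Q \<Longrightarrow> AE x in M. \<phi> (x, y)"
  shows "AE z in M \<Otimes>\<^sub>M Q. \<phi> z"
proof -
  interpret pair_prob_space M Q using assms(1,2) by (simp add: pair_prob_space_def pair_sigma_finite_def prob_space_imp_sigma_finite)
  have "AE y in Q. AE x in M. \<phi> (x, y)" using assms(4) by (rule AE_I2)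
  then have "AE x in M. AE y in Q. \<phi> (x, y)"
    using AE_commute[of "\<lambda>x y. \<phi> (x, y)"] assms(3) by simp
  then show ?thesis using AE_pair_measure[OF assms(3)] by simp
qed

lemma sets_pair_mono_left:
  assumes "space N = space M" "sets N \<subseteq> sets M"
  shows "sets (N \<Otimes>\<^sub>M Q) \<subseteq> sets (M \<Otimes>\<^sub>M Q)"
  unfolding sets_pair_measure assms(1) using assms(2) by (intro sigma_sets_mono') blast

lemma hsection_sets: "E \<in> sets (M \<Otimes>\<^sub>M Q) \<Longrightarrow> hsection E y \<in> sets M"
  using sets_Pair2[of E M Q y] by (simp add: hsection_def vimage_def)

text \<open>These are the partial liftings to which Zorn's lemma is applied; \<open>\<A>\<close> is
  the sub-\<sigma>-algebra treated so far. A value \<open>s A\<close> may be any subset of the space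
  equal to \<open>A\<close> off a null set, so it is measurable only for the completion. Forming
  \<open>sigma (space M) \<A>\<close> turns \<open>\<A>\<close> into a factor of a product.\<close>

definition section_lifting :: "'a measure \<Rightarrow> 'b measure \<Rightarrow> 'a set set \<Rightarrow> ('a set \<Rightarrow> 'a set) \<Rightarrow> bool" where
  "section_lifting M Q \<A> s \<longleftrightarrow>
     sigma_algebra (space M) \<A> \<and> \<A> \<subseteq> sets M \<and>
     set_hom (space M) (null_sets M) \<A> (space M) s \<and>
     (\<forall>A\<in>\<A>. AE x in M. x \<in> s A \<longleftrightarrow> x \<in> A) \<and>
     (\<forall>E\<in>sets (sigma (space M) \<A> \<Otimes>\<^sub>M Q). AE z in M \<Otimes>\<^sub>M Q. fst z \<in> s (hsection E (snd z)) \<longleftrightarrow> z \<in> E)"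

lemma section_liftingD:
  assumes "section_lifting M Q \<A> s"
  shows "sigma_algebra (space M) \<A>" "\<A> \<subseteq> sets M" "set_hom (space M) (null_sets M) \<A> (space M) s"
    "algebra (space M) \<A>" "A \<in> \<A> \<Longrightarrow> AE x in M. x \<in> s A \<longleftrightarrow> x \<in> A"
    "E \<in> sets (sigma (space M) \<A> \<Otimes>\<^sub>M Q) \<Longrightarrow> AE z in M \<Otimes>\<^sub>M Q. fst z \<in> s (hsection E (snd z)) \<longleftrightarrow> z \<in> E"
  using assms by (auto simp: section_lifting_def sigma_algebra_def)

lemma sets_sigma_sigma_algebra: "sigma_algebra \<Omega> \<A> \<Longrightarrow> sets (sigma \<Omega> \<A>) = \<A>"
  by (rule sigma_algebra.sets_measure_of_eq)

lemma sets_sigma_pair: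
  assumes "sigma_algebra \<Omega> \<A>"
  shows "sets (sigma \<Omega> \<A> \<Otimes>\<^sub>M Q) = sigma_sets (\<Omega> \<times> space Q) {A \<times> B |A B. A \<in> \<A> \<and> B \<in> sets Q}"
  using assms by (simp add: sets_pair_measure sets_sigma_sigma_algebra space_measure_of_conv)

text \<open>Compatibility survives because each set in the enlarged product \<sigma>-algebra is
  pieced together along the cylinder over \<open>E\<close> from two sets of the old one. Its
  sections are pieced together along \<open>E\<close> in the same way, and replacing
  \<open>E\<close> by its image changes only a null set of x.\<close>

lemma section_lifting_adjoin:
  assumes "prob_space M" "prob_space Q" and L: "section_lifting M Q \<A> s" and E: "E \<in> sets M"
  shows "\<exists>\<B> t. section_lifting M Q \<B> t \<and> \<A> \<subseteq> \<B> \<and> E \<in> \<B> \<and> (\<forall>A\<in>\<A>. t A = s A)"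
proof -
  interpret M: prob_space M by fact
  interpret A: sigma_algebra "space M" \<A> using L by (rule section_liftingD)
  note alg = A.algebra_axioms and AM = section_liftingD(2)[OF L] and hom = section_liftingD(3)[OF L]
    and AE_s = section_liftingD(5)[OF L]
  have E\<Omega>: "E \<subseteq> space M" using E by (rule sets.sets_into_space)
  have "\<exists>C :: nat \<Rightarrow> 'a set. range C \<subseteq> {F \<in> \<A>. F \<inter> E \<in> null_sets M} \<and>
      (\<forall>F\<in>{F \<in> \<A>. F \<inter> E \<in> null_sets M}. F - (\<Union>n. C n) \<in> null_sets M)"
    using AM by (intro finite_measure_ess_sup_family M.finite_measure_axioms) (auto simp: Int_Un_distrib2)
  then obtain C1 :: "nat \<Rightarrow> 'a set" where C1: "range C1 \<subseteq> {F \<in> \<A>. F \<inter> E \<in> null_sets M}"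
      "\<And>F. F \<in> {F \<in> \<A>. F \<inter> E \<in> null_sets M} \<Longrightarrow> F - (\<Union>n. C1 n) \<in> null_sets M"
    by blast
  have "\<exists>C :: nat \<Rightarrow> 'a set. range C \<subseteq> {F \<in> \<A>. F - E \<in> null_sets M} \<and>
      (\<forall>F\<in>{F \<in> \<A>. F - E \<in> null_sets M}. F - (\<Union>n. C n) \<in> null_sets M)"
    using AM by (intro finite_measure_ess_sup_family M.finite_measure_axioms) (auto simp: Un_Diff)
  then obtain C2 :: "nat \<Rightarrow> 'a set" where C2: "range C2 \<subseteq> {F \<in> \<A>. F - E \<in> null_sets M}"
      "\<And>F. F \<in> {F \<in> \<A>. F - E \<in> null_sets M} \<Longrightarrow> F - (\<Union>n. C2 n) \<in> null_sets M"
    by blast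
  \<comment> \<open>Up to null sets, \<open>S1\<close> is the largest set of \<open>\<A>\<close>
    disjoint from \<open>E\<close>, and \<open>S2\<close> the largest one inside \<open>E\<close>.
    They reduce the extension criterion for all \<open>F\<close> to two sets.\<close>
  define S1 where "S1 = (\<Union>n. C1 n)"
  define S2 where "S2 = (\<Union>n. C2 n)"
  have S: "S1 \<in> \<A>" "S2 \<in> \<A>" using C1(1) C2(1) by (auto simp: S1_def S2_def)
  have "(\<Union>n. C1 n \<inter> E) \<in> null_sets M" "(\<Union>n. C2 n - E) \<in> null_sets M"
    using C1(1) C2(1) by (intro null_sets_UN; auto)+
  then have SE: "S1 \<inter> E \<in> null_sets M" "S2 - E \<in> null_sets M" by (simp_all add: S1_def S2_def)
  \<comment> \<open>\<open>K\<close> modifies \<open>E\<close> on a null set so that it contains \<open>s F\<close> for \<open>F\<close> essentially inside \<open>E\<close> and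
    avoids \<open>s F\<close> for \<open>F\<close> essentially disjoint from \<open>E\<close>.\<close>
  define K where "K = (E \<union> s S2) - s S1"
  have K\<Omega>: "K \<subseteq> space M" using E\<Omega> set_homD(1)[OF hom S(2)] by (auto simp: K_def)
  have K_AE: "AE x in M. x \<in> K \<longleftrightarrow> x \<in> E"
    using AE_s[OF S(1)] AE_s[OF S(2)] AE_not_in[OF SE(1)] AE_not_in[OF SE(2)]
    by eventually_elim (auto simp: K_def)
  let ?\<B> = "{(F \<inter> E) \<union> (G - E) |F G. F \<in> \<A> \<and> G \<in> \<A>}"
  have "\<exists>t. set_hom (space M) (null_sets M) ?\<B> (space M) t \<and>
      (\<forall>F\<in>\<A>. \<forall>G\<in>\<A>. t ((F \<inter> E) \<union> (G - E)) = (s F \<inter> K) \<union> (s G - K))"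
  proof (rule set_hom_adjoin_set[OF hom alg _ _ sets.algebra_axioms AM E K\<Omega>])
    show "{} \<in> null_sets M" by simp
    show "B \<in> null_sets M" if "A \<in> null_sets M" "B \<in> sets M" "B \<subseteq> A" for A B
      using that by (rule null_sets_subset)
    show "s F \<inter> K = {}" if F: "F \<in> \<A>" "F \<inter> E \<in> null_sets M" for F
    proof -
      have "F - S1 \<in> null_sets M" using C1(2) F by (simp add: S1_def)
      then have "s F \<subseteq> s S1" by (rule set_hom_mono[OF hom alg F(1) S(1)])
      then show ?thesis by (auto simp: K_def)
    qed
    show "s F \<subseteq> K" if F: "F \<in> \<A>" "F - E \<in> null_sets M" for F
    proof -
      have "F - S2 \<in> null_sets M" using C2(2) F by (simp add: S2_def)
      then have "s F \<subseteq> s S2" by (rule set_hom_mono[OF hom alg F(1) S(2)])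
      moreover have "F \<inter> S1 \<in> null_sets M"
        using null_sets.Un[OF F(2) SE(1)] by (rule null_sets_subset) (use F S AM in auto)
      then have "s F \<inter> s S1 = {}" by (rule set_hom_disjoint[OF hom alg F(1) S(1)])
      ultimately show ?thesis by (auto simp: K_def)
    qed
  qed
  then obtain t where t: "set_hom (space M) (null_sets M) ?\<B> (space M) t"
      "\<And>F G. F \<in> \<A> \<Longrightarrow> G \<in> \<A> \<Longrightarrow> t ((F \<inter> E) \<union> (G - E)) = (s F \<inter> K) \<union> (s G - K)"
    by blast
  have sB: "sigma_algebra (space M) ?\<B>" using A.sigma_algebra_axioms E\<Omega> by (rule adjoin_set_sigma_algebra)
  have "section_lifting M Q ?\<B> t"
    unfolding section_lifting_def
  proof (intro conjI ballI sB t(1))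
    show "?\<B> \<subseteq> sets M" using AM E by blast
    show "AE x in M. (x \<in> t B) = (x \<in> B)" if "B \<in> ?\<B>" for B
    proof -
      from that obtain F G where B: "B = (F \<inter> E) \<union> (G - E)" "F \<in> \<A>" "G \<in> \<A>" by blast
      show ?thesis
        unfolding B(1) t(2)[OF B(2,3)] using AE_s[OF B(2)] AE_s[OF B(3)] K_AE by eventually_elim auto
    qed
    fix D assume D: "D \<in> sets (sigma (space M) ?\<B> \<Otimes>\<^sub>M Q)"
    let ?EY = "E \<times> space Q"
    let ?\<S> = "sets (sigma (space M) \<A> \<Otimes>\<^sub>M Q)"
    have "sigma_algebra (space M \<times> space Q) {(F \<inter> ?EY) \<union> (G - ?EY) |F G. F \<in> ?\<S> \<and> G \<in> ?\<S>}" (is "sigma_algebra _ ?\<D>")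
      using E\<Omega> sets.sigma_algebra_axioms[of "sigma (space M) \<A> \<Otimes>\<^sub>M Q"]
      by (intro adjoin_set_sigma_algebra) (auto simp: space_pair_measure space_measure_of_conv)
    moreover have "{A \<times> B |A B. A \<in> ?\<B> \<and> B \<in> sets Q} \<subseteq> ?\<D>"
    proof
      fix R assume "R \<in> {A \<times> B |A B. A \<in> ?\<B> \<and> B \<in> sets Q}"
      then obtain F G B where R: "R = ((F \<inter> E) \<union> (G - E)) \<times> B" "F \<in> \<A>" "G \<in> \<A>" "B \<in> sets Q" by blast
      have "R = ((F \<times> B) \<inter> ?EY) \<union> ((G \<times> B) - ?EY)" using R sets.sets_into_space[OF R(4)] by auto
      moreover have "F \<times> B \<in> ?\<S>" "G \<times> B \<in> ?\<S>"
        using R by (auto intro!: pair_measureI simp: sets_sigma_sigma_algebra[OF A.sigma_algebra_axioms])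
      ultimately show "R \<in> ?\<D>" by blast
    qed
    ultimately have "sets (sigma (space M) ?\<B> \<Otimes>\<^sub>M Q) \<subseteq> ?\<D>"
      unfolding sets_sigma_pair[OF sB] by (rule sigma_algebra.sigma_sets_subset)
    then obtain F G where FG: "D = (F \<inter> ?EY) \<union> (G - ?EY)" "F \<in> ?\<S>" "G \<in> ?\<S>" using D by blast
    have sec: "hsection F y \<in> \<A>" "hsection G y \<in> \<A>" for y
      using hsection_sets[OF FG(2), of y] hsection_sets[OF FG(3), of y]
      by (simp_all add: sets_sigma_sigma_algebra[OF A.sigma_algebra_axioms])
    have "t (hsection D y) = (s (hsection F y) \<inter> K) \<union> (s (hsection G y) - K)" if "y \<in> space Q" for y
    proof -
      have "hsection D y = (hsection F y \<inter> E) \<union> (hsection G y - E)"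
        using that FG(1) by (auto simp: hsection_def)
      then show ?thesis using t(2) sec by simp
    qed
    moreover have "AE z in M \<Otimes>\<^sub>M Q. fst z \<in> K \<longleftrightarrow> fst z \<in> E" by (rule AE_pair_fst[OF prob_space_imp_sigma_finite[OF assms(2)] K_AE])
    ultimately show "AE z in M \<Otimes>\<^sub>M Q. (fst z \<in> t (hsection D (snd z))) = (z \<in> D)"
      using section_liftingD(6)[OF L FG(2)] section_liftingD(6)[OF L FG(3)] AE_space
      by (auto elim!: eventually_elim2 simp: FG(1) space_pair_measure)
  qed
  moreover have "\<A> \<subseteq> ?\<B>"
  proof
    fix A assume A: "A \<in> \<A>"
    have "A = (A \<inter> E) \<union> (A - E)" by blast
    then show "A \<in> ?\<B>" using A by blast
  qed
  moreover have "E \<in> ?\<B>"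
  proof -
    have "E = (space M \<inter> E) \<union> ({} - E)" using E\<Omega> by blast
    then show ?thesis using A.top A.empty_sets by blast
  qed
  moreover have "t A = s A" if "A \<in> \<A>" for A
  proof -
    have "(A \<inter> E) \<union> (A - E) = A" by blast
    then show ?thesis using t(2)[OF that that] by auto
  qed
  ultimately show ?thesis by (intro exI[of _ ?\<B>] exI[of _ t]) auto
qed

text \<open>The union of the \<open>\<A> n\<close> need not be a \<sigma>-algebra, so values have to
  be found on the one it generates. Conditional probabilities given \<open>F n\<close> yield a lower
  density that agrees with \<open>s n\<close> on \<open>\<A> n\<close>; a homomorphism above this
  density is the limit.\<close>

lemma section_lifting_limit:
  assumes "prob_space M" "prob_space Q" and L: "\<And>n::nat. section_lifting M Q (\<A> n) (s n)"
    and mono: "\<And>m n. m \<le> n \<Longrightarrow> \<A> m \<subseteq> \<A> n"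
    and agree: "\<And>m n A. m \<le> n \<Longrightarrow> A \<in> \<A> m \<Longrightarrow> s n A = s m A"
  shows "\<exists>\<B> t. section_lifting M Q \<B> t \<and> (\<forall>n. \<A> n \<subseteq> \<B> \<and> (\<forall>A\<in>\<A> n. t A = s n A))"
proof -
  interpret M: prob_space M by fact
  define F where "F n = sigma (space M) (\<A> n)" for n
  have F: "sets (F n) = \<A> n" "space (F n) = space M" for n
    unfolding F_def using sets_sigma_sigma_algebra[OF section_liftingD(1)[OF L]] by (simp_all add: space_measure_of_conv)
  interpret increasing_subalgebras M F
    by unfold_locales (use F section_liftingD(2)[OF L] mono in \<open>auto simp: subalgebra_def\<close>)
  note hom = section_liftingD(3)[OF L] and alg = section_liftingD(4)[OF L]
  \<comment> \<open>The levels bound the conditional probability of the complement, so that only subadditivity in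
    \<^typ>\<open>ennreal\<close> is needed.\<close>
  define lev where "lev m k C = {x \<in> space M. cond_prob M (F m) (space M - C) x < ennreal (1 / Suc k)}" for m k C
  have lev: "lev m k C \<in> \<A> m" for m k C
    unfolding lev_def F(1)[symmetric] F(2)[of m, symmetric] by measurable
  have lev_M: "lev m k C \<in> sets M" for m k C using lev section_liftingD(2)[OF L] by blast
  \<comment> \<open>\<open>lev m k C\<close> is, almost everywhere, the set where \<open>C\<close>
    has conditional probability above 1 - 1/(k + 1). Applying \<open>s m\<close> makes the result
    independent of the version, so the density laws hold at every point and not merely almost
    everywhere.\<close>
  define \<delta> where "\<delta> C = {x \<in> space M. \<forall>k. \<exists>n. \<forall>m\<ge>n. x \<in> s m (lev m k C)}" for C
  have s_lev_mono: "s m (lev m k C) \<subseteq> s m (lev m k' D)"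
    if "AE x in M. x \<in> lev m k C \<longrightarrow> x \<in> lev m k' D" for m k k' C D
  proof (rule set_hom_mono[OF hom alg lev lev])
    show "lev m k C - lev m k' D \<in> null_sets M"
      by (rule AE_imp_Diff_null_sets[OF lev_M lev_M that])
  qed
  have s_lev_space: "s m (lev m k C) = space M" if "AE x in M. x \<in> lev m k C" for m k C
  proof -
    interpret sigma_algebra "space M" "\<A> m" by (rule section_liftingD(1)[OF L])
    have "space M - lev m k C \<in> null_sets M"
      using that by (intro AE_imp_Diff_null_sets lev_M) auto
    then have "s m (space M) \<subseteq> s m (lev m k C)" by (rule set_hom_mono[OF hom alg top lev])
    then show ?thesis using set_hom_whole(1)[OF hom alg] set_homD(1)[OF hom lev] by blast
  qed
  have \<delta>_Int: "\<delta> (C \<inter> D) = \<delta> C \<inter> \<delta> D" if CD: "C \<in> sets M" "D \<in> sets M" for C D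
  proof
    have 1: "s m (lev m k (C \<inter> D)) \<subseteq> s m (lev m k C) \<inter> s m (lev m k D)" for m k
    proof -
      have *: "AE x in M. cond_prob M (F m) (space M - C') x \<le> cond_prob M (F m) (space M - (C \<inter> D)) x"
        if "C' \<in> sets M" "C \<inter> D \<subseteq> C'" for C'
      proof (rule sub.cond_prob_mono)
        have "(space M - C') - (space M - C \<inter> D) = {}" using that by auto
        then show "(space M - C') - (space M - C \<inter> D) \<in> null_sets M" by (simp only: null_sets.empty_sets)
      qed (use that CD in auto)
      have "AE x in M. x \<in> lev m k (C \<inter> D) \<longrightarrow> x \<in> lev m k C'" if "C' \<in> sets M" "C \<inter> D \<subseteq> C'" for C'
        using *[OF that] by eventually_elim (auto simp: lev_def)
      then show ?thesis using CD by (intro Int_greatest s_lev_mono) auto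
    qed
    then show "\<delta> (C \<inter> D) \<subseteq> \<delta> C \<inter> \<delta> D" unfolding \<delta>_def by blast
    have 2: "s m (lev m (2 * k + 1) C) \<inter> s m (lev m (2 * k + 1) D) \<subseteq> s m (lev m k (C \<inter> D))" for m k
    proof -
      interpret A: algebra "space M" "\<A> m" by (rule alg)
      have "AE x in M. cond_prob M (F m) ((space M - C) \<union> (space M - D)) x \<le>
          cond_prob M (F m) (space M - C) x + cond_prob M (F m) (space M - D) x"
        using CD by (intro sub.cond_prob_Un) auto
      then have "AE x in M. x \<in> lev m (2 * k + 1) C \<inter> lev m (2 * k + 1) D \<longrightarrow> x \<in> lev m k (C \<inter> D)"
      proof eventually_elim
        case (elim x)
        have "x \<in> lev m k (C \<inter> D)" if x: "x \<in> lev m (2 * k + 1) C" "x \<in> lev m (2 * k + 1) D"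
        proof -
          have "cond_prob M (F m) (space M - C) x + cond_prob M (F m) (space M - D) x <
              ennreal (1 / Suc (2 * k + 1)) + ennreal (1 / Suc (2 * k + 1))"
            using x by (intro add_strict_mono) (auto simp: lev_def)
          then have "cond_prob M (F m) ((space M - C) \<union> (space M - D)) x < ennreal (1 / Suc k)"
            using elim unfolding two_halves_ennreal by (rule le_less_trans[rotated])
          then show ?thesis using x by (simp add: lev_def Diff_Int)
        qed
        then show ?case by blast
      qed
      then have "lev m (2 * k + 1) C \<inter> lev m (2 * k + 1) D - lev m k (C \<inter> D) \<in> null_sets M"
        by (intro AE_imp_Diff_null_sets sets.Int lev_M)
      then have "s m (lev m (2 * k + 1) C \<inter> lev m (2 * k + 1) D) \<subseteq> s m (lev m k (C \<inter> D))"
        by (rule set_hom_mono[OF hom alg A.Int[OF lev lev] lev])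
      then show ?thesis using set_homD(3)[OF hom lev lev] by simp
    qed
    show "\<delta> C \<inter> \<delta> D \<subseteq> \<delta> (C \<inter> D)"
    proof
      fix x assume x: "x \<in> \<delta> C \<inter> \<delta> D"
      have "\<exists>n. \<forall>m\<ge>n. x \<in> s m (lev m k (C \<inter> D))" for k
      proof -
        obtain n1 n2 where "\<And>m. m \<ge> n1 \<Longrightarrow> x \<in> s m (lev m (2 * k + 1) C)"
            "\<And>m. m \<ge> n2 \<Longrightarrow> x \<in> s m (lev m (2 * k + 1) D)"
          using x unfolding \<delta>_def by blast
        then have "\<forall>m\<ge>max n1 n2. x \<in> s m (lev m k (C \<inter> D))" using 2 by fastforce
        then show ?thesis by blast
      qed
      then show "x \<in> \<delta> (C \<inter> D)" using x unfolding \<delta>_def by blast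
    qed
  qed
  have \<delta>_null: "\<delta> (space M - C) = space M" if C: "C \<in> null_sets M" for C
  proof -
    have "s m (lev m k (space M - C)) = space M" for m k
    proof (rule s_lev_space)
      have "AE x in M. cond_prob M (F m) C x \<le> cond_prob M (F m) {} x"
        using C by (intro sub.cond_prob_mono) auto
      moreover have "AE x in M. cond_prob M (F m) {} x = indicator {} x"
        by (rule sub.cond_prob_measurable_set) simp
      moreover have "space M - (space M - C) = C" using sets.sets_into_space C by blast
      ultimately show "AE x in M. x \<in> lev m k (space M - C)"
        using AE_space by (auto elim!: eventually_elim2 simp: lev_def)
    qed
    then show ?thesis by (auto simp: \<delta>_def)
  qed
  have \<delta>_\<A>: "\<delta> C = s n C" if C: "C \<in> \<A> n" for C n
  proof -
    have "s m (lev m k C) = s n C" if "m \<ge> n" for m k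
    proof -
      have Cm: "C \<in> \<A> m" using C mono[OF that] by blast
      have "space M - C \<in> sets (F m)" using Cm by (metis F sets.compl_sets)
      from sub.cond_prob_measurable_set[OF this]
      have AE: "AE x in M. x \<in> lev m k C \<longleftrightarrow> x \<in> C"
        using AE_space by eventually_elim (auto simp: lev_def indicator_def)
      have "s m (lev m k C) = s m C"
        using AE Cm section_liftingD(2)[OF L]
        by (intro set_hom_cong_null[OF hom alg lev Cm] AE_imp_Diff_null_sets lev_M) auto
      then show ?thesis using agree[OF that C] by simp
    qed
    moreover have "s n C \<subseteq> space M" by (rule set_homD(1)[OF hom C])
    ultimately show ?thesis unfolding \<delta>_def by (auto intro: exI[of _ n]) (metis max.cobounded1 max.cobounded2)
  qed
  define \<B> where "\<B> = sigma_sets (space M) (\<Union>n. \<A> n)"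
  have AM: "(\<Union>n. \<A> n) \<subseteq> sets M" using section_liftingD(2)[OF L] by blast
  have sB: "sigma_algebra (space M) \<B>"
    unfolding \<B>_def using AM sets.space_closed by (intro sigma_algebra_sigma_sets) blast
  then interpret B: sigma_algebra "space M" \<B> .
  have BM: "\<B> \<subseteq> sets M" unfolding \<B>_def using AM by (rule sets.sigma_sets_subset)
  have AB: "\<A> n \<subseteq> \<B>" for n unfolding \<B>_def by (auto intro: sigma_sets.Basic)
  have "\<exists>t. set_hom (space M) (null_sets M) \<B> (space M) t \<and> (\<forall>A\<in>\<B>. \<delta> A \<inter> space M \<subseteq> t A)"
  proof (rule set_hom_above_density[OF B.algebra_axioms])
    show "\<delta> {} = {}" using \<delta>_\<A>[of "{}" 0] set_hom_whole(2)[OF hom[of 0] alg] sets.empty_sets[of "F 0"] by (simp add: F)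
    show "\<delta> (A \<inter> B) = \<delta> A \<inter> \<delta> B" if "A \<in> \<B>" "B \<in> \<B>" for A B
      using that BM by (intro \<delta>_Int) auto
  qed (use \<delta>_null in simp_all)
  then obtain t where t: "set_hom (space M) (null_sets M) \<B> (space M) t"
    and t_above: "\<And>A. A \<in> \<B> \<Longrightarrow> \<delta> A \<inter> space M \<subseteq> t A" by blast
  \<comment> \<open>\<open>t C\<close> is squeezed between \<open>\<delta> C\<close> and the
    complement of \<open>\<delta> (space M - C)\<close>. The ultrafilters therefore matter only
    where \<open>\<delta>\<close> errs, and almost-everywhere statements pass from
    \<open>\<delta>\<close> to \<open>t\<close>, also jointly over all sections.\<close>
  have t_iff: "x \<in> t C \<longleftrightarrow> x \<in> C" if "C \<in> \<B>" "x \<in> space M"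
    "x \<in> C \<Longrightarrow> x \<in> \<delta> C" "x \<notin> C \<Longrightarrow> x \<in> \<delta> (space M - C)" for x C
    using t_above[OF that(1)] t_above[OF B.compl_sets[OF that(1)]] set_homD(2)[OF t that(1)] that(2-) by blast
  have t_eq: "t C = s n C" if C: "C \<in> \<A> n" for C n
  proof -
    interpret A: algebra "space M" "\<A> n" by (rule alg)
    have CB: "C \<in> \<B>" using C AB by blast
    have "s n C \<subseteq> t C" using t_above[OF CB] \<delta>_\<A>[OF C] set_homD(1)[OF hom C] by blast
    moreover have "s n (space M - C) \<subseteq> t (space M - C)"
      using t_above[OF B.compl_sets[OF CB]] \<delta>_\<A>[OF A.compl_sets[OF C]] set_homD(1)[OF hom A.compl_sets[OF C]] by blast
    ultimately show ?thesis
      using set_homD(2)[OF t CB] set_homD(2)[OF hom C] set_homD(1)[OF t CB] set_homD(1)[OF hom C] by blast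
  qed
  have "sigma_sets (space M) (\<Union>n. sets (F n)) = \<B>" by (simp add: \<B>_def F)
  note Levy = Levy_zero_one[unfolded this]
  have AE_\<delta>: "AE x in M. x \<in> \<delta> C \<longleftrightarrow> x \<in> C" if C: "C \<in> \<B>" for C
  proof -
    have "AE x in M. \<forall>m k. x \<in> s m (lev m k C) \<longleftrightarrow> x \<in> lev m k C"
      unfolding AE_all_countable using section_liftingD(5)[OF L lev] by blast
    moreover have "C \<in> sets M" using C BM by blast
    ultimately show ?thesis
      using Levy[OF C] AE_space by (auto elim!: eventually_elim2 simp: \<delta>_def lev_def)
  qed
  have AE_t: "AE x in M. x \<in> t C \<longleftrightarrow> x \<in> C" if C: "C \<in> \<B>" for C
    using AE_\<delta>[OF C] AE_\<delta>[OF B.compl_sets[OF C]] AE_space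
    by eventually_elim (rule t_iff[OF C]; simp)
  have AE_\<delta>_pair: "AE z in M \<Otimes>\<^sub>M Q. fst z \<in> \<delta> (hsection E (snd z)) \<longleftrightarrow> z \<in> E"
    if E: "E \<in> sets (sigma (space M) \<B> \<Otimes>\<^sub>M Q)" for E
  proof -
    let ?\<Omega> = "space M \<times> space Q"
    have "sets (sigma (space M) \<B> \<Otimes>\<^sub>M Q) \<subseteq> sets (M \<Otimes>\<^sub>M Q)"
      using BM by (intro sets_pair_mono_left) (simp_all add: sets_sigma_sigma_algebra[OF sB] space_measure_of_conv)
    then have EM[measurable]: "E \<in> sets (M \<Otimes>\<^sub>M Q)" using E by blast
    have secB: "hsection E y \<in> \<B>" for y using hsection_sets[OF E] by (simp add: sets_sigma_sigma_algebra[OF sB])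
    have secM: "hsection E y \<in> sets M" for y using secB BM by blast
    have Ec: "?\<Omega> - E \<in> sets (M \<Otimes>\<^sub>M Q)" using sets.compl_sets[OF EM] by (simp add: space_pair_measure)
    have secEc: "hsection (?\<Omega> - E) y = space M - hsection E y" if "y \<in> space Q" for y
      using that by (auto simp: hsection_def)
    have "\<forall>m. \<exists>g\<in>borel_measurable (F m \<Otimes>\<^sub>M Q). \<forall>y\<in>space Q. AE x in M. g (x, y) = cond_prob M (F m) (hsection (?\<Omega> - E) y) x"
      using sub.cond_prob_sections_version[OF Ec] by blast
    then obtain g where g: "\<And>m. g m \<in> borel_measurable (F m \<Otimes>\<^sub>M Q)"
      and g_AE: "\<And>m y. y \<in> space Q \<Longrightarrow> AE x in M. g m (x, y) = cond_prob M (F m) (hsection (?\<Omega> - E) y) x"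
      by metis
    \<comment> \<open>\<open>D m k\<close> gathers the level sets of all sections into one set of
      the product with \<open>F m\<close>. For every y in \<open>Q\<close> its section is almost
      everywhere the level set, hence has exactly the same image under \<open>s m\<close>, and
      compatibility of \<open>s m\<close> can be applied to \<open>D m k\<close>.\<close>
    define D where "D m k = {z \<in> ?\<Omega>. g m z < ennreal (1 / Suc k)}" for m k
    have D: "D m k \<in> sets (F m \<Otimes>\<^sub>M Q)" for m k
    proof -
      note [measurable] = g[of m]
      have "{z \<in> space (F m \<Otimes>\<^sub>M Q). g m z < ennreal (1 / Suc k)} \<in> sets (F m \<Otimes>\<^sub>M Q)" by measurable
      then show ?thesis by (simp add: D_def space_pair_measure F)
    qed
    have gM[measurable]: "g m \<in> borel_measurable (M \<Otimes>\<^sub>M Q)" for m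
    proof -
      have "sets (F m \<Otimes>\<^sub>M Q) \<subseteq> sets (M \<Otimes>\<^sub>M Q)"
        using section_liftingD(2)[OF L] by (intro sets_pair_mono_left) (simp_all add: F)
      then show ?thesis
        by (rule borel_measurable_subalgebra[OF _ _ g]) (simp add: space_pair_measure F)
    qed
    have s_D: "s m (hsection (D m k) y) = s m (lev m k (hsection E y))" if y: "y \<in> space Q" for m k y
    proof -
      have Dm: "hsection (D m k) y \<in> \<A> m" using hsection_sets[OF D] by (simp add: F)
      have "AE x in M. x \<in> hsection (D m k) y \<longleftrightarrow> x \<in> lev m k (hsection E y)"
        using g_AE[OF y, of m, unfolded secEc[OF y]] AE_space
      proof eventually_elim
        case (elim x)
        have "x \<in> hsection (D m k) y \<longleftrightarrow> g m (x, y) < ennreal (1 / Suc k)"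
          using elim(2) y by (simp add: hsection_def D_def)
        then show ?case using elim by (simp add: lev_def)
      qed
      then show ?thesis
        using Dm section_liftingD(2)[OF L]
        by (intro set_hom_cong_null[OF hom alg Dm lev] AE_imp_Diff_null_sets lev_M) auto
    qed
    have "AE z in M \<Otimes>\<^sub>M Q. \<forall>m k. fst z \<in> s m (hsection (D m k) (snd z)) \<longleftrightarrow> z \<in> D m k"
      unfolding AE_all_countable using section_liftingD(6)[OF L] D by (auto simp: F_def)
    moreover have "AE z in M \<Otimes>\<^sub>M Q. z \<in> E \<longleftrightarrow> (\<forall>k. \<exists>n. \<forall>m\<ge>n. g m z < ennreal (1 / Suc k))"
    proof (rule AE_pair_sections[OF assms(1,2)])
      show "{z \<in> space (M \<Otimes>\<^sub>M Q). (z \<in> E) = (\<forall>k. \<exists>n. \<forall>m\<ge>n. g m z < ennreal (1 / Suc k))} \<in> sets (M \<Otimes>\<^sub>M Q)"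
        by measurable
      fix y assume y: "y \<in> space Q"
      have "AE x in M. \<forall>m. g m (x, y) = cond_prob M (F m) (space M - hsection E y) x"
        unfolding AE_all_countable using g_AE[OF y] by (simp add: secEc[OF y])
      with Levy[OF secB secM, of y]
      show "AE x in M. ((x, y) \<in> E) = (\<forall>k. \<exists>n. \<forall>m\<ge>n. g m (x, y) < ennreal (1 / Suc k))"
        by eventually_elim (simp add: hsection_def)
    qed
    ultimately show ?thesis
      using AE_space
    proof eventually_elim
      case (elim z)
      then have z: "fst z \<in> space M" "snd z \<in> space Q" "z \<in> ?\<Omega>" by (auto simp: space_pair_measure)
      have "fst z \<in> \<delta> (hsection E (snd z)) \<longleftrightarrow> (\<forall>k. \<exists>n. \<forall>m\<ge>n. z \<in> D m k)"
        using elim(1) z(1) by (simp add: \<delta>_def s_D[OF z(2), symmetric])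
      also have "\<dots> \<longleftrightarrow> z \<in> E" using elim(2) z(3) by (simp add: D_def)
      finally show ?case .
    qed
  qed
  have "section_lifting M Q \<B> t"
    unfolding section_lifting_def
  proof (intro conjI ballI sB BM t AE_t)
    fix E assume E: "E \<in> sets (sigma (space M) \<B> \<Otimes>\<^sub>M Q)"
    let ?\<Omega> = "space M \<times> space Q"
    have Ec: "?\<Omega> - E \<in> sets (sigma (space M) \<B> \<Otimes>\<^sub>M Q)"
      using sets.compl_sets[OF E] by (simp add: space_pair_measure space_measure_of_conv)
    have secB: "hsection E y \<in> \<B>" for y using hsection_sets[OF E] by (simp add: sets_sigma_sigma_algebra[OF sB])
    show "AE z in M \<Otimes>\<^sub>M Q. (fst z \<in> t (hsection E (snd z))) = (z \<in> E)"
      using AE_\<delta>_pair[OF E] AE_\<delta>_pair[OF Ec] AE_space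
    proof eventually_elim
      case (elim z)
      then have z: "fst z \<in> space M" "snd z \<in> space Q" "z \<in> ?\<Omega>" by (auto simp: space_pair_measure)
      have 1: "hsection (?\<Omega> - E) (snd z) = space M - hsection E (snd z)" using z by (auto simp: hsection_def)
      have 2: "z \<in> E \<longleftrightarrow> fst z \<in> hsection E (snd z)" by (simp add: hsection_def)
      have "fst z \<in> t (hsection E (snd z)) \<longleftrightarrow> fst z \<in> hsection E (snd z)"
        by (rule t_iff[OF secB z(1)]) (use elim 1 2 z in auto)
      then show ?case using 2 by simp
    qed
  qed
  then show ?thesis using AB t_eq by blast
qed

text \<open>If sequences in \<open>C\<close> are bounded in \<open>C\<close>, a countable union of
  sets from the \<open>\<A>\<close> is formed inside a single one, so the union of the
  \<open>\<A>\<close> is a \<sigma>-algebra. For the same reason every set of its product with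
  \<open>Q\<close> already comes from a single member of \<open>C\<close>, whose compatibility
  applies.\<close>

lemma section_lifting_union:
  assumes "C \<noteq> {}" and L: "\<And>\<A> s. (\<A>, s) \<in> C \<Longrightarrow> section_lifting M Q \<A> s"
    and agree: "\<And>\<A> s \<A>' s' A. (\<A>, s) \<in> C \<Longrightarrow> (\<A>', s') \<in> C \<Longrightarrow> A \<in> \<A> \<Longrightarrow> A \<in> \<A>' \<Longrightarrow> s A = s' A"
    and bounded: "\<And>c :: nat \<Rightarrow> _. range c \<subseteq> C \<Longrightarrow> \<exists>p\<in>C. \<forall>n. fst (c n) \<subseteq> fst p"
  shows "\<exists>\<B> t. section_lifting M Q \<B> t \<and> (\<forall>(\<A>, s)\<in>C. \<A> \<subseteq> \<B> \<and> (\<forall>A\<in>\<A>. t A = s A))"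
proof -
  define \<B> where "\<B> = (\<Union>p\<in>C. fst p)"
  define t where "t A = snd (SOME p. p \<in> C \<and> A \<in> fst p) A" for A
  have L': "section_lifting M Q (fst p) (snd p)" if "p \<in> C" for p using L[of "fst p" "snd p"] that by simp
  have t: "t A = s A" if "(\<A>, s) \<in> C" "A \<in> \<A>" for \<A> s A
  proof -
    have "\<exists>p. p \<in> C \<and> A \<in> fst p" using that by force
    then have "(SOME p. p \<in> C \<and> A \<in> fst p) \<in> C \<and> A \<in> fst (SOME p. p \<in> C \<and> A \<in> fst p)" by (rule someI_ex)
    then show ?thesis
      unfolding t_def using that
        agree[of "fst (SOME p. p \<in> C \<and> A \<in> fst p)" "snd (SOME p. p \<in> C \<and> A \<in> fst p)" \<A> s A]
      by simp
  qed
  have countable: "\<exists>p\<in>C. \<forall>n. A n \<in> fst p" if "range A \<subseteq> \<B>" for A :: "nat \<Rightarrow> _"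
  proof -
    have "\<forall>n. \<exists>p\<in>C. A n \<in> fst p" using that by (auto simp: \<B>_def)
    then obtain c where c: "\<And>n. c n \<in> C" "\<And>n. A n \<in> fst (c n)" by metis
    then obtain p where "p \<in> C" "\<And>n. fst (c n) \<subseteq> fst p" using bounded[of c] by blast
    then show ?thesis using c by blast
  qed
  have two: "\<exists>p\<in>C. A \<in> fst p \<and> B \<in> fst p" if "A \<in> \<B>" "B \<in> \<B>" for A B
  proof -
    have "range (\<lambda>n::nat. if n = 0 then A else B) \<subseteq> \<B>" using that by auto
    from countable[OF this] obtain p where "p \<in> C" "\<And>n::nat. (if n = 0 then A else B) \<in> fst p" by blast
    from this(1) this(2)[of 0] this(2)[of 1] show ?thesis by auto
  qed
  obtain p0 where p0: "p0 \<in> C" using assms(1) by blast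
  have sB: "sigma_algebra (space M) \<B>"
    unfolding sigma_algebra_iff2
  proof (intro conjI ballI allI impI)
    show "\<B> \<subseteq> Pow (space M)" using section_liftingD(2)[OF L'] sets.space_closed unfolding \<B>_def by blast
    interpret A0: sigma_algebra "space M" "fst p0" by (rule section_liftingD(1)[OF L'[OF p0]])
    show "{} \<in> \<B>" using p0 by (auto simp: \<B>_def)
    show "space M - A \<in> \<B>" if A: "A \<in> \<B>" for A
    proof -
      obtain p where p: "p \<in> C" "A \<in> fst p" using A unfolding \<B>_def by blast
      interpret A: sigma_algebra "space M" "fst p" by (rule section_liftingD(1)[OF L'[OF p(1)]])
      show ?thesis using A.compl_sets[OF p(2)] p(1) by (auto simp: \<B>_def)
    qed
    show "(\<Union>i. A i) \<in> \<B>" if A: "range A \<subseteq> \<B>" for A :: "nat \<Rightarrow> _"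
    proof -
      obtain p where p: "p \<in> C" "\<And>n. A n \<in> fst p" using countable[OF A] by blast
      interpret A: sigma_algebra "space M" "fst p" by (rule section_liftingD(1)[OF L'[OF p(1)]])
      have "(\<Union>i. A i) \<in> fst p" using p(2) by auto
      then show ?thesis using p(1) by (auto simp: \<B>_def)
    qed
  qed
  have hom: "set_hom (space M) (null_sets M) \<B> (space M) t"
  proof (rule set_homI)
    fix A assume "A \<in> \<B>"
    then obtain \<A> s where p: "(\<A>, s) \<in> C" "A \<in> \<A>" by (auto simp: \<B>_def)
    note h = section_liftingD(3)[OF L[OF p(1)]]
    interpret A: sigma_algebra "space M" \<A> by (rule section_liftingD(1)[OF L[OF p(1)]])
    show "t A \<subseteq> space M" using t[OF p] set_homD(1)[OF h p(2)] by simp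
    show "t (space M - A) = space M - t A"
      using t[OF p] t[OF p(1) A.compl_sets[OF p(2)]] set_homD(2)[OF h p(2)] by simp
    show "t A = {}" if "A \<in> null_sets M" using t[OF p] set_homD(4)[OF h p(2) that] by simp
  next
    fix A B assume "A \<in> \<B>" "B \<in> \<B>"
    then obtain \<A> s where p: "(\<A>, s) \<in> C" "A \<in> \<A>" "B \<in> \<A>" using two by force
    note h = section_liftingD(3)[OF L[OF p(1)]]
    interpret A: sigma_algebra "space M" \<A> by (rule section_liftingD(1)[OF L[OF p(1)]])
    show "t (A \<inter> B) = t A \<inter> t B"
      using t[OF p(1) p(2)] t[OF p(1) p(3)] t[OF p(1) A.Int[OF p(2,3)]] set_homD(3)[OF h p(2,3)] by simp
  qed
  have "section_lifting M Q \<B> t"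
    unfolding section_lifting_def
  proof (intro conjI ballI sB hom)
    show "\<B> \<subseteq> sets M" using section_liftingD(2)[OF L'] unfolding \<B>_def by blast
    fix A assume "A \<in> \<B>"
    then obtain \<A> s where p: "(\<A>, s) \<in> C" "A \<in> \<A>" by (auto simp: \<B>_def)
    show "AE x in M. (x \<in> t A) = (x \<in> A)" using section_liftingD(5)[OF L[OF p(1)] p(2)] t[OF p] by simp
  next
    fix E assume E: "E \<in> sets (sigma (space M) \<B> \<Otimes>\<^sub>M Q)"
    let ?S = "\<lambda>p. sets (sigma (space M) (fst p) \<Otimes>\<^sub>M Q)"
    have S: "?S p = sigma_sets (space M \<times> space Q) {A \<times> B |A B. A \<in> fst p \<and> B \<in> sets Q}" if "p \<in> C" for p
      by (rule sets_sigma_pair[OF section_liftingD(1)[OF L'[OF that]]])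
    have spS: "space (sigma (space M) (fst p) \<Otimes>\<^sub>M Q) = space M \<times> space Q" for p :: "'a set set \<times> ('a set \<Rightarrow> 'a set)"
      by (simp add: space_pair_measure space_measure_of_conv)
    have S_mono: "?S p \<subseteq> ?S q" if "fst p \<subseteq> fst q" "p \<in> C" "q \<in> C" for p q
      unfolding S[OF that(2)] S[OF that(3)] using that(1) by (intro sigma_sets_mono') blast
    have "sigma_algebra (space M \<times> space Q) (\<Union>p\<in>C. ?S p)"
      unfolding sigma_algebra_iff2
    proof (intro conjI ballI allI impI)
      show "(\<Union>p\<in>C. ?S p) \<subseteq> Pow (space M \<times> space Q)" using sets.space_closed spS by blast
      show "{} \<in> (\<Union>p\<in>C. ?S p)" by (intro UN_I[OF p0]) simp
      show "space M \<times> space Q - A \<in> (\<Union>p\<in>C. ?S p)" if A: "A \<in> (\<Union>p\<in>C. ?S p)" for A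
      proof -
        obtain p where p: "p \<in> C" "A \<in> ?S p" using A by blast
        show ?thesis using sets.compl_sets[OF p(2), unfolded spS] by (rule UN_I[OF p(1)])
      qed
      show "(\<Union>i. A i) \<in> (\<Union>p\<in>C. ?S p)" if "range A \<subseteq> (\<Union>p\<in>C. ?S p)" for A :: "nat \<Rightarrow> _"
      proof -
        have "\<forall>n. \<exists>p\<in>C. A n \<in> ?S p" using that by blast
        then obtain c where c: "\<And>n. c n \<in> C" "\<And>n. A n \<in> ?S (c n)" by metis
        then obtain p where p: "p \<in> C" "\<And>n. fst (c n) \<subseteq> fst p" using bounded[of c] by blast
        have "A n \<in> ?S p" for n using S_mono[OF p(2) c(1) p(1)] c(2) by blast
        then have "(\<Union>i. A i) \<in> ?S p" by auto
        then show ?thesis using p(1) by blast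
      qed
    qed
    moreover have "{A \<times> B |A B. A \<in> \<B> \<and> B \<in> sets Q} \<subseteq> (\<Union>p\<in>C. ?S p)"
    proof
      fix R assume "R \<in> {A \<times> B |A B. A \<in> \<B> \<and> B \<in> sets Q}"
      then obtain A B where R: "R = A \<times> B" "A \<in> \<B>" "B \<in> sets Q" by blast
      obtain p where p: "p \<in> C" "A \<in> fst p" using R(2) unfolding \<B>_def by blast
      then have "R \<in> ?S p" unfolding S[OF p(1)] using R by (intro sigma_sets.Basic) blast
      then show "R \<in> (\<Union>p\<in>C. ?S p)" using p(1) by blast
    qed
    ultimately have "sets (sigma (space M) \<B> \<Otimes>\<^sub>M Q) \<subseteq> (\<Union>p\<in>C. ?S p)"
      unfolding sets_sigma_pair[OF sB] by (rule sigma_algebra.sigma_sets_subset)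
    then obtain \<A> s where p: "(\<A>, s) \<in> C" "E \<in> sets (sigma (space M) \<A> \<Otimes>\<^sub>M Q)" using E by force
    have "hsection E y \<in> \<A>" for y
      using hsection_sets[OF p(2)] by (simp add: sets_sigma_sigma_algebra[OF section_liftingD(1)[OF L[OF p(1)]]])
    then show "AE z in M \<Otimes>\<^sub>M Q. (fst z \<in> t (hsection E (snd z))) = (z \<in> E)"
      using section_liftingD(6)[OF L[OF p(1)] p(2)] t[OF p(1)] by simp
  qed
  moreover have "\<A> \<subseteq> \<B> \<and> (\<forall>A\<in>\<A>. t A = s A)" if "(\<A>, s) \<in> C" for \<A> s
    using t[OF that] UN_upper[OF that, of fst] by (simp add: \<B>_def)
  ultimately show ?thesis by (intro exI[of _ \<B>] exI[of _ t] conjI) auto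
qed

text \<open>Either every sequence in the chain has an upper bound there, and the union works, or
  some sequence has none. In a chain such a sequence is cofinal, which reduces the question to a
  countable limit.\<close>

lemma section_lifting_chain:
  assumes "prob_space M" "prob_space Q" and "C \<noteq> {}" and L: "\<And>\<A> s. (\<A>, s) \<in> C \<Longrightarrow> section_lifting M Q \<A> s"
    and chain: "\<And>\<A> s \<A>' s'. (\<A>, s) \<in> C \<Longrightarrow> (\<A>', s') \<in> C \<Longrightarrow>
      \<A> \<subseteq> \<A>' \<and> (\<forall>A\<in>\<A>. s' A = s A) \<or> \<A>' \<subseteq> \<A> \<and> (\<forall>A\<in>\<A>'. s A = s' A)"
  shows "\<exists>\<B> t. section_lifting M Q \<B> t \<and> (\<forall>(\<A>, s)\<in>C. \<A> \<subseteq> \<B> \<and> (\<forall>A\<in>\<A>. t A = s A))"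
proof (cases "\<forall>c::nat \<Rightarrow> _. range c \<subseteq> C \<longrightarrow> (\<exists>p\<in>C. \<forall>n. fst (c n) \<subseteq> fst p)")
  case True
  have agree: "s A = s' A" if "(\<A>, s) \<in> C" "(\<A>', s') \<in> C" "A \<in> \<A>" "A \<in> \<A>'" for \<A> s \<A>' s' A
    using chain[OF that(1,2)] that(3,4) by auto
  show ?thesis
  proof (rule section_lifting_union[OF assms(3)])
    show "section_lifting M Q \<A> s" if "(\<A>, s) \<in> C" for \<A> s using that by (rule L)
    show "s A = s' A" if "(\<A>, s) \<in> C" "(\<A>', s') \<in> C" "A \<in> \<A>" "A \<in> \<A>'" for \<A> s \<A>' s' A
      using that by (rule agree)
    show "\<exists>p\<in>C. \<forall>n. fst (c n) \<subseteq> fst p" if "range c \<subseteq> C" for c :: "nat \<Rightarrow> _"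
      using True that by blast
  qed
next
  case False
  then have "\<exists>c :: nat \<Rightarrow> _. (\<forall>n. c n \<in> C) \<and> (\<forall>p\<in>C. \<exists>n. \<not> fst (c n) \<subseteq> fst p)"
    by (simp add: image_subset_iff)
  then obtain c :: "nat \<Rightarrow> _" where c: "\<And>n. c n \<in> C" "\<And>p. p \<in> C \<Longrightarrow> \<exists>n. \<not> fst (c n) \<subseteq> fst p"
    by blast
  \<comment> \<open>The running maximum of \<open>c\<close>: it increases and dominates every
    \<open>c n\<close>.\<close>
  define d where "d = rec_nat (c 0) (\<lambda>n p. if fst p \<subseteq> fst (c (Suc n)) then c (Suc n) else p)"
  have d0: "d 0 = c 0" and dS: "d (Suc n) = (if fst (d n) \<subseteq> fst (c (Suc n)) then c (Suc n) else d n)" for n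
    by (simp_all add: d_def)
  have dC: "d n \<in> C" for n by (induction n) (simp_all add: d0 dS c)
  have comp: "fst p \<subseteq> fst q \<or> fst q \<subseteq> fst p" if "p \<in> C" "q \<in> C" for p q
    using chain[of "fst p" "snd p" "fst q" "snd q"] that by auto
  have agree: "snd q A = snd p A" if "p \<in> C" "q \<in> C" "A \<in> fst p" "A \<in> fst q" for p q A
    using chain[of "fst p" "snd p" "fst q" "snd q"] that by auto
  have d_mono: "m \<le> n \<Longrightarrow> fst (d m) \<subseteq> fst (d n)" for m n
    by (rule lift_Suc_mono_le[of "\<lambda>n. fst (d n)"]) (auto simp: dS)
  have cd: "fst (c n) \<subseteq> fst (d n)" for n
  proof (cases n)
    case (Suc k)
    then show ?thesis using comp[OF dC[of k] c(1)[of "Suc k"]] by (auto simp: dS)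
  qed (simp add: d0)
  have cofinal: "\<exists>n. fst p \<subseteq> fst (d n)" if "p \<in> C" for p
    using c(2)[OF that] comp[OF that c(1)] cd by (meson order_trans)
  have "\<exists>\<B> t. section_lifting M Q \<B> t \<and> (\<forall>n. fst (d n) \<subseteq> \<B> \<and> (\<forall>A\<in>fst (d n). t A = snd (d n) A))"
  proof (rule section_lifting_limit[OF assms(1,2)])
    show "section_lifting M Q (fst (d n)) (snd (d n))" for n using L[of "fst (d n)" "snd (d n)"] dC by simp
    show "snd (d n) A = snd (d m) A" if "m \<le> n" "A \<in> fst (d m)" for m n A
      using agree[OF dC dC that(2)] d_mono[OF that(1)] that(2) by blast
  qed (rule d_mono)
  then obtain \<B> t where Bt: "section_lifting M Q \<B> t" "\<And>n. fst (d n) \<subseteq> \<B>"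
    "\<And>n A. A \<in> fst (d n) \<Longrightarrow> t A = snd (d n) A" by blast
  have "fst p \<subseteq> \<B> \<and> (\<forall>A\<in>fst p. t A = snd p A)" if p: "p \<in> C" for p
  proof -
    obtain n where n: "fst p \<subseteq> fst (d n)" using cofinal[OF p] by blast
    have "t A = snd p A" if "A \<in> fst p" for A
      using Bt(3)[of A n] agree[OF p dC[of n] that] n that by auto
    then show ?thesis using n Bt(2) by blast
  qed
  then have "\<forall>p\<in>C. fst p \<subseteq> \<B> \<and> (\<forall>A\<in>fst p. t A = snd p A)" by blast
  then show ?thesis using Bt(1) by (intro exI[of _ \<B>] exI[of _ t] conjI) (simp_all add: split_beta)
qed

theorem exists_section_lifting:
  assumes "prob_space M" "prob_space Q"
  shows "\<exists>s. section_lifting M Q (sets M) s"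
proof -
  interpret M: prob_space M by fact
  \<comment> \<open>The identity is admissible on the trivial \<sigma>-algebra: the whole space has
    measure 1, so the only null set there is the empty one.\<close>
  have start: "section_lifting M Q {{}, space M} (\<lambda>A. A)"
    unfolding section_lifting_def
  proof (intro conjI ballI sigma_algebra_trivial)
    have "space M \<notin> null_sets M" using M.emeasure_space_1 by auto
    then show "set_hom (space M) (null_sets M) {{}, space M} (space M) (\<lambda>A. A)"
      by (intro set_homI) auto
  qed (simp_all add: hsection_def)
  have "\<exists>\<A> s. section_lifting M Q \<A> s \<and>
      (\<forall>\<B> t. section_lifting M Q \<B> t \<and> \<A> \<subseteq> \<B> \<and> (\<forall>A\<in>\<A>. t A = s A) \<longrightarrow> \<B> = \<A>)"
  proof (rule partial_map_Zorn[of "section_lifting M Q", OF start])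
    fix C assume C: "C \<noteq> {}" and L: "\<And>\<A> s. (\<A>, s) \<in> C \<Longrightarrow> section_lifting M Q \<A> s"
      and chain: "\<And>\<A> s \<A>' s'. (\<A>, s) \<in> C \<Longrightarrow> (\<A>', s') \<in> C \<Longrightarrow>
        \<A> \<subseteq> \<A>' \<and> (\<forall>A\<in>\<A>. s' A = s A) \<or> \<A>' \<subseteq> \<A> \<and> (\<forall>A\<in>\<A>'. s A = s' A)"
    show "\<exists>\<B> t. section_lifting M Q \<B> t \<and> (\<forall>(\<A>, s)\<in>C. \<A> \<subseteq> \<B> \<and> (\<forall>A\<in>\<A>. t A = s A))"
    proof (rule section_lifting_chain[OF assms C])
      show "section_lifting M Q \<A> s" if "(\<A>, s) \<in> C" for \<A> s using that by (rule L)
      show "\<A> \<subseteq> \<A>' \<and> (\<forall>A\<in>\<A>. s' A = s A) \<or> \<A>' \<subseteq> \<A> \<and> (\<forall>A\<in>\<A>'. s A = s' A)"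
        if "(\<A>, s) \<in> C" "(\<A>', s') \<in> C" for \<A> s \<A>' s' using that by (rule chain)
    qed
  qed
  then obtain \<A> s where max: "section_lifting M Q \<A> s \<and>
      (\<forall>\<B> t. section_lifting M Q \<B> t \<and> \<A> \<subseteq> \<B> \<and> (\<forall>A\<in>\<A>. t A = s A) \<longrightarrow> \<B> = \<A>)"
    by (elim exE)
  note L = max[THEN conjunct1]
  have "E \<in> \<A>" if "E \<in> sets M" for E
  proof -
    from section_lifting_adjoin[OF assms L that] obtain \<B> t
      where B: "section_lifting M Q \<B> t \<and> \<A> \<subseteq> \<B> \<and> E \<in> \<B> \<and> (\<forall>A\<in>\<A>. t A = s A)"
      by (elim exE)
    then have "\<B> = \<A>" using max[THEN conjunct2, THEN spec, THEN spec, of \<B> t] by simp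
    then show ?thesis using B by simp
  qed
  then have "\<A> = sets M" using section_liftingD(2)[OF L] by blast
  then show ?thesis using L by blast
qed

section \<open>Liftings, completions and extension of homomorphisms\<close>

lemma set_hom_Un:
  assumes h: "set_hom \<Omega> \<N> \<G> \<Omega>' h" and "algebra \<Omega> \<G>" and AB: "A \<in> \<G>" "B \<in> \<G>"
  shows "h (A \<union> B) = h A \<union> h B"
proof -
  interpret algebra \<Omega> \<G> by fact
  have AB': "\<Omega> - A \<in> \<G>" "\<Omega> - B \<in> \<G>" using AB by auto
  have "A \<union> B = \<Omega> - ((\<Omega> - A) \<inter> (\<Omega> - B))" using AB sets_into_space by blast
  then have "h (A \<union> B) = \<Omega>' - (h (\<Omega> - A) \<inter> h (\<Omega> - B))"
    using set_homD(2)[OF h Int[OF AB']] set_homD(3)[OF h AB'] by simp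
  then show ?thesis
    unfolding set_homD(2)[OF h AB(1)] set_homD(2)[OF h AB(2)]
    using set_homD(1)[OF h AB(1)] set_homD(1)[OF h AB(2)] by blast
qed

lemma liftingsD:
  assumes "\<sigma> \<in> liftings S"
  shows "A \<in> sets S \<Longrightarrow> \<sigma> A \<in> sets S" "A \<in> sets S \<Longrightarrow> AE x in S. x \<in> \<sigma> A \<longleftrightarrow> x \<in> A"
    "A \<in> sets S \<Longrightarrow> B \<in> sets S \<Longrightarrow> AE x in S. x \<in> A \<longleftrightarrow> x \<in> B \<Longrightarrow> \<sigma> A = \<sigma> B"
    "A \<in> sets S \<Longrightarrow> \<sigma> (\<sigma> A) = \<sigma> A" "\<sigma> {} = {}"
    "A \<in> sets S \<Longrightarrow> B \<in> sets S \<Longrightarrow> \<sigma> (A \<inter> B) = \<sigma> A \<inter> \<sigma> B"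
    "A \<in> sets S \<Longrightarrow> \<sigma> (space S - A) = space S - \<sigma> A"
proof -
  note d = assms[unfolded liftings_def lower_density_def mem_Collect_eq]
  have 1: "\<sigma> A \<in> sets S" if "A \<in> sets S" for A using d that by blast
  have 2: "AE x in S. x \<in> \<sigma> A \<longleftrightarrow> x \<in> A" if "A \<in> sets S" for A using d that by blast
  have 3: "\<sigma> A = \<sigma> B" if "A \<in> sets S" "B \<in> sets S" "AE x in S. x \<in> A \<longleftrightarrow> x \<in> B" for A B using d that by blast
  have 4: "\<sigma> {} = {}" using d by blast
  have Int: "\<forall>A\<in>sets S. \<forall>B\<in>sets S. \<sigma> (A \<inter> B) = \<sigma> A \<inter> \<sigma> B" using d by (elim conjE)
  have 5: "\<sigma> (A \<inter> B) = \<sigma> A \<inter> \<sigma> B" if "A \<in> sets S" "B \<in> sets S" for A B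
    using that by (rule Int[THEN bspec, THEN bspec])
  have compl: "\<forall>A\<in>sets S. \<sigma> (space S - A) = space S - \<sigma> A" using d by (elim conjE)
  have 6: "\<sigma> (space S - A) = space S - \<sigma> A" if "A \<in> sets S" for A using that by (rule compl[THEN bspec])
  show "A \<in> sets S \<Longrightarrow> \<sigma> A \<in> sets S" "A \<in> sets S \<Longrightarrow> AE x in S. x \<in> \<sigma> A \<longleftrightarrow> x \<in> A" "\<sigma> {} = {}"
    "A \<in> sets S \<Longrightarrow> B \<in> sets S \<Longrightarrow> AE x in S. x \<in> A \<longleftrightarrow> x \<in> B \<Longrightarrow> \<sigma> A = \<sigma> B"
    "A \<in> sets S \<Longrightarrow> B \<in> sets S \<Longrightarrow> \<sigma> (A \<inter> B) = \<sigma> A \<inter> \<sigma> B"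
    "A \<in> sets S \<Longrightarrow> \<sigma> (space S - A) = space S - \<sigma> A"
    by (fact 1, fact 2, fact 4, fact 3, fact 5, fact 6)
  show "\<sigma> (\<sigma> A) = \<sigma> A" if "A \<in> sets S"
    using that by (intro 3 1 2)
qed

lemma liftings_set_hom:
  assumes "\<sigma> \<in> liftings S"
  shows "set_hom (space S) (null_sets S) (sets S) (space S) \<sigma>"
proof (rule set_homI)
  show "\<sigma> A \<subseteq> space S" if "A \<in> sets S" for A
    using liftingsD(1)[OF assms that] by (rule sets.sets_into_space)
  show "\<sigma> A = {}" if "A \<in> sets S" "A \<in> null_sets S" for A
  proof -
    have "AE x in S. x \<in> A \<longleftrightarrow> x \<in> {}" using AE_not_in[OF that(2)] by simp
    then have "\<sigma> A = \<sigma> {}" by (intro liftingsD(3)[OF assms that(1)]) auto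
    then show ?thesis using liftingsD(5)[OF assms] by simp
  qed
  show "\<sigma> (space S - A) = space S - \<sigma> A" if "A \<in> sets S" for A using that by (rule liftingsD(7)[OF assms])
  show "\<sigma> (A \<inter> B) = \<sigma> A \<inter> \<sigma> B" if "A \<in> sets S" "B \<in> sets S" for A B
    using that by (rule liftingsD(6)[OF assms])
qed

lemma liftingsI:
  assumes "\<And>A. A \<in> sets S \<Longrightarrow> \<sigma> A \<in> sets S" "\<And>A. A \<in> sets S \<Longrightarrow> AE x in S. x \<in> \<sigma> A \<longleftrightarrow> x \<in> A"
    and hom: "set_hom (space S) (null_sets S) (sets S) (space S) \<sigma>"
  shows "\<sigma> \<in> liftings S"
proof -
  have "\<sigma> A = \<sigma> B" if "A \<in> sets S" "B \<in> sets S" "AE z in S. z \<in> A \<longleftrightarrow> z \<in> B" for A B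
  proof (rule set_hom_cong_null[OF hom sets.algebra_axioms that(1,2)])
    have "AE z in S. z \<in> A \<longrightarrow> z \<in> B" "AE z in S. z \<in> B \<longrightarrow> z \<in> A"
      using that(3) by (eventually_elim, simp)+
    with that(1,2) show "A - B \<in> null_sets S" "B - A \<in> null_sets S"
      by (simp_all add: AE_imp_Diff_null_sets)
  qed
  then show ?thesis
    unfolding liftings_def lower_density_def mem_Collect_eq
    by (intro conjI ballI impI assms(1,2) set_homD(2,3)[OF hom]
        set_hom_whole[OF hom sets.algebra_axioms null_sets.empty_sets])
qed

lemma AE_completionD:
  assumes "AE x in completion M. \<phi> x"
  shows "AE x in M. \<phi> x"
proof -
  obtain N where N: "N \<in> null_sets (completion M)" "{x \<in> space M. \<not> \<phi> x} \<subseteq> N"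
    using assms by (auto simp: eventually_ae_filter)
  then obtain N' where "N' \<in> null_sets M" "N \<subseteq> N'" by (auto simp: null_sets_completion_iff2)
  then show ?thesis using N(2) by (intro AE_I'[of N']) auto
qed

lemma main_part_AE:
  assumes "A \<in> sets (completion M)"
  shows "AE x in M. x \<in> main_part M A \<longleftrightarrow> x \<in> A"
proof -
  obtain N where N: "N \<in> null_sets M" "null_part M A \<subseteq> N" using null_part[OF assms] by blast
  have "main_part M A \<subseteq> A" "A \<subseteq> main_part M A \<union> N"
    using main_part_null_part_Un[OF assms] N(2) by blast+
  then show ?thesis using AE_not_in[OF N(1)] by (auto elim!: eventually_mono)
qed

lemma sets_completion_AE_eq:
  assumes "A \<in> sets (completion M)" "B \<subseteq> space M" "AE x in M. x \<in> B \<longleftrightarrow> x \<in> A"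
  shows "B \<in> sets (completion M)"
proof -
  obtain N where N: "N \<in> null_sets M" "{x \<in> space M. \<not> (x \<in> B \<longleftrightarrow> x \<in> A)} \<subseteq> N"
    using assms(3) by (auto simp: eventually_ae_filter)
  have "A \<subseteq> space M" using sets.sets_into_space[OF assms(1)] by simp
  then have "B - A \<subseteq> N" "A - B \<subseteq> N" using N(2) assms(2) by blast+
  then have D: "B - A \<in> sets (completion M)" "A - B \<in> sets (completion M)"
    by (simp_all add: null_sets_completion[OF N(1)])
  have "(A - (A - B)) \<union> (B - A) \<in> sets (completion M)"
    by (rule sets.Un[OF sets.Diff[OF assms(1) D(2)] D(1)])
  moreover have "(A - (A - B)) \<union> (B - A) = B" by blast
  ultimately show ?thesis by simp
qed

text \<open>Sikorski's extension theorem, with the complete Boolean algebra of classes of measurable sets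
  realised by the fixed sets of a lifting.\<close>

theorem set_hom_into_lifted_sets_extends:
  assumes "finite_measure M" and \<sigma>: "\<sigma> \<in> liftings M"
    and start: "algebra (space N) \<G>0" "\<G>0 \<subseteq> sets N" "set_hom (space N) (null_sets N) \<G>0 (space M) h0"
      "\<And>A. A \<in> \<G>0 \<Longrightarrow> h0 A \<in> sets M \<and> \<sigma> (h0 A) = h0 A"
  shows "\<exists>h. set_hom (space N) (null_sets N) (sets N) (space M) h \<and>
    (\<forall>A\<in>sets N. h A \<in> sets M \<and> \<sigma> (h A) = h A) \<and> (\<forall>A\<in>\<G>0. h A = h0 A)"
proof -
  note \<sigma>_hom = liftings_set_hom[OF \<sigma>]
  \<comment> \<open>The domains are algebras and not \<sigma>-algebras, so the union of any nonempty
    chain is again admissible and no distinction by cofinality arises.\<close>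
  define V where "V \<G> h \<longleftrightarrow> algebra (space N) \<G> \<and> \<G> \<subseteq> sets N \<and> \<G>0 \<subseteq> \<G> \<and>
    set_hom (space N) (null_sets N) \<G> (space M) h \<and> (\<forall>A\<in>\<G>. h A \<in> sets M \<and> \<sigma> (h A) = h A) \<and>
    (\<forall>A\<in>\<G>0. h A = h0 A)" for \<G> h
  have VD: "algebra (space N) \<G>" "\<G> \<subseteq> sets N" "\<G>0 \<subseteq> \<G>" "set_hom (space N) (null_sets N) \<G> (space M) h"
    "\<And>A. A \<in> \<G> \<Longrightarrow> h A \<in> sets M" "\<And>A. A \<in> \<G> \<Longrightarrow> \<sigma> (h A) = h A" "\<And>A. A \<in> \<G>0 \<Longrightarrow> h A = h0 A"
    if "V \<G> h" for \<G> h using that by (auto simp: V_def)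
  have "V \<G>0 h0" using start by (simp add: V_def)
  then have "\<exists>\<G> h. V \<G> h \<and> (\<forall>\<G>' h'. V \<G>' h' \<and> \<G> \<subseteq> \<G>' \<and> (\<forall>A\<in>\<G>. h' A = h A) \<longrightarrow> \<G>' = \<G>)"
  proof (rule partial_map_Zorn[of V])
    fix C assume C: "C \<noteq> {}" "\<And>\<G> h. (\<G>, h) \<in> C \<Longrightarrow> V \<G> h"
      and chain: "\<And>\<G> h \<G>' h'. (\<G>, h) \<in> C \<Longrightarrow> (\<G>', h') \<in> C \<Longrightarrow>
        \<G> \<subseteq> \<G>' \<and> (\<forall>A\<in>\<G>. h' A = h A) \<or> \<G>' \<subseteq> \<G> \<and> (\<forall>A\<in>\<G>'. h A = h' A)"
    define \<G>' where "\<G>' = (\<Union>p\<in>C. fst p)"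
    define t where "t A = snd (SOME p. p \<in> C \<and> A \<in> fst p) A" for A
    have t: "t A = h A" if "(\<G>, h) \<in> C" "A \<in> \<G>" for \<G> h A
    proof -
      have "\<exists>p. p \<in> C \<and> A \<in> fst p" using that by force
      then have p: "(SOME p. p \<in> C \<and> A \<in> fst p) \<in> C \<and> A \<in> fst (SOME p. p \<in> C \<and> A \<in> fst p)" by (rule someI_ex)
      then show ?thesis
        unfolding t_def using chain[of "fst (SOME p. p \<in> C \<and> A \<in> fst p)" "snd (SOME p. p \<in> C \<and> A \<in> fst p)" \<G> h] that
        by auto
    qed
    have two: "\<exists>\<G> h. (\<G>, h) \<in> C \<and> A \<in> \<G> \<and> B \<in> \<G>" if AB: "A \<in> \<G>'" "B \<in> \<G>'" for A B
    proof -
      obtain \<G>1 h1 \<G>2 h2 where 1: "(\<G>1, h1) \<in> C" "A \<in> \<G>1" and 2: "(\<G>2, h2) \<in> C" "B \<in> \<G>2"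
        using AB by (force simp: \<G>'_def)
      then have "\<G>1 \<subseteq> \<G>2 \<or> \<G>2 \<subseteq> \<G>1" using chain[OF 1(1) 2(1)] by blast
      then show ?thesis using 1 2 by blast
    qed
    have one: "\<exists>\<G> h. (\<G>, h) \<in> C \<and> A \<in> \<G>" if "A \<in> \<G>'" for A using two[OF that that] by blast
    have sub: "\<G> \<subseteq> \<G>'" if "(\<G>, h) \<in> C" for \<G> h using that by (force simp: \<G>'_def)
    obtain \<G>1 h1 where 1: "(\<G>1, h1) \<in> C" using C(1) by auto
    have "V \<G>' t"
      unfolding V_def
    proof (intro conjI ballI)
      show "algebra (space N) \<G>'"
        unfolding algebra_iff_Int
      proof (intro conjI ballI)
        show "\<G>' \<subseteq> Pow (space N)"
        proof
          fix A assume "A \<in> \<G>'"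
          then obtain \<G> h where "(\<G>, h) \<in> C" "A \<in> \<G>" using one by blast
          then have "A \<in> sets N" using VD(2)[OF C(2)] by blast
          then show "A \<in> Pow (space N)" using sets.sets_into_space by blast
        qed
        interpret A1: algebra "space N" \<G>1 by (rule VD(1)[OF C(2)[OF 1]])
        show "{} \<in> \<G>'" using sub[OF 1] by blast
        fix A assume A: "A \<in> \<G>'"
        then obtain \<G> h where p: "(\<G>, h) \<in> C" "A \<in> \<G>" using one by blast
        interpret A: algebra "space N" \<G> by (rule VD(1)[OF C(2)[OF p(1)]])
        show "space N - A \<in> \<G>'" using sub[OF p(1)] A.compl_sets[OF p(2)] by blast
        fix B assume B: "B \<in> \<G>'"
        obtain \<H> k where q: "(\<H>, k) \<in> C" "A \<in> \<H>" "B \<in> \<H>" using two[OF A B] by blast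
        interpret B: algebra "space N" \<H> by (rule VD(1)[OF C(2)[OF q(1)]])
        show "A \<inter> B \<in> \<G>'" using sub[OF q(1)] B.Int[OF q(2,3)] by blast
      qed
      show "\<G>' \<subseteq> sets N"
      proof
        fix A assume "A \<in> \<G>'"
        then obtain \<G> h where "(\<G>, h) \<in> C" "A \<in> \<G>" using one by blast
        then show "A \<in> sets N" using VD(2)[OF C(2)] by blast
      qed
      show "\<G>0 \<subseteq> \<G>'" using VD(3)[OF C(2)[OF 1]] sub[OF 1] by blast
      show "set_hom (space N) (null_sets N) \<G>' (space M) t"
      proof (rule set_homI)
        fix A assume "A \<in> \<G>'"
        then obtain \<G> h where p: "(\<G>, h) \<in> C" "A \<in> \<G>" using one by blast
        note h = VD(4)[OF C(2)[OF p(1)]]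
        interpret A: algebra "space N" \<G> by (rule VD(1)[OF C(2)[OF p(1)]])
        show "t A \<subseteq> space M" using t[OF p] set_homD(1)[OF h p(2)] by simp
        show "t (space N - A) = space M - t A"
          using t[OF p] t[OF p(1) A.compl_sets[OF p(2)]] set_homD(2)[OF h p(2)] by simp
        show "t A = {}" if "A \<in> null_sets N" using t[OF p] set_homD(4)[OF h p(2) that] by simp
      next
        fix A B assume "A \<in> \<G>'" "B \<in> \<G>'"
        then obtain \<G> h where p: "(\<G>, h) \<in> C" "A \<in> \<G>" "B \<in> \<G>" using two by blast
        note h = VD(4)[OF C(2)[OF p(1)]]
        interpret A: algebra "space N" \<G> by (rule VD(1)[OF C(2)[OF p(1)]])
        show "t (A \<inter> B) = t A \<inter> t B"
          using t[OF p(1) p(2)] t[OF p(1) p(3)] t[OF p(1) A.Int[OF p(2,3)]] set_homD(3)[OF h p(2,3)] by simp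
      qed
      show "t A \<in> sets M" "\<sigma> (t A) = t A" if "A \<in> \<G>'" for A
        using one[OF that] VD(5,6)[OF C(2)] t by metis+
      show "t A = h0 A" if "A \<in> \<G>0" for A
        using VD(3,7)[OF C(2)[OF 1]] t[OF 1] that by auto
    qed
    then show "\<exists>\<G> h. V \<G> h \<and> (\<forall>(\<G>', h')\<in>C. \<G>' \<subseteq> \<G> \<and> (\<forall>A\<in>\<G>'. h A = h' A))"
      using sub t by (intro exI[of _ \<G>'] exI[of _ t]) auto
  qed
  then obtain \<G> h where max: "V \<G> h \<and> (\<forall>\<G>' h'. V \<G>' h' \<and> \<G> \<subseteq> \<G>' \<and> (\<forall>A\<in>\<G>. h' A = h A) \<longrightarrow> \<G>' = \<G>)"
    by (elim exE)
  note V = max[THEN conjunct1]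
  note hom = VD(4)[OF V] and alg = VD(1)[OF V]
  interpret G: algebra "space N" \<G> by (rule alg)
  have "E \<in> \<G>" if E: "E \<in> sets N" for E
  proof -
    let ?\<G>' = "{(F \<inter> E) \<union> (G - E) |F G. F \<in> \<G> \<and> G \<in> \<G>}"
    have E\<Omega>: "E \<subseteq> space N" using E by (rule sets.sets_into_space)
    \<comment> \<open>The supremum is taken over the images in \<open>M\<close>, not over the sets
      \<open>D\<close> in \<open>N\<close>: the domain need not be closed under countable unions,
      only the target has to be complete.\<close>
    have "\<exists>S :: nat \<Rightarrow> _. range S \<subseteq> h ` {D \<in> \<G>. D - E \<in> null_sets N} \<and>
      (\<forall>K\<in>h ` {D \<in> \<G>. D - E \<in> null_sets N}. K - (\<Union>n. S n) \<in> null_sets M)"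
    proof (rule finite_measure_ess_sup_family[OF assms(1)])
      show "h ` {D \<in> \<G>. D - E \<in> null_sets N} \<subseteq> sets M" using VD(5)[OF V] by blast
      have "h {} = {}" by (rule set_hom_whole(2)[OF hom alg]) simp
      then show "{} \<in> h ` {D \<in> \<G>. D - E \<in> null_sets N}" by (intro image_eqI[of _ _ "{}"]) auto
      fix A B assume "A \<in> h ` {D \<in> \<G>. D - E \<in> null_sets N}" "B \<in> h ` {D \<in> \<G>. D - E \<in> null_sets N}"
      then obtain D1 D2 where D: "A = h D1" "B = h D2" "D1 \<in> \<G>" "D2 \<in> \<G>" "D1 - E \<in> null_sets N" "D2 - E \<in> null_sets N"
        by blast
      then have "A \<union> B = h (D1 \<union> D2)" using set_hom_Un[OF hom alg] by simp
      moreover have "D1 \<union> D2 - E \<in> null_sets N" unfolding Un_Diff using D by blast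
      ultimately show "A \<union> B \<in> h ` {D \<in> \<G>. D - E \<in> null_sets N}" using D by blast
    qed
    then obtain S :: "nat \<Rightarrow> _" where S: "range S \<subseteq> h ` {D \<in> \<G>. D - E \<in> null_sets N} \<and>
      (\<forall>K\<in>h ` {D \<in> \<G>. D - E \<in> null_sets N}. K - (\<Union>n. S n) \<in> null_sets M)"
      by (elim exE)
    have S1: "\<exists>D\<in>\<G>. D - E \<in> null_sets N \<and> S n = h D" for n
    proof -
      have "S n \<in> h ` {D \<in> \<G>. D - E \<in> null_sets N}" using S[THEN conjunct1] by (rule subsetD) simp
      then show ?thesis by blast
    qed
    define SS where "SS = (\<Union>n. S n)"
    have "S n \<in> sets M" for n using S1[of n] VD(5)[OF V] by auto
    then have SS: "SS \<in> sets M" unfolding SS_def by auto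
    \<comment> \<open>\<open>\<sigma>\<close> turns the essential supremum into the least measurable
      fixed set above all the \<open>h D\<close>. Each \<open>h D\<close> is disjoint from
      \<open>h F\<close> when \<open>F \<inter> E\<close> is null, and this disjointness passes to
      the supremum.\<close>
    define K where "K = \<sigma> SS"
    have K: "K \<in> sets M" "\<sigma> K = K" using liftingsD(1,4)[OF \<sigma> SS] by (auto simp: K_def)
    have "\<exists>h'. set_hom (space N) (null_sets N) ?\<G>' (space M) h' \<and>
        (\<forall>F\<in>\<G>. \<forall>G\<in>\<G>. h' ((F \<inter> E) \<union> (G - E)) = (h F \<inter> K) \<union> (h G - K))"
    proof (rule set_hom_adjoin_set[OF hom alg _ _ sets.algebra_axioms VD(2)[OF V] E])
      show "{} \<in> null_sets N" by simp
      show "B \<in> null_sets N" if "A \<in> null_sets N" "B \<in> sets N" "B \<subseteq> A" for A B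
        using that by (rule null_sets_subset)
      show "K \<subseteq> space M" using K(1) by (rule sets.sets_into_space)
      show "h F \<inter> K = {}" if F: "F \<in> \<G>" "F \<inter> E \<in> null_sets N" for F
      proof -
        have "h F \<inter> h D = {}" if D: "D \<in> \<G>" "D - E \<in> null_sets N" for D
        proof (rule set_hom_disjoint[OF hom alg F(1) D(1)])
          show "F \<inter> D \<in> null_sets N"
            using null_sets.Un[OF F(2) D(2)] by (rule null_sets_subset) (use F D VD(2)[OF V] in auto)
        qed
        then have "h F \<inter> S n = {}" for n using S1[of n] by auto
        then have "h F \<inter> SS = {}" unfolding SS_def by blast
        then have "\<sigma> (h F) \<inter> \<sigma> SS = {}"
          using VD(5)[OF V F(1)] SS by (intro set_hom_disjoint[OF \<sigma>_hom sets.algebra_axioms]) auto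
        then show ?thesis using VD(6)[OF V F(1)] by (simp add: K_def)
      qed
      show "h F \<subseteq> K" if F: "F \<in> \<G>" "F - E \<in> null_sets N" for F
      proof -
        have "h F - SS \<in> null_sets M"
          unfolding SS_def by (rule S[THEN conjunct2, THEN bspec]) (use F in blast)
        then have "\<sigma> (h F) \<subseteq> \<sigma> SS"
          using VD(5)[OF V F(1)] SS by (intro set_hom_mono[OF \<sigma>_hom sets.algebra_axioms]) auto
        then show ?thesis using VD(6)[OF V F(1)] by (simp add: K_def)
      qed
    qed
    then obtain h' where h'_ext: "set_hom (space N) (null_sets N) ?\<G>' (space M) h' \<and>
        (\<forall>F\<in>\<G>. \<forall>G\<in>\<G>. h' ((F \<inter> E) \<union> (G - E)) = (h F \<inter> K) \<union> (h G - K))"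
      by (elim exE)
    note h'_hom = h'_ext[THEN conjunct1] and h' = h'_ext[THEN conjunct2, THEN bspec, THEN bspec]
    have sub: "\<G> \<subseteq> ?\<G>'"
    proof
      fix A assume A: "A \<in> \<G>"
      have "A = (A \<inter> E) \<union> (A - E)" by blast
      then show "A \<in> ?\<G>'" using A by blast
    qed
    have eq: "h' A = h A" if "A \<in> \<G>" for A
    proof -
      have "(A \<inter> E) \<union> (A - E) = A" by blast
      then show ?thesis using h'[OF that that] by auto
    qed
    have "V ?\<G>' h'"
      unfolding V_def
    proof (intro conjI h'_hom ballI)
      show "algebra (space N) ?\<G>'" by (rule adjoin_set_algebra[OF alg E\<Omega>])
      show "?\<G>' \<subseteq> sets N" using VD(2)[OF V] E by blast
      show "\<G>0 \<subseteq> ?\<G>'" using VD(3)[OF V] sub by (rule order_trans)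
      show "h' A = h0 A" if "A \<in> \<G>0" for A using eq VD(3,7)[OF V] that by auto
      fix A assume "A \<in> ?\<G>'"
      then obtain F G where A: "A = (F \<inter> E) \<union> (G - E)" "F \<in> \<G>" "G \<in> \<G>" by blast
      have eqA: "h' A = (h F \<inter> K) \<union> (h G - K)" using h'[OF A(2,3)] A(1) by simp
      note m = VD(5)[OF V A(2)] VD(5)[OF V A(3)] K(1)
      show "h' A \<in> sets M" unfolding eqA using m by auto
      have "\<sigma> ((h F \<inter> K) \<union> (h G - K)) = \<sigma> (h F \<inter> K) \<union> \<sigma> (h G - K)"
        using m by (intro set_hom_Un[OF \<sigma>_hom sets.algebra_axioms]) auto
      also have "\<sigma> (h F \<inter> K) = \<sigma> (h F) \<inter> \<sigma> K" using m by (intro set_homD(3)[OF \<sigma>_hom])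
      also have "\<sigma> (h G - K) = \<sigma> (h G) - \<sigma> K" using m by (intro set_hom_diff[OF \<sigma>_hom sets.algebra_axioms])
      finally show "\<sigma> (h' A) = h' A" unfolding eqA using VD(6)[OF V A(2)] VD(6)[OF V A(3)] K(2) by simp
    qed
    then have "?\<G>' = \<G>" using max[THEN conjunct2, THEN spec, THEN spec, of ?\<G>' h'] sub eq by blast
    moreover have "E = (space N \<inter> E) \<union> ({} - E)" using E\<Omega> by blast
    then have "E \<in> ?\<G>'" using G.top G.empty_sets by blast
    ultimately show ?thesis by simp
  qed
  then have "\<G> = sets N" using VD(2)[OF V] by blast
  then show ?thesis using V by (intro exI[of _ h]) (simp add: V_def)
qed

section \<open>Homomorphisms indexed by the second coordinate\<close>

text \<open>The main part of a set is an uncontrolled choice. As \<open>h\<close> sees only classes,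
  any measurable set in the same class may replace it.\<close>

lemma set_hom_main_part:
  assumes h: "set_hom \<Omega> (null_sets M) (sets M) \<Omega>' h" and \<Omega>: "\<Omega> = space M"
    and A: "A \<in> sets (completion M)" and A': "A' \<in> sets M" "AE x in M. x \<in> A \<longleftrightarrow> x \<in> A'"
  shows "h (main_part M A) = h A'"
proof (rule set_hom_cong_null[OF h _ main_part_sets[OF A] A'(1)])
  show "algebra \<Omega> (sets M)" unfolding \<Omega> by (rule sets.algebra_axioms)
  have "AE x in M. x \<in> main_part M A \<longrightarrow> x \<in> A'" "AE x in M. x \<in> A' \<longrightarrow> x \<in> main_part M A"
    using main_part_AE[OF A] A'(2) by (eventually_elim, simp)+
  then show "main_part M A - A' \<in> null_sets M" "A' - main_part M A \<in> null_sets M"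
    using main_part_sets[OF A] A'(1) by (simp_all add: AE_imp_Diff_null_sets)
qed

text \<open>Composition with the main part remains a homomorphism because \<open>h\<close> ignores
  null sets. Its values differ from their arguments by null sets, and this alone makes them
  measurable for the completion.\<close>

lemma completion_liftingI:
  assumes h: "set_hom (space M) (null_sets M) (sets M) (space M) h"
    and AE: "\<And>A. A \<in> sets M \<Longrightarrow> AE x in M. x \<in> h A \<longleftrightarrow> x \<in> A"
  shows "(\<lambda>A. h (main_part M A)) \<in> liftings (completion M)"
proof (rule liftingsI)
  note mp = set_hom_main_part[OF h refl]
  have AE_mp: "AE x in M. x \<in> h (main_part M A) \<longleftrightarrow> x \<in> A" if A: "A \<in> sets (completion M)" for A
    using AE[OF main_part_sets[OF A]] main_part_AE[OF A] by eventually_elim simp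
  show "h (main_part M A) \<in> sets (completion M)" if A: "A \<in> sets (completion M)" for A
    using set_homD(1)[OF h main_part_sets[OF A]] by (rule sets_completion_AE_eq[OF A _ AE_mp[OF A]])
  show "AE x in completion M. x \<in> h (main_part M A) \<longleftrightarrow> x \<in> A" if A: "A \<in> sets (completion M)" for A
    using AE_mp[OF A] by (rule AE_completion)
  show "set_hom (space (completion M)) (null_sets (completion M)) (sets (completion M)) (space (completion M)) (\<lambda>A. h (main_part M A))"
    unfolding space_completion
  proof (rule set_homI)
    fix A assume A: "A \<in> sets (completion M)"
    note mA = main_part_sets[OF A] and aA = main_part_AE[OF A]
    show "h (main_part M A) \<subseteq> space M" using mA by (rule set_homD(1)[OF h])
    have "space M - A \<in> sets (completion M)" using sets.compl_sets[OF A] by simp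
    moreover have "AE x in M. x \<in> space M - A \<longleftrightarrow> x \<in> space M - main_part M A"
      using aA by eventually_elim simp
    ultimately have "h (main_part M (space M - A)) = h (space M - main_part M A)"
      using mA by (intro mp) auto
    then show "h (main_part M (space M - A)) = space M - h (main_part M A)"
      using set_homD(2)[OF h mA] by simp
    show "h (main_part M A) = {}" if "A \<in> null_sets (completion M)"
    proof -
      have "AE x in M. x \<in> A \<longleftrightarrow> x \<in> {}"
        using AE_completionD[OF AE_not_in[OF that]] by eventually_elim simp
      then have "h (main_part M A) = h {}" by (intro mp A) auto
      then show ?thesis using set_homD(4)[OF h] by simp
    qed
    fix B assume B: "B \<in> sets (completion M)"
    note mB = main_part_sets[OF B] and aB = main_part_AE[OF B]
    have "AE x in M. x \<in> A \<inter> B \<longleftrightarrow> x \<in> main_part M A \<inter> main_part M B"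
      using aA aB by eventually_elim simp
    then have "h (main_part M (A \<inter> B)) = h (main_part M A \<inter> main_part M B)"
      using A B mA mB by (intro mp sets.Int)
    then show "h (main_part M (A \<inter> B)) = h (main_part M A) \<inter> h (main_part M B)"
      using set_homD(3)[OF h mA mB] by simp
  qed
qed

lemma sets_completion_complete:
  assumes "complete_measure M"
  shows "sets (completion M) = sets M"
proof
  interpret complete_measure M by fact
  show "sets (completion M) \<subseteq> sets M"
  proof
    fix A assume "A \<in> sets (completion M)"
    then obtain S N N' where "A = S \<union> N" "S \<in> sets M" "N \<subseteq> N'" "N' \<in> null_sets M"
      by (auto simp: sets_completion)
    then show "A \<in> sets M" using complete by blast
  qed
qed auto

lemma section_lifting_setsD:
  assumes "section_lifting M Q (sets M) s"
  shows "set_hom (space M) (null_sets M) (sets M) (space M) s"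
    "A \<in> sets M \<Longrightarrow> AE x in M. x \<in> s A \<longleftrightarrow> x \<in> A"
    "E \<in> sets (M \<Otimes>\<^sub>M Q) \<Longrightarrow> AE z in M \<Otimes>\<^sub>M Q. fst z \<in> s (hsection E (snd z)) \<longleftrightarrow> z \<in> E"
proof -
  have "sets (sigma (space M) (sets M) \<Otimes>\<^sub>M Q) = sets (M \<Otimes>\<^sub>M Q)"
    by (intro sets_pair_measure_cong) (auto simp: sets_sigma_sigma_algebra sets.sigma_algebra_axioms)
  then show "E \<in> sets (M \<Otimes>\<^sub>M Q) \<Longrightarrow> AE z in M \<Otimes>\<^sub>M Q. fst z \<in> s (hsection E (snd z)) \<longleftrightarrow> z \<in> E"
    using section_liftingD(6)[OF assms] by simp
qed (use section_liftingD(3,5)[OF assms] in auto)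

text \<open>The homomorphism property, the fixed values and the formula for rectangles hold for
  every y in the space. The description by sections holds only almost everywhere, with an
  exceptional set depending on \<open>E\<close>. The target is the completion of \<open>P\<close>,
  where \<sigma> has measurable values.\<close>

lemma exists_section_homs:
  assumes "prob_space P" "prob_space Q"
    and s: "section_lifting P Q (sets P) s" and r: "section_lifting Q P (sets Q) r"
  defines "\<sigma> \<equiv> \<lambda>A. s (main_part P A)"
  shows "\<exists>H. (\<forall>y\<in>space Q. set_hom (space (P \<Otimes>\<^sub>M Q)) (null_sets (P \<Otimes>\<^sub>M Q)) (sets (P \<Otimes>\<^sub>M Q)) (space P) (H y) \<and>
      (\<forall>E\<in>sets (P \<Otimes>\<^sub>M Q). H y E \<in> sets (completion P) \<and> \<sigma> (H y E) = H y E) \<and>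
      (\<forall>A\<in>sets P. \<forall>B\<in>sets Q. H y (A \<times> B) = (if y \<in> r B then s A else {}))) \<and>
    (\<forall>E\<in>sets (P \<Otimes>\<^sub>M Q). AE y in Q. H y E = s (hsection E y))"
proof -
  interpret P: prob_space P by fact
  interpret Q: prob_space Q by fact
  interpret PQ: pair_prob_space P Q ..
  interpret QP: pair_prob_space Q P ..
  interpret cP: finite_measure "completion P"
    by (rule finite_measureI) (simp add: P.emeasure_space_1)
  let ?PQ = "P \<Otimes>\<^sub>M Q"
  note s_hom = section_lifting_setsD(1)[OF s] and r_hom = section_lifting_setsD(1)[OF r]
  have \<sigma>: "\<sigma> \<in> liftings (completion P)"
    unfolding \<sigma>_def by (rule completion_liftingI[OF s_hom section_lifting_setsD(2)[OF s]])
  note \<sigma>_hom = liftings_set_hom[OF \<sigma>, unfolded space_completion]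
  have \<sigma>s: "\<sigma> A = s A" if "A \<in> sets P" for A using that by (simp add: \<sigma>_def)
  define S where "S y E = {x \<in> space P. y \<in> r (Pair x -` E)}" for y E
  \<comment> \<open>Rectangles and null sets belong to \<open>\<G> y\<close> for every y in the
    space, so the extension cannot disturb their values.\<close>
  define \<G> where "\<G> y = {E \<in> sets ?PQ. S y E \<in> sets (completion P)}" for y
  have sec: "Pair x -` E \<in> sets Q" if "E \<in> sets ?PQ" for x E using that by (rule sets_Pair1)
  have S_compl: "S y (space ?PQ - E) = space P - S y E" if E: "E \<in> sets ?PQ" and y: "y \<in> space Q" for y E
  proof -
    have "Pair x -` (space ?PQ - E) = space Q - Pair x -` E" if "x \<in> space P" for x
      using that by (auto simp: space_pair_measure)
    then show ?thesis using set_homD(2)[OF r_hom sec[OF E]] y by (auto simp: S_def)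
  qed
  have S_Int: "S y (E \<inter> F) = S y E \<inter> S y F" if "E \<in> sets ?PQ" "F \<in> sets ?PQ" for y E F
    using set_homD(3)[OF r_hom sec[OF that(1)] sec[OF that(2)]] by (auto simp: S_def vimage_Int)
  have S_rect: "S y (A \<times> B) = (if y \<in> r B then A else {})" if A: "A \<in> sets P" and B: "B \<in> sets Q" for y A B
  proof -
    have "Pair x -` (A \<times> B) = (if x \<in> A then B else {})" for x by auto
    moreover have "r {} = {}" by (rule set_hom_whole(2)[OF r_hom sets.algebra_axioms]) simp
    ultimately show ?thesis using sets.sets_into_space[OF A] by (auto simp: S_def)
  qed
  have S_null: "S y E \<in> null_sets (completion P)" if E: "E \<in> null_sets ?PQ" for y E
  proof -
    have "AE x in P. AE y in Q. (x, y) \<notin> E" by (rule PQ.AE_pair[OF AE_not_in[OF E]])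
    then have "AE x in P. x \<notin> S y E"
    proof eventually_elim
      case (elim x)
      have m: "Pair x -` E \<in> sets Q" using E by (intro sec) auto
      then have "Pair x -` E \<in> null_sets Q" using elim by (subst AE_iff_null_sets) auto
      then show ?case using set_homD(4)[OF r_hom m] by (auto simp: S_def)
    qed
    then obtain N where N: "N \<in> null_sets P" "{x \<in> space P. x \<in> S y E} \<subseteq> N" by (auto simp: eventually_ae_filter)
    moreover have "S y E \<subseteq> space P" by (auto simp: S_def)
    ultimately show ?thesis unfolding null_sets_completion_iff2 by blast
  qed
  have \<G>_alg: "algebra (space ?PQ) (\<G> y)" if y: "y \<in> space Q" for y
    unfolding algebra_iff_Int
  proof (intro conjI ballI)
    show "\<G> y \<subseteq> Pow (space ?PQ)" using sets.sets_into_space by (auto simp: \<G>_def)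
    show "{} \<in> \<G> y" using S_rect[of "{}" "{}" y] by (simp add: \<G>_def)
    show "space ?PQ - E \<in> \<G> y" if "E \<in> \<G> y" for E
    proof -
      have E: "E \<in> sets ?PQ" "S y E \<in> sets (completion P)" using that by (auto simp: \<G>_def)
      have "space P - S y E \<in> sets (completion P)" using sets.compl_sets[OF E(2)] by simp
      then show ?thesis using E by (simp add: \<G>_def S_compl y sets.compl_sets)
    qed
    show "E \<inter> F \<in> \<G> y" if "E \<in> \<G> y" "F \<in> \<G> y" for E F
      using that by (auto simp: \<G>_def S_Int)
  qed
  have ex: "\<exists>H. set_hom (space ?PQ) (null_sets ?PQ) (sets ?PQ) (space P) H \<and>
      (\<forall>E\<in>sets ?PQ. H E \<in> sets (completion P) \<and> \<sigma> (H E) = H E) \<and> (\<forall>E\<in>\<G> y. H E = \<sigma> (S y E))"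
    if y: "y \<in> space Q" for y
  proof -
    have "\<exists>H. set_hom (space ?PQ) (null_sets ?PQ) (sets ?PQ) (space (completion P)) H \<and>
      (\<forall>E\<in>sets ?PQ. H E \<in> sets (completion P) \<and> \<sigma> (H E) = H E) \<and> (\<forall>E\<in>\<G> y. H E = \<sigma> (S y E))"
    proof (rule set_hom_into_lifted_sets_extends[OF cP.finite_measure_axioms \<sigma> \<G>_alg[OF y]])
      show "\<G> y \<subseteq> sets ?PQ" by (auto simp: \<G>_def)
      show "\<sigma> (S y E) \<in> sets (completion P) \<and> \<sigma> (\<sigma> (S y E)) = \<sigma> (S y E)" if "E \<in> \<G> y" for E
        using that liftingsD(1,4)[OF \<sigma>] by (simp add: \<G>_def)
      show "set_hom (space ?PQ) (null_sets ?PQ) (\<G> y) (space (completion P)) (\<lambda>E. \<sigma> (S y E))"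
        unfolding space_completion
      proof (rule set_homI)
        fix E assume "E \<in> \<G> y"
        then have E: "E \<in> sets ?PQ" "S y E \<in> sets (completion P)" by (auto simp: \<G>_def)
        show "\<sigma> (S y E) \<subseteq> space P" using E(2) by (rule set_homD(1)[OF \<sigma>_hom])
        show "\<sigma> (S y (space ?PQ - E)) = space P - \<sigma> (S y E)"
          unfolding S_compl[OF E(1) y] using E(2) by (rule set_homD(2)[OF \<sigma>_hom])
        show "\<sigma> (S y E) = {}" if "E \<in> null_sets ?PQ"
          using E(2) S_null[OF that] by (rule set_homD(4)[OF \<sigma>_hom])
        fix F assume "F \<in> \<G> y"
        then have F: "F \<in> sets ?PQ" "S y F \<in> sets (completion P)" by (auto simp: \<G>_def)
        show "\<sigma> (S y (E \<inter> F)) = \<sigma> (S y E) \<inter> \<sigma> (S y F)"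
          unfolding S_Int[OF E(1) F(1)] using E(2) F(2) by (rule set_homD(3)[OF \<sigma>_hom])
      qed
    qed
    then show ?thesis by simp
  qed
  have "\<exists>H. \<forall>y\<in>space Q.
      set_hom (space ?PQ) (null_sets ?PQ) (sets ?PQ) (space P) (H y) \<and>
      (\<forall>E\<in>sets ?PQ. H y E \<in> sets (completion P) \<and> \<sigma> (H y E) = H y E) \<and> (\<forall>E\<in>\<G> y. H y E = \<sigma> (S y E))"
    by (rule bchoice) (intro ballI ex)
  then obtain H where H: "\<forall>y\<in>space Q.
      set_hom (space ?PQ) (null_sets ?PQ) (sets ?PQ) (space P) (H y) \<and>
      (\<forall>E\<in>sets ?PQ. H y E \<in> sets (completion P) \<and> \<sigma> (H y E) = H y E) \<and> (\<forall>E\<in>\<G> y. H y E = \<sigma> (S y E))"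
    by (elim exE)
  have H_good: "H y E = \<sigma> (S y E)" if "y \<in> space Q" "E \<in> \<G> y" for y E using H that by simp
  have "H y (A \<times> B) = (if y \<in> r B then s A else {})" if "y \<in> space Q" "A \<in> sets P" "B \<in> sets Q" for y A B
  proof -
    have "A \<times> B \<in> \<G> y" using that S_rect[OF that(2,3), of y] by (simp add: \<G>_def)
    then show ?thesis using H_good[OF that(1)] S_rect[OF that(2,3), of y] \<sigma>s that liftingsD(5)[OF \<sigma>] by simp
  qed
  moreover have "AE y in Q. H y E = s (hsection E y)" if E: "E \<in> sets ?PQ" for E
  proof -
    \<comment> \<open>\<open>r\<close> is compatible on the product in the other order, hence the
      swap. For almost every y the set \<open>S y E\<close> then agrees with the section almost
      everywhere, which both puts \<open>E\<close> into \<open>\<G> y\<close> and determines the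
      value.\<close>
    define E' where "E' = (\<lambda>(y, x). (x, y)) -` E \<inter> space (Q \<Otimes>\<^sub>M P)"
    have E': "E' \<in> sets (Q \<Otimes>\<^sub>M P)" unfolding E'_def by (rule measurable_sets[OF measurable_pair_swap' E])
    have E'_sec: "hsection E' x = Pair x -` E" if "x \<in> space P" for x
      using that sets.sets_into_space[OF E] by (auto simp: E'_def hsection_def space_pair_measure)
    have "AE y in Q. AE x in P. y \<in> r (hsection E' x) \<longleftrightarrow> (y, x) \<in> E'"
      using QP.AE_pair[OF section_lifting_setsD(3)[OF r E']] by simp
    then have "AE y in Q. AE x in P. x \<in> S y E \<longleftrightarrow> x \<in> hsection E y"
      using AE_space
    proof eventually_elim
      case (elim y)
      from elim(1) AE_space show ?case
      proof eventually_elim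
        case (elim x)
        have "(y, x) \<in> E' \<longleftrightarrow> (x, y) \<in> E" using elim(2) \<open>y \<in> space Q\<close> by (simp add: E'_def space_pair_measure)
        then show ?case using elim E'_sec[OF elim(2)] by (simp add: S_def hsection_def)
      qed
    qed
    with AE_space show ?thesis
    proof eventually_elim
      case (elim y)
      have sE: "hsection E y \<in> sets P" by (rule hsection_sets[OF E])
      then have cE: "hsection E y \<in> sets (completion P)" by simp
      have SE: "S y E \<in> sets (completion P)"
        using elim(2) by (intro sets_completion_AE_eq[OF cE]) (auto simp: S_def)
      then have "H y E = \<sigma> (S y E)" using E by (intro H_good elim(1)) (simp add: \<G>_def)
      also have "\<dots> = \<sigma> (hsection E y)" by (rule liftingsD(3)[OF \<sigma> SE cE AE_completion[OF elim(2)]])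
      finally show ?case using \<sigma>s[OF sE] by simp
    qed
  qed
  ultimately show ?thesis using H by (intro exI[of _ H] conjI ballI) auto
qed

section \<open>Liftings for a measure given by a density\<close>

lemma nn_integral_indicator_times:
  fixes f :: "'a \<times> 'b \<Rightarrow> ennreal"
  assumes "pair_sigma_finite P Q" and f: "f \<in> borel_measurable (P \<Otimes>\<^sub>M Q)" and AB: "A \<in> sets P" "B \<in> sets Q"
  shows "emeasure (density (P \<Otimes>\<^sub>M Q) f) (A \<times> B) = (\<integral>\<^sup>+y\<in>B. (\<integral>\<^sup>+x\<in>A. f (x, y) \<partial>P) \<partial>Q)"
proof -
  interpret pair_sigma_finite P Q by fact
  note [measurable] = f AB
  have "emeasure (density (P \<Otimes>\<^sub>M Q) f) (A \<times> B) = (\<integral>\<^sup>+z. f z * indicator (A \<times> B) z \<partial>(P \<Otimes>\<^sub>M Q))"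
    by (rule emeasure_density) measurable
  also have "\<dots> = (\<integral>\<^sup>+y. \<integral>\<^sup>+x. f (x, y) * indicator (A \<times> B) (x, y) \<partial>P \<partial>Q)"
    by (rule nn_integral_snd[symmetric]) measurable
  also have "\<dots> = (\<integral>\<^sup>+y\<in>B. (\<integral>\<^sup>+x\<in>A. f (x, y) \<partial>P) \<partial>Q)"
    by (intro nn_integral_cong) (simp add: indicator_times mult.assoc[symmetric] nn_integral_multc)
  finally show ?thesis .
qed

theorem theorem2p6:
  fixes P :: "'a measure" and Q :: "'b measure" and R :: "('a \<times> 'b) measure"
  assumes "prob_space P"
    and "prob_space Q" and "complete_measure Q"
    and "prob_space R" and "sets R = sets (P \<Otimes>\<^sub>M Q)"
    and "distr R P fst = P" and "distr R Q snd = Q"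
    and "absolutely_continuous (P \<Otimes>\<^sub>M Q) R"
  shows "\<exists>T \<rho>'. product_rcp P Q R T \<and> \<rho>' \<in> liftings Q \<and>
    (\<forall>A\<in>sets P. \<forall>B\<in>sets Q. emeasure R (A \<times> B) = 0 \<longrightarrow>
        emeasure Q B = 0 \<or> (\<forall>y\<in>\<rho>' B. emeasure (T y) A = 0)) \<and>
    (\<exists>\<sigma> \<pi>.
      (\<forall>y\<in>space Q. \<sigma> y \<in> liftings (completion (T y))) \<and>
      \<pi> \<in> liftings (completion R) \<and>
      (\<forall>y\<in>space Q. \<forall>E\<in>sets (completion R).
          hsection (\<pi> E) y \<in> sets (completion (T y)) \<and>
          hsection (\<pi> E) y = \<sigma> y (hsection (\<pi> E) y)) \<and>
      (\<forall>A\<in>sets P. \<forall>B\<in>sets Q. \<pi> (A \<times> B) = (\<Union>y\<in>\<rho>' B. \<sigma> y A \<times> {y})))"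
proof -
  interpret P: prob_space P by fact
  interpret Q: prob_space Q by fact
  interpret R: prob_space R by fact
  interpret PQ: pair_prob_space P Q ..
  let ?PQ = "P \<Otimes>\<^sub>M Q"
  have setsR[simp]: "sets R = sets ?PQ" by fact
  have spaceR[simp]: "space R = space ?PQ" by (rule sets_eq_imp_space_eq) simp
  obtain f where f[measurable]: "f \<in> borel_measurable ?PQ" and R: "R = density ?PQ f"
    using PQ.Radon_Nikodym[OF assms(8) setsR] by auto
  obtain s where s: "section_lifting P Q (sets P) s" using exists_section_lifting[OF assms(1,2)] by blast
  obtain \<rho> where \<rho>: "section_lifting Q P (sets Q) \<rho>" using exists_section_lifting[OF assms(2,1)] by blast
  note s_hom = section_lifting_setsD(1)[OF s] and \<rho>_hom = section_lifting_setsD(1)[OF \<rho>]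
  note s_AE = section_lifting_setsD(2)[OF s] and \<rho>_AE = section_lifting_setsD(2)[OF \<rho>]
  have "\<exists>H. (\<forall>y\<in>space Q. set_hom (space ?PQ) (null_sets ?PQ) (sets ?PQ) (space P) (H y) \<and>
      (\<forall>E\<in>sets ?PQ. H y E \<in> sets (completion P) \<and> s (main_part P (H y E)) = H y E) \<and>
      (\<forall>A\<in>sets P. \<forall>B\<in>sets Q. H y (A \<times> B) = (if y \<in> \<rho> B then s A else {}))) \<and>
    (\<forall>E\<in>sets ?PQ. AE y in Q. H y E = s (hsection E y))"
    by (rule exists_section_homs[OF assms(1,2) s \<rho>])
  then obtain H where H: "(\<forall>y\<in>space Q. set_hom (space ?PQ) (null_sets ?PQ) (sets ?PQ) (space P) (H y) \<and>
      (\<forall>E\<in>sets ?PQ. H y E \<in> sets (completion P) \<and> s (main_part P (H y E)) = H y E) \<and>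
      (\<forall>A\<in>sets P. \<forall>B\<in>sets Q. H y (A \<times> B) = (if y \<in> \<rho> B then s A else {}))) \<and>
    (\<forall>E\<in>sets ?PQ. AE y in Q. H y E = s (hsection E y))"
    by (elim exE)
  have H_hom: "set_hom (space ?PQ) (null_sets ?PQ) (sets ?PQ) (space P) (H y)" if "y \<in> space Q" for y
    using H that by simp
  have H_sets: "H y E \<in> sets (completion P)" and H_fixed: "s (main_part P (H y E)) = H y E"
    if "y \<in> space Q" "E \<in> sets ?PQ" for y E using H that by simp_all
  have H_rect: "H y (A \<times> B) = (if y \<in> \<rho> B then s A else {})" if "y \<in> space Q" "A \<in> sets P" "B \<in> sets Q" for y A B
    using H that by simp
  have H_AE: "AE y in Q. H y E = s (hsection E y)" if "E \<in> sets ?PQ" for E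
    using H[THEN conjunct2] that by (rule bspec)

  \<comment> \<open>\<open>N\<close> carries \<open>R\<close>: a measurable set is null for
    \<open>R\<close> exactly when its intersection with \<open>N\<close> is null for the product
    measure.\<close>
  define N where "N = {z \<in> space ?PQ. 0 < f z}"
  have N: "N \<in> sets ?PQ" unfolding N_def by measurable
  have N_sec: "hsection N y \<in> sets P" for y using N by (rule hsection_sets)
  have N_iff: "x \<in> hsection N y \<longleftrightarrow> 0 < f (x, y)" if "x \<in> space P" "y \<in> space Q" for x y
    using that by (simp add: N_def hsection_def space_pair_measure)
  have R_times: "emeasure R (A \<times> B) = (\<integral>\<^sup>+y\<in>B. (\<integral>\<^sup>+x\<in>A. f (x, y) \<partial>P) \<partial>Q)"
    if "A \<in> sets P" "B \<in> sets Q" for A B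
    unfolding R by (rule nn_integral_indicator_times[OF _ f that]) unfold_locales

  \<comment> \<open>As \<open>Q\<close> is the second marginal of \<open>R\<close>, the inner
    integral is a density of \<open>Q\<close> with respect to itself.\<close>
  have "AE y in Q. (\<integral>\<^sup>+x. f (x, y) \<partial>P) = 1"
  proof (rule Q.density_unique)
    show "density Q (\<lambda>y. \<integral>\<^sup>+x. f (x, y) \<partial>P) = density Q (\<lambda>_. 1)"
    proof (rule measure_eqI)
      fix B assume "B \<in> sets (density Q (\<lambda>y. \<integral>\<^sup>+x. f (x, y) \<partial>P))"
      then have B: "B \<in> sets Q" by simp
      have "emeasure (density Q (\<lambda>y. \<integral>\<^sup>+x. f (x, y) \<partial>P)) B = (\<integral>\<^sup>+y\<in>B. (\<integral>\<^sup>+x. f (x, y) \<partial>P) \<partial>Q)"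
        using B by (intro emeasure_density) auto
      also have "\<dots> = (\<integral>\<^sup>+y\<in>B. (\<integral>\<^sup>+x\<in>space P. f (x, y) \<partial>P) \<partial>Q)"
        by (intro nn_integral_cong arg_cong2[where f = "(*)"]) auto
      also have "\<dots> = emeasure R (space P \<times> B)" using B by (intro R_times[symmetric]) auto
      also have "space P \<times> B = snd -` B \<inter> space R"
        using sets.sets_into_space[OF B] by (auto simp: space_pair_measure)
      also have "emeasure R \<dots> = emeasure (distr R Q snd) B"
        using B by (intro emeasure_distr[symmetric]) (simp_all cong: measurable_cong_sets)
      also have "\<dots> = emeasure (density Q (\<lambda>_. 1)) B"
        unfolding assms(7) by (simp add: density_1)
      finally show "emeasure (density Q (\<lambda>y. \<integral>\<^sup>+x. f (x, y) \<partial>P)) B = emeasure (density Q (\<lambda>_. 1)) B" .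
    qed simp
  qed auto
  with H_AE[OF N] have "AE y in Q. (\<integral>\<^sup>+x. f (x, y) \<partial>P) = 1 \<and> H y N = s (hsection N y)"
    by eventually_elim simp
  then obtain Z where Z: "Z \<in> null_sets Q"
    "{y \<in> space Q. \<not> ((\<integral>\<^sup>+x. f (x, y) \<partial>P) = 1 \<and> H y N = s (hsection N y))} \<subseteq> Z"
    by (auto simp: eventually_ae_filter)
  have "\<not> space Q \<subseteq> Z"
  proof
    assume "space Q \<subseteq> Z"
    then have "space Q \<in> null_sets Q" using Z(1) by (rule null_sets_subset[rotated 2]) simp
    then show False using Q.emeasure_space_1 by auto
  qed
  then obtain y0 where y0: "y0 \<in> space Q" "y0 \<notin> Z" by blast
  \<comment> \<open>Bad points are redirected to the regular point \<open>y0\<close>. Later objects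
    are formed at \<open>q y\<close>, so both conditions hold for every y in the space, while
    \<open>q\<close> is the identity almost everywhere.\<close>
  define q where "q y = (if y \<in> Z then y0 else y)" for y
  have q_space: "q y \<in> space Q" if "y \<in> space Q" for y using that y0 by (simp add: q_def)
  have q_norm: "(\<integral>\<^sup>+x. f (x, q y) \<partial>P) = 1" and q_N: "H (q y) N = s (hsection N (q y))"
    if "y \<in> space Q" for y using that y0 Z(2) by (auto simp: q_def split: if_splits)
  have q_AE: "AE y in Q. q y = y" using AE_not_in[OF Z(1)] by eventually_elim (simp add: q_def)
  have q_meas[measurable]: "q \<in> measurable Q Q"
    unfolding q_def using Z(1) y0(1) by (intro measurable_If_set) auto

  define D where "D y = s (hsection N y)" for y
  have D_sub: "D y \<subseteq> space P" for y unfolding D_def by (rule set_homD(1)[OF s_hom N_sec])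
  have D_ne: "D (q y) \<noteq> {}" if y: "y \<in> space Q" for y
  proof
    assume "D (q y) = {}"
    then have empty: "s (hsection N (q y)) = {}" by (simp add: D_def)
    have "AE x in P. x \<notin> hsection N (q y)"
      using s_AE[OF N_sec[of "q y"]] unfolding empty by simp
    with AE_space have "AE x in P. f (x, q y) = 0"
      by eventually_elim (use N_iff q_space[OF y] in auto)
    then have "(\<integral>\<^sup>+x. f (x, q y) \<partial>P) = (\<integral>\<^sup>+x. 0 \<partial>P)" by (rule nn_integral_cong_AE)
    then show False using q_norm[OF y] by simp
  qed
  \<comment> \<open>Points outside \<open>D y\<close> go to one common point, for which any element
    of \<open>D y\<close> serves. At \<open>q y\<close> the set \<open>D (q y)\<close> carries
    \<open>T y\<close>, so the retraction is the identity almost everywhere for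
    \<open>T y\<close>.\<close>
  define r where "r y x = (if x \<in> D y then x else (SOME c. c \<in> D y))" for y x
  have r_D: "r (q y) x \<in> D (q y)" if "y \<in> space Q" for y x
    using D_ne[OF that] by (auto simp: r_def intro: someI)

  have r_space: "r (q y) x \<in> space P" if "y \<in> space Q" for y x
    using r_D[OF that] D_sub by blast

  define T where "T y = density P (\<lambda>x. f (x, q y))" for y
  have fq[measurable]: "(\<lambda>x. f (x, q y)) \<in> borel_measurable P" if "y \<in> space Q" for y
    using q_space[OF that] by measurable
  have sets_T[simp]: "sets (T y) = sets P" "space (T y) = space P" for y by (simp_all add: T_def)
  have emeasure_T: "emeasure (T y) A = (\<integral>\<^sup>+x\<in>A. f (x, q y) \<partial>P)" if "y \<in> space Q" "A \<in> sets P" for y A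
    unfolding T_def using fq[OF that(1)] that(2) by (rule emeasure_density)
  have T_prob: "prob_space (T y)" if "y \<in> space Q" for y
  proof (rule prob_spaceI)
    have "emeasure (T y) (space (T y)) = (\<integral>\<^sup>+x\<in>space P. f (x, q y) \<partial>P)" using that by (simp add: emeasure_T)
    also have "\<dots> = (\<integral>\<^sup>+x. f (x, q y) \<partial>P)" by (intro nn_integral_cong) simp
    finally show "emeasure (T y) (space (T y)) = 1" using q_norm[OF that] by simp
  qed
  have T_AE: "(AE x in T y. \<phi> x) \<longleftrightarrow> (AE x in P. 0 < f (x, q y) \<longrightarrow> \<phi> x)" if "y \<in> space Q" for y \<phi>
    unfolding T_def using fq[OF that] by (rule AE_density)
  have T_AE_P: "AE x in T y. \<phi> x" if "y \<in> space Q" "AE x in P. \<phi> x" for y \<phi>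
    unfolding T_AE[OF that(1)] using that(2) by eventually_elim simp
  have T_r: "AE x in T y. r (q y) x = x" if y: "y \<in> space Q" for y
    unfolding T_AE[OF y] using s_AE[OF N_sec[of "q y"]] AE_space
    by eventually_elim (use N_iff q_space[OF y] in \<open>auto simp: r_def D_def\<close>)
  have T_null: "A \<in> null_sets (T y) \<longleftrightarrow> A \<inter> hsection N (q y) \<in> null_sets P" if y: "y \<in> space Q" and A: "A \<in> sets P" for y A
  proof -
    have "A \<in> null_sets (T y) \<longleftrightarrow> (AE x in T y. x \<notin> A)" using A by (intro AE_iff_null_sets) simp
    also have "\<dots> \<longleftrightarrow> (AE x in P. x \<notin> A \<inter> hsection N (q y))"
      unfolding T_AE[OF y] by (intro AE_cong) (use N_iff q_space[OF y] in auto)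
    also have "\<dots> \<longleftrightarrow> A \<inter> hsection N (q y) \<in> null_sets P"
      using A N_sec by (intro AE_iff_null_sets[symmetric]) auto
    finally show ?thesis .
  qed
  have s_D: "A \<inter> hsection N y \<in> null_sets P \<longleftrightarrow> s A \<inter> D y = {}" if A: "A \<in> sets P" for A y
  proof
    assume "A \<inter> hsection N y \<in> null_sets P"
    then show "s A \<inter> D y = {}"
      unfolding D_def by (rule set_hom_disjoint[OF s_hom sets.algebra_axioms A N_sec])
  next
    assume "s A \<inter> D y = {}"
    then have disj: "x \<notin> s A \<or> x \<notin> s (hsection N y)" for x by (auto simp: D_def)
    have "AE x in P. x \<notin> A \<inter> hsection N y"
      using s_AE[OF A] s_AE[OF N_sec[of y]] by eventually_elim (use disj in auto)
    then show "A \<inter> hsection N y \<in> null_sets P"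
      using A N_sec by (subst AE_iff_null_sets) auto
  qed

  \<comment> \<open>Intersecting \<open>s A\<close> with the support would not respect complements;
    a preimage does. As the retraction always lands in \<open>D (q y)\<close>, null sets of
    \<open>T y\<close> become empty even at points off the support.\<close>
  define g where "g y A = {x \<in> space P. r (q y) x \<in> s A}" for y A
  define \<sigma> where "\<sigma> y A = g y (main_part (T y) A)" for y A
  have g_hom: "set_hom (space (T y)) (null_sets (T y)) (sets (T y)) (space (T y)) (g y)" if y: "y \<in> space Q" for y
    unfolding sets_T
  proof (rule set_homI)
    fix A assume A: "A \<in> sets P"
    show "g y A \<subseteq> space P" by (auto simp: g_def)
    show "g y (space P - A) = space P - g y A"
      using r_space[OF y] set_homD(2)[OF s_hom A] by (auto simp: g_def)
    show "g y A = {}" if "A \<in> null_sets (T y)"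
    proof -
      have "s A \<inter> D (q y) = {}" using that T_null[OF y A] s_D[OF A] by simp
      then show ?thesis using r_D[OF y] by (auto simp: g_def)
    qed
    show "g y (A \<inter> B) = g y A \<inter> g y B" if "B \<in> sets P" for B
      using set_homD(3)[OF s_hom A that] by (auto simp: g_def)
  qed
  have g_AE: "AE x in T y. x \<in> g y A \<longleftrightarrow> x \<in> A" if y: "y \<in> space Q" and A: "A \<in> sets P" for y A
    using T_r[OF y] T_AE_P[OF y s_AE[OF A]] AE_space by eventually_elim (simp add: g_def)
  have \<sigma>_lifting: "\<sigma> y \<in> liftings (completion (T y))" if y: "y \<in> space Q" for y
    unfolding \<sigma>_def by (rule completion_liftingI[OF g_hom[OF y]]) (simp add: g_AE[OF y])

  define \<rho>' where "\<rho>' B = {y \<in> space Q. q y \<in> \<rho> B}" for B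
  have \<rho>'_AE: "AE y in Q. y \<in> \<rho>' B \<longleftrightarrow> y \<in> B" if "B \<in> sets Q" for B
    using \<rho>_AE[OF that] q_AE AE_space by eventually_elim (simp add: \<rho>'_def)
  have \<rho>'_lifting: "\<rho>' \<in> liftings Q"
  proof (rule liftingsI)
    show "\<rho>' B \<in> sets Q" if B: "B \<in> sets Q" for B
    proof -
      \<comment> \<open>Completeness of \<open>Q\<close> enters here: \<open>\<rho>' B\<close> is
        known only to equal \<open>B\<close> almost everywhere.\<close>
      have "\<rho>' B \<in> sets (completion Q)"
        by (rule sets_completion_AE_eq[OF _ _ \<rho>'_AE[OF B]]) (use B in \<open>auto simp: \<rho>'_def\<close>)
      then show ?thesis using sets_completion_complete[OF assms(3)] by simp
    qed
    show "set_hom (space Q) (null_sets Q) (sets Q) (space Q) \<rho>'"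
    proof (rule set_homI)
      fix A assume A: "A \<in> sets Q"
      show "\<rho>' A \<subseteq> space Q" by (auto simp: \<rho>'_def)
      show "\<rho>' (space Q - A) = space Q - \<rho>' A"
        using q_space set_homD(2)[OF \<rho>_hom A] by (auto simp: \<rho>'_def)
      show "\<rho>' A = {}" if "A \<in> null_sets Q" using set_homD(4)[OF \<rho>_hom A that] by (simp add: \<rho>'_def)
      show "\<rho>' (A \<inter> B) = \<rho>' A \<inter> \<rho>' B" if "B \<in> sets Q" for B
        using set_homD(3)[OF \<rho>_hom A that] by (auto simp: \<rho>'_def)
    qed
  qed (rule \<rho>'_AE)

  define k where "k E = {z \<in> space P \<times> space Q. r (q (snd z)) (fst z) \<in> H (q (snd z)) E}" for E
  define \<pi> where "\<pi> E = k (main_part R E)" for E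
  have k_hom: "set_hom (space R) (null_sets R) (sets R) (space R) k"
    unfolding setsR spaceR space_pair_measure
  proof (rule set_homI)
    fix E assume E: "E \<in> sets ?PQ"
    show "k E \<subseteq> space P \<times> space Q" by (auto simp: k_def)
    show "k (space P \<times> space Q - E) = space P \<times> space Q - k E"
    proof -
      have "H (q y) (space P \<times> space Q - E) = space P - H (q y) E" if "y \<in> space Q" for y
        using set_homD(2)[OF H_hom[OF q_space[OF that]] E] by (simp add: space_pair_measure)
      then show ?thesis using r_space by (auto simp: k_def)
    qed
    show "k E = {}" if ER: "E \<in> null_sets R"
    proof -
      have "AE z in ?PQ. z \<in> E \<longrightarrow> f z = 0" using ER unfolding R by (simp add: null_sets_density_iff)
      then have "AE z in ?PQ. z \<notin> E \<inter> N" by eventually_elim (auto simp: N_def)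
      then have EN: "E \<inter> N \<in> null_sets ?PQ" using E N by (subst AE_iff_null_sets) auto
      \<comment> \<open>\<open>H (q y) E\<close> is disjoint from \<open>H (q y) N\<close>, which is
        \<open>D (q y)\<close> for every y by the choice of \<open>q\<close>. The retraction takes
        its values in \<open>D (q y)\<close>, so all fibres of \<open>k E\<close> are empty.\<close>
      have "H (q y) E \<inter> D (q y) = {}" if y: "y \<in> space Q" for y
        using set_hom_disjoint[OF H_hom[OF q_space[OF y]] sets.algebra_axioms E N EN] q_N[OF y]
        by (simp add: D_def)
      then show ?thesis using r_D by (fastforce simp: k_def)
    qed
    show "k (E \<inter> F) = k E \<inter> k F" if F: "F \<in> sets ?PQ" for F
      using set_homD(3)[OF H_hom[OF q_space] E F] by (auto simp: k_def)
  qed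
  have k_AE: "AE z in R. z \<in> k E \<longleftrightarrow> z \<in> E" if "E \<in> sets R" for E
  proof -
    have E: "E \<in> sets ?PQ" using that by simp
    have "AE y in Q. q y = y \<and> H y E = s (hsection E y)"
      using q_AE H_AE[OF E] by eventually_elim simp
    then have "AE z in ?PQ. q (snd z) = snd z \<and> H (snd z) E = s (hsection E (snd z))"
      by (rule AE_pair_snd[OF Q.sigma_finite_measure_axioms])
    \<comment> \<open>Almost everywhere on \<open>N\<close> nothing is moved: \<open>q\<close> fixes
      y, compatibility of \<open>s\<close> for \<open>N\<close> puts x into \<open>D y\<close>,
      where the retraction fixes it, and compatibility for \<open>E\<close> compares
      \<open>s (hsection E y)\<close> with \<open>E\<close>. Off \<open>N\<close> the density
      vanishes.\<close>
    then have "AE z in ?PQ. 0 < f z \<longrightarrow> (z \<in> k E \<longleftrightarrow> z \<in> E)"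
      using section_lifting_setsD(3)[OF s E] section_lifting_setsD(3)[OF s N] AE_space
    proof eventually_elim
      case (elim z)
      then have z: "z \<in> space P \<times> space Q" by (simp add: space_pair_measure)
      show ?case
      proof
        assume "0 < f z"
        then have "z \<in> N" using elim by (simp add: N_def)
        then have "r (q (snd z)) (fst z) = fst z" using elim by (simp add: r_def D_def)
        then show "z \<in> k E \<longleftrightarrow> z \<in> E" using elim z by (simp add: k_def)
      qed
    qed
    then show ?thesis unfolding R by (subst AE_density) auto
  qed
  have \<pi>_lifting: "\<pi> \<in> liftings (completion R)"
    unfolding \<pi>_def by (rule completion_liftingI[OF k_hom k_AE])

  have \<pi>_sec: "hsection (\<pi> E) y \<in> sets (completion (T y)) \<and> hsection (\<pi> E) y = \<sigma> y (hsection (\<pi> E) y)"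
    if y: "y \<in> space Q" and E: "E \<in> sets (completion R)" for y E
  proof -
    \<comment> \<open>The section of \<open>\<pi> E\<close> is the preimage of \<open>W\<close>
      under the retraction. For \<open>T y\<close> it is almost everywhere the main part of
      \<open>W\<close>, and since \<open>W\<close> is fixed, \<open>g y\<close> returns the same
      preimage.\<close>
    define W where "W = H (q y) (main_part R E)"
    have "main_part R E \<in> sets ?PQ" using main_part_sets[OF E] by simp
    then have W: "W \<in> sets (completion P)" "s (main_part P W) = W"
      unfolding W_def using H_sets H_fixed q_space[OF y] by auto
    have sec: "hsection (\<pi> E) y = {x \<in> space P. r (q y) x \<in> W}"
      using y by (auto simp: hsection_def \<pi>_def k_def W_def)
    have AE: "AE x in T y. x \<in> hsection (\<pi> E) y \<longleftrightarrow> x \<in> main_part P W"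
      using T_r[OF y] T_AE_P[OF y main_part_AE[OF W(1)]] AE_space
      by eventually_elim (simp add: sec)
    have mW: "main_part P W \<in> sets (T y)" using main_part_sets[OF W(1)] by simp
    have m: "hsection (\<pi> E) y \<in> sets (completion (T y))"
      by (rule sets_completion_AE_eq[OF sets_completionI_sets[OF mW] _ AE]) (auto simp: sec)
    have "\<sigma> y (hsection (\<pi> E) y) = g y (main_part P W)"
      unfolding \<sigma>_def by (rule set_hom_main_part[OF g_hom[OF y] refl m mW AE])
    also have "\<dots> = hsection (\<pi> E) y" by (simp add: g_def sec W(2))
    finally show ?thesis using m by simp
  qed
  have \<pi>_rect: "\<pi> (A \<times> B) = (\<Union>y\<in>\<rho>' B. \<sigma> y A \<times> {y})" if A: "A \<in> sets P" and B: "B \<in> sets Q" for A B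
  proof -
    have "A \<times> B \<in> sets R" using A B by simp
    then have "\<pi> (A \<times> B) = {z \<in> space P \<times> space Q. r (q (snd z)) (fst z) \<in> H (q (snd z)) (A \<times> B)}"
      by (simp add: \<pi>_def k_def)
    also have "\<dots> = {z \<in> space P \<times> space Q. q (snd z) \<in> \<rho> B \<and> r (q (snd z)) (fst z) \<in> s A}"
      using H_rect[OF q_space A B] by (auto split: if_splits)
    also have "\<dots> = (\<Union>y\<in>\<rho>' B. g y A \<times> {y})" by (auto simp: \<rho>'_def g_def)
    finally show ?thesis using A by (simp add: \<sigma>_def)
  qed
  have zero: "emeasure (T y) A = 0"
    if A: "A \<in> sets P" and B: "B \<in> sets Q" and R0: "emeasure R (A \<times> B) = 0" and y: "y \<in> \<rho>' B" for A B y
  proof -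
    have yQ: "y \<in> space Q" and qy: "q y \<in> \<rho> B" using y by (auto simp: \<rho>'_def)
    have AB: "A \<times> B \<in> sets ?PQ" using A B by simp
    have "A \<times> B \<in> null_sets R" using R0 AB by (simp add: null_sets_def)
    then have "AE z in ?PQ. z \<in> A \<times> B \<longrightarrow> f z = 0" unfolding R by (simp add: null_sets_density_iff)
    then have "AE z in ?PQ. z \<notin> (A \<times> B) \<inter> N" by eventually_elim (auto simp: N_def)
    then have "(A \<times> B) \<inter> N \<in> null_sets ?PQ" using AB N by (subst AE_iff_null_sets) auto
    \<comment> \<open>The image of the rectangle at \<open>q y\<close> is \<open>s A\<close>,
      because \<open>q y\<close> lies in \<open>\<rho> B\<close>. So \<open>s A\<close> misses the
      support, which means that \<open>A\<close> is null for \<open>T y\<close>.\<close>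
    then have "H (q y) (A \<times> B) \<inter> H (q y) N = {}"
      by (rule set_hom_disjoint[OF H_hom[OF q_space[OF yQ]] sets.algebra_axioms AB N])
    then have "s A \<inter> D (q y) = {}"
      using H_rect[OF q_space[OF yQ] A B] qy q_N[OF yQ] by (simp add: D_def)
    then show ?thesis using T_null[OF yQ A] s_D[OF A] by auto
  qed
  have "product_rcp P Q R T"
    unfolding product_rcp_def
  proof (intro conjI ballI)
    show "prob_space (T y)" if "y \<in> space Q" for y using that by (rule T_prob)
    show "sets (T y) = sets P" for y by simp
    fix A assume A[measurable]: "A \<in> sets P"
    have "(\<lambda>y. \<integral>\<^sup>+x\<in>A. f (x, q y) \<partial>P) \<in> borel_measurable Q" by measurable
    then show "(\<lambda>y. emeasure (T y) A) \<in> borel_measurable Q"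
      using emeasure_T[OF _ A] by (simp cong: measurable_cong)
    fix B assume B: "B \<in> sets Q"
    show "emeasure R (A \<times> B) = (\<integral>\<^sup>+y\<in>B. emeasure (T y) A \<partial>Q)"
      unfolding R_times[OF A B]
    proof (rule nn_integral_cong_AE)
      show "AE y in Q. (\<integral>\<^sup>+x\<in>A. f (x, y) \<partial>P) * indicator B y = emeasure (T y) A * indicator B y"
        using q_AE AE_space by eventually_elim (simp add: emeasure_T[OF _ A])
    qed
  qed
  then show ?thesis
    using \<rho>'_lifting zero \<sigma>_lifting \<pi>_lifting \<pi>_sec \<pi>_rect
    by (intro exI[of _ T] exI[of _ \<rho>'] conjI exI[of _ \<sigma>] exI[of _ \<pi>] ballI impI disjI2) auto
qed

end
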